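(* Let $\Sigma\subset\mathbb{B}^3$ be a smooth, properly immersed free boundary minimal surface with unit normal $\nu=(\nu_1,\nu_2,\nu_3)$, such that the span of the normal components, $V=\operatorname{span}(\nu_1,\nu_2,\nu_3)\subset C^\infty(\Sigma)$, is an eigen-subspace of the Jacobi-Steklov problem. Then $\Sigma$ must be rotationally symmetric.
   Context: $\mathbb{B}^3$ is the unit ball of $\mathbb{R}^3$ centered at the origin, $\mathbb{S}^2=\partial\mathbb{B}^3$. A (smooth, properly immersed) free boundary minimal surface $\Sigma=X(\Sigma_0)$ in $\mathbb{B}^3$ is the image of a smooth surface with boundary $\Sigma_0$ under a proper isometric immersion $X$ into $\mathbb{B}^3$ such that $\partial\Sigma=\Sigma\cap\partial\mathbb{B}^3$, the mean curvature vanishes, and $\Sigma$ meets $\partial\mathbb{B}^3$ orthogonally along $\partial\Sigma$. The immersed surface is identified with $\Sigma_0$, so functions on $\Sigma$ are functions on $\Sigma_0$. $\nu:\Sigma\to\mathbb{S}^2$ is a choice of smooth unit normal field, and $\nu_i=\nu\cdot e_i$ for an orthonormal basis $e_1,e_2,e_3$ of $\mathbb{R}^3$. $\mathbf{h}$ is the second fundamental form and $|\mathbf{h}|$ its norm, $\eta$ is the outward unit conormal of $\Sigma$ along $\partial\Sigma$, and $J=\Delta+|\mathbf{h}|^2$ is the Jacobi operator ($\Delta$ the Laplacian of $\Sigma$). A function $u\in C^\infty(\Sigma)$ is an eigenfunction with eigenvalue $\lambda$ of the Jacobi-Steklov problem if $Ju=0$ on $\Sigma$ and $D_\eta u=\lambda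 u$ on $\partial\Sigma$. A subspace $W\subset C^\infty(\Sigma)$ is an eigen-subspace if it has a basis consisting of such eigenfunctions (possibly with different eigenvalues). Rotationally symmetric means invariant under all rotations of $\mathbb{R}^3$ about some line through the origin.
   Formalization: The surface is additionally assumed to be connected; without this the claim fails, for example for the union of two flat unit discs through the origin in different planes, where V consists of eigenfunctions with eigenvalue 0 but the union is not rotationally symmetric. *)

theory Defs
  imports "HOL-Analysis.Analysis" "HOL-Library.Function_Algebras"
begin

section \<open>Smooth maps on subsets of the half-plane\<close>

primrec Ck_on_open :: "nat \<Rightarrow> 'a::euclidean_space set \<Rightarrow> ('a \<Rightarrow> 'b::real_normed_vector) \<Rightarrow> bool" where
  "Ck_on_open 0 W F \<longleftrightarrow> continuous_on W F"
| "Ck_on_open (Suc k) W F \<longleftrightarrow>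
     (\<forall>x\<in>W. F differentiable (at x)) \<and>
     (\<forall>v. Ck_on_open k W (\<lambda>x. frechet_derivative F (at x) v))"

text \<open>As usual for manifolds with boundary, smoothness on a set that need not be open means local
  extendability to a smooth map on an open set.\<close>

definition smooth_map_on :: "'a::euclidean_space set \<Rightarrow> ('a \<Rightarrow> 'b::real_normed_vector) \<Rightarrow> bool" where
  "smooth_map_on D f \<longleftrightarrow>
     (\<forall>x\<in>D. \<exists>W F. open W \<and> x \<in> W \<and> (\<forall>k. Ck_on_open k W F) \<and> (\<forall>y\<in>D \<inter> W. F y = f y))"

definition half_plane :: "(real^2) set" where
  "half_plane = {q. q $ 2 \<ge> 0}"


section \<open>Smooth surfaces with boundary\<close>

text \<open>The underlying space of the surface is the whole type \<open>'m\<close>, so that functions on the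
  surface are exactly the functions on \<open>'m\<close>. The Hausdorff property and second
  countability are expressed by the sort of \<open>'m\<close>. A chart is a pair \<open>(U, \<phi>)\<close> of
  a domain and a coordinate map into the half-plane; values of \<open>\<phi>\<close> off \<open>U\<close> are
  irrelevant.\<close>

type_synonym 'm chart = "'m set \<times> ('m \<Rightarrow> real^2)"

definition chart_image :: "'m chart \<Rightarrow> (real^2) set" where
  "chart_image c = snd c ` fst c"

definition chart_inv :: "'m chart \<Rightarrow> real^2 \<Rightarrow> 'm" where
  "chart_inv c = inv_into (fst c) (snd c)"

definition is_chart :: "'m::topological_space chart \<Rightarrow> bool" where
  "is_chart c \<longleftrightarrow>
     open (fst c) \<and> openin (top_of_set half_plane) (chart_image c) \<and>
     homeomorphism (fst c) (chart_image c) (snd c) (chart_inv c)"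

definition smooth_surface :: "'m::{t2_space, second_countable_topology} chart set \<Rightarrow> bool" where
  "smooth_surface A \<longleftrightarrow>
     (\<forall>c\<in>A. is_chart c) \<and> (\<Union>c\<in>A. fst c) = UNIV \<and>
     (\<forall>c\<in>A. \<forall>d\<in>A. smooth_map_on (snd c ` (fst c \<inter> fst d)) (snd d \<circ> chart_inv c)) \<and>
     connected (UNIV :: 'm set)"

definition surface_boundary :: "'m chart set \<Rightarrow> 'm set" where
  "surface_boundary A = {p. \<exists>c\<in>A. p \<in> fst c \<and> snd c p $ 2 = 0}"

definition smooth_fun :: "'m chart set \<Rightarrow> ('m \<Rightarrow> 'b::real_normed_vector) \<Rightarrow> bool" where
  "smooth_fun A f \<longleftrightarrow> (\<forall>c\<in>A. smooth_map_on (chart_image c) (f \<circ> chart_inv c))"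

text \<open>The derivative of \<open>f\<close> at \<open>p\<close> in the direction with coordinates \<open>v\<close> in the
  chart \<open>c\<close>. The derivative within the chart image makes sense at boundary points too: it is
  unique because the image is relatively open in the half-plane.\<close>

definition chart_deriv :: "'m chart \<Rightarrow> ('m \<Rightarrow> 'b::real_normed_vector) \<Rightarrow> 'm \<Rightarrow> real^2 \<Rightarrow> 'b" where
  "chart_deriv c f p v =
     frechet_derivative (f \<circ> chart_inv c) (at (snd c p) within chart_image c) v"

definition pd :: "'m chart \<Rightarrow> 2 \<Rightarrow> ('m \<Rightarrow> 'b::real_normed_vector) \<Rightarrow> 'm \<Rightarrow> 'b" where
  "pd c i f p = chart_deriv c f p (axis i 1)"


section \<open>Geometry of an immersed surface\<close>

definition smooth_immersion :: "'m chart set \<Rightarrow> ('m \<Rightarrow> real^3) \<Rightarrow> bool" where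
  "smooth_immersion A X \<longleftrightarrow>
     smooth_fun A X \<and> (\<forall>c\<in>A. \<forall>p\<in>fst c. inj (chart_deriv c X p))"

definition unit_normal :: "'m chart set \<Rightarrow> ('m \<Rightarrow> real^3) \<Rightarrow> ('m \<Rightarrow> real^3) \<Rightarrow> bool" where
  "unit_normal A X \<nu> \<longleftrightarrow>
     smooth_fun A \<nu> \<and> (\<forall>p. norm (\<nu> p) = 1) \<and>
     (\<forall>c\<in>A. \<forall>p\<in>fst c. \<forall>v. chart_deriv c X p v \<bullet> \<nu> p = 0)"

text \<open>The Riemannian metric of the surface is the one induced by \<open>X\<close> (the immersion is
  isometric). Below, \<open>metric\<close>, \<open>metric_inv\<close> and \<open>second_ff\<close> are the coordinate matrices
  \<open>(g\<^sub>i\<^sub>j)\<close>, \<open>(g\<^sup>i\<^sup>j)\<close> and \<open>(h\<^sub>i\<^sub>j)\<close>.\<close>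

definition metric :: "'m chart \<Rightarrow> ('m \<Rightarrow> real^3) \<Rightarrow> 'm \<Rightarrow> real^2^2" where
  "metric c X p = (\<chi> i j. pd c i X p \<bullet> pd c j X p)"

definition metric_inv :: "'m chart \<Rightarrow> ('m \<Rightarrow> real^3) \<Rightarrow> 'm \<Rightarrow> real^2^2" where
  "metric_inv c X p = matrix_inv (metric c X p)"

definition second_ff :: "'m chart \<Rightarrow> ('m \<Rightarrow> real^3) \<Rightarrow> ('m \<Rightarrow> real^3) \<Rightarrow> 'm \<Rightarrow> real^2^2" where
  "second_ff c X \<nu> p = (\<chi> i j. pd c i (pd c j X) p \<bullet> \<nu> p)"

definition mean_curvature :: "'m chart \<Rightarrow> ('m \<Rightarrow> real^3) \<Rightarrow> ('m \<Rightarrow> real^3) \<Rightarrow> 'm \<Rightarrow> real" where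
  "mean_curvature c X \<nu> p =
     (\<Sum>i\<in>UNIV. \<Sum>j\<in>UNIV. metric_inv c X p $ i $ j * second_ff c X \<nu> p $ i $ j)"

text \<open>\<open>|h|\<^sup>2 = g\<^sup>i\<^sup>k g\<^sup>j\<^sup>l h\<^sub>i\<^sub>j h\<^sub>k\<^sub>l\<close>\<close>

definition second_ff_norm2 :: "'m chart \<Rightarrow> ('m \<Rightarrow> real^3) \<Rightarrow> ('m \<Rightarrow> real^3) \<Rightarrow> 'm \<Rightarrow> real" where
  "second_ff_norm2 c X \<nu> p =
     (\<Sum>i\<in>UNIV. \<Sum>j\<in>UNIV. \<Sum>k\<in>UNIV. \<Sum>l\<in>UNIV.
        metric_inv c X p $ i $ k * metric_inv c X p $ j $ l *
        second_ff c X \<nu> p $ i $ j * second_ff c X \<nu> p $ k $ l)"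

text \<open>\<open>\<Delta>u = (det g)\<^sup>-\<^sup>1\<^sup>/\<^sup>2 \<partial>\<^sub>i ((det g)\<^sup>1\<^sup>/\<^sup>2 g\<^sup>i\<^sup>j \<partial>\<^sub>j u)\<close>\<close>

definition laplacian :: "'m chart \<Rightarrow> ('m \<Rightarrow> real^3) \<Rightarrow> ('m \<Rightarrow> real) \<Rightarrow> 'm \<Rightarrow> real" where
  "laplacian c X u p =
     (\<Sum>i\<in>UNIV. pd c i (\<lambda>q. sqrt (det (metric c X q)) *
         (\<Sum>j\<in>UNIV. metric_inv c X q $ i $ j * pd c j u q)) p) / sqrt (det (metric c X p))"

definition jacobi_op ::
    "'m chart \<Rightarrow> ('m \<Rightarrow> real^3) \<Rightarrow> ('m \<Rightarrow> real^3) \<Rightarrow> ('m \<Rightarrow> real) \<Rightarrow> 'm \<Rightarrow> real" where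
  "jacobi_op c X \<nu> u p = laplacian c X u p + second_ff_norm2 c X \<nu> p * u p"

text \<open>Coordinates, in a chart around the boundary point \<open>p\<close>, of the outward unit conormal
  \<open>\<eta>\<close>: the directions tangent to the boundary are those with \<open>v $ 2 = 0\<close>, and the outward
  ones point out of the half-plane. There is exactly one such \<open>w\<close> when \<open>X\<close> is an
  immersion.\<close>

definition conormal_coords :: "'m chart \<Rightarrow> ('m \<Rightarrow> real^3) \<Rightarrow> 'm \<Rightarrow> real^2" where
  "conormal_coords c X p =
     (THE w. w $ 2 < 0 \<and> norm (chart_deriv c X p w) = 1 \<and>
        (\<forall>v. v $ 2 = 0 \<longrightarrow> chart_deriv c X p w \<bullet> chart_deriv c X p v = 0))"

definition conormal_deriv :: "'m chart \<Rightarrow> ('m \<Rightarrow> real^3) \<Rightarrow> ('m \<Rightarrow> real) \<Rightarrow> 'm \<Rightarrow> real" where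
  "conormal_deriv c X u p = chart_deriv c u p (conormal_coords c X p)"


section \<open>Free boundary minimal surfaces in the unit ball\<close>

text \<open>Orthogonality along the boundary is the vanishing of the scalar product of \<open>\<nu>\<close> with the
  normal of the sphere, which at \<open>X p\<close> is \<open>X p\<close> itself. The boundary condition relates images
  in \<open>\<real>\<^sup>3\<close>.\<close>

definition free_boundary_minimal_surface ::
    "'m::{t2_space, second_countable_topology} chart set \<Rightarrow> ('m \<Rightarrow> real^3) \<Rightarrow> ('m \<Rightarrow> real^3) \<Rightarrow> bool" where
  "free_boundary_minimal_surface A X \<nu> \<longleftrightarrow>
     smooth_surface A \<and> smooth_immersion A X \<and> unit_normal A X \<nu> \<and>
     proper_map euclidean (top_of_set (cball 0 1)) X \<and>
     X ` surface_boundary A = range X \<inter> sphere 0 1 \<and>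
     (\<forall>c\<in>A. \<forall>p\<in>fst c. mean_curvature c X \<nu> p = 0) \<and>
     (\<forall>p\<in>surface_boundary A. \<nu> p \<bullet> X p = 0)"


section \<open>The Jacobi-Steklov problem\<close>

definition jacobi_steklov_eigenfunction ::
    "'m chart set \<Rightarrow> ('m \<Rightarrow> real^3) \<Rightarrow> ('m \<Rightarrow> real^3) \<Rightarrow> real \<Rightarrow> ('m \<Rightarrow> real) \<Rightarrow> bool" where
  "jacobi_steklov_eigenfunction A X \<nu> \<mu> u \<longleftrightarrow>
     smooth_fun A u \<and> u \<noteq> 0 \<and>
     (\<forall>c\<in>A. \<forall>p\<in>fst c. jacobi_op c X \<nu> u p = 0) \<and>
     (\<forall>c\<in>A. \<forall>p\<in>fst c \<inter> surface_boundary A. conormal_deriv c X u p = \<mu> * u p)"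

definition fun_scale :: "real \<Rightarrow> ('m \<Rightarrow> real) \<Rightarrow> 'm \<Rightarrow> real" where
  "fun_scale a f = (\<lambda>x. a * f x)"

global_interpretation fun_space: vector_space fun_scale
  by unfold_locales (auto simp: fun_scale_def algebra_simps fun_eq_iff)

definition eigen_subspace ::
    "'m chart set \<Rightarrow> ('m \<Rightarrow> real^3) \<Rightarrow> ('m \<Rightarrow> real^3) \<Rightarrow> ('m \<Rightarrow> real) set \<Rightarrow> bool" where
  "eigen_subspace A X \<nu> W \<longleftrightarrow>
     (\<exists>B. fun_space.independent B \<and> fun_space.span B = W \<and>
        (\<forall>u\<in>B. \<exists>\<mu>. jacobi_steklov_eigenfunction A X \<nu> \<mu> u))"

definition normal_component_span :: "('m \<Rightarrow> real^3) \<Rightarrow> ('m \<Rightarrow> real) set" where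
  "normal_component_span \<nu> = fun_space.span (range (\<lambda>i p. \<nu> p $ i))"

text \<open>\<open>Q\<close> ranges over the rotations about the line spanned by \<open>a\<close>.\<close>

definition rotationally_symmetric :: "(real^3) set \<Rightarrow> bool" where
  "rotationally_symmetric S \<longleftrightarrow>
     (\<exists>a. a \<noteq> 0 \<and> (\<forall>Q. rotation_matrix Q \<and> Q *v a = a \<longrightarrow> (\<lambda>x. Q *v x) ` S = S))"

end

theory Submission
  imports Defs "HOL-Complex_Analysis.Conformal_Mappings"
begin

text \<open>Along the boundary \<open>\<eta> = X\<close>, and since the sphere is umbilic \<open>D\<^sub>\<eta> \<nu> = \<kappa> X\<close>. The eigen-subspace
  hypothesis implies \<open>D\<^sub>\<eta> \<nu> = M \<nu>\<close> for a constant matrix \<open>M\<close>. Differentiating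
  \<open>\<kappa> X = M \<nu>\<close> along the boundary gives \<open>\<kappa>\<^sup>2 = det M\<close> wherever \<open>\<kappa> \<noteq> 0\<close>. Either \<open>\<kappa> \<noteq> 0\<close> is locally
  constant, \<open>n = \<nu> + \<kappa> X\<close> is constant on each arc, and \<open>M = n n\<^sup>T - 1\<close> shows that all boundary arcs are
  circles about the same axis; or \<open>\<kappa> = 0\<close> and the boundary consists of great circles.

  Minimality makes \<open>dX \<times> \<nu>\<close> closed, so locally \<open>X\<close> is the real part of a holomorphic null curve. The
  Cauchy data at a boundary circle agree with those of a catenoid (or a flat disk), so by boundary
  uniqueness of holomorphic functions the rotation field \<open>n \<times> X\<close> is tangent to the surface near the
  circle (or \<open>n \<bullet> X = 0\<close> there), and by the identity theorem everywhere. A compact set to which a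
  rotation field is tangent is invariant under the rotations.\<close>

section \<open>Second derivatives and primitives of closed forms\<close>

text \<open>Read in a chart, X and \<nu> are extended across the boundary line, and the geometric
  identities hold only on the closed half disc. Holomorphy is therefore expressed there pointwise,
  as df = c dz with a complex factor c, relative to a coordinate z that is a C^1 diffeomorphism of a
  full neighbourhood. Then extension by zero replaces any reflection principle at the boundary.
  Tangency of the rotation field n \<times> X is the vanishing of its product with \<nu>, and \<nu>
  is not holomorphic. Up to a positive factor, however, this product is the imaginary part of a
  finite sum of terms a cnj(b) with a and b holomorphic; that is why the identity theorem is proved
  for such sums. Tangency alone does not yet give invariance: at a boundary point the field must
  also point along the boundary, or its flow would leave the surface. For this the axis is read off
  from M at every boundary point, on whichever arc it lies. If \<kappa> vanishes throughout, a
  boundary point is still needed to start from; the maximum principle provides it.\<close>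

lemma second_difference_quotient:
  fixes f :: "'a::real_normed_vector \<Rightarrow> real"
  assumes "open W" "x \<in> W" and f': "\<And>y. y \<in> W \<Longrightarrow> (f has_derivative f' y) (at y)"
    and f'': "((\<lambda>y. f' y v) has_derivative f'') (at x)" and "e > 0"
  shows "\<exists>d>0. \<forall>s. 0 < s \<and> s < d \<longrightarrow>
    \<bar>f (x + s *\<^sub>R v + s *\<^sub>R w) - f (x + s *\<^sub>R v) - f (x + s *\<^sub>R w) + f x - s\<^sup>2 * f'' w\<bar> \<le> e * s\<^sup>2"
proof -
  \<comment> \<open>All points used below lie within \<open>s * C\<close> of \<open>x\<close>; the
    factor 2 makes the two first-order errors add up to at most \<open>e * s\<close>, and the 1
    keeps \<open>C\<close> positive.\<close>
  define C where "C = 2 * norm v + 2 * norm w + 1"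
  have "C > 0" unfolding C_def by (simp add: add_nonneg_pos)
  interpret L: bounded_linear f'' using f'' by (rule has_derivative_bounded_linear)
  obtain d1 where d1: "d1 > 0" "\<And>y. norm (y - x) < d1 \<Longrightarrow>
      norm (f' y v - f' x v - f'' (y - x)) \<le> (e / C) * norm (y - x)"
    using f''[unfolded has_derivative_at_alt] \<open>e > 0\<close> \<open>C > 0\<close>
    by (meson divide_pos_pos)
  obtain d2 where d2: "d2 > 0" "ball x d2 \<subseteq> W"
    using assms(1,2) open_contains_ball by blast
  define d where "d = min d1 d2 / C"
  have "d > 0" unfolding d_def using d1 d2 \<open>C > 0\<close> by auto
  moreover have "\<bar>f (x + s *\<^sub>R v + s *\<^sub>R w) - f (x + s *\<^sub>R v) - f (x + s *\<^sub>R w) + f x - s\<^sup>2 * f'' w\<bar> \<le> e * s\<^sup>2"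
    if s: "0 < s" "s < d" for s
  proof -
    have sC: "s * C < d1" "s * C < d2"
      using s \<open>C > 0\<close> unfolding d_def by (auto simp: pos_less_divide_eq)
    have nrm: "norm (t *\<^sub>R v + r *\<^sub>R w) \<le> s * (norm v + norm w)" 
      if "0 \<le> t" "t \<le> s" "0 \<le> r" "r \<le> s" for t r
    proof -
      have "norm (t *\<^sub>R v + r *\<^sub>R w) \<le> t * norm v + r * norm w"
        using norm_triangle_ineq[of "t *\<^sub>R v" "r *\<^sub>R w"] that by simp
      also have "\<dots> \<le> s * norm v + s * norm w"
        using that by (intro add_mono mult_right_mono) auto
      finally show ?thesis by (simp add: algebra_simps)
    qed
    have nC: "s * (norm v + norm w) < s * C" 
      unfolding C_def using s(1) norm_ge_zero[of v] norm_ge_zero[of w] by (intro mult_strict_left_mono) linarith+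
    have inW: "x + (t *\<^sub>R v + r *\<^sub>R w) \<in> W" if "0 \<le> t" "t \<le> s" "0 \<le> r" "r \<le> s" for t r
    proof -
      have "dist (x + (t *\<^sub>R v + r *\<^sub>R w)) x < d2" 
        using nrm[OF that] nC sC by (simp add: dist_norm)
      then show ?thesis using d2(2) by (auto simp: dist_commute)
    qed
    \<comment> \<open>The second difference is an increment of \<open>g\<close>; the mean value
      theorem turns it into a difference of first derivatives, which differentiability at
      \<open>x\<close> controls.\<close>
    define g where "g = (\<lambda>t. f (x + t *\<^sub>R v + s *\<^sub>R w) - f (x + t *\<^sub>R v))"
    have "(g has_derivative (\<lambda>h. h * (f' (x + t *\<^sub>R v + s *\<^sub>R w) v - f' (x + t *\<^sub>R v) v))) (at t within {0..s})"
      if t: "0 \<le> t" "t \<le> s" for t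
    proof -
      have A: "x + t *\<^sub>R v + s *\<^sub>R w \<in> W" "x + t *\<^sub>R v \<in> W"
        using inW[of t s] inW[of t 0] t s by (auto simp: add.assoc)
      have B: "bounded_linear (f' y)" if "y \<in> W" for y
        using f'[OF that] has_derivative_bounded_linear by blast
      have 1: "((\<lambda>t. f (x + t *\<^sub>R v + s *\<^sub>R w)) has_derivative (\<lambda>h. f' (x + t *\<^sub>R v + s *\<^sub>R w) (h *\<^sub>R v))) (at t within {0..s})"
        by (rule has_derivative_compose[where f="\<lambda>t. x + t *\<^sub>R v + s *\<^sub>R w" and g=f, OF _ f'[OF A(1)]])
           (auto intro!: derivative_eq_intros)
      have 2: "((\<lambda>t. f (x + t *\<^sub>R v)) has_derivative (\<lambda>h. f' (x + t *\<^sub>R v) (h *\<^sub>R v))) (at t within {0..s})"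
        by (rule has_derivative_compose[where f="\<lambda>t. x + t *\<^sub>R v" and g=f, OF _ f'[OF A(2)]])
           (auto intro!: derivative_eq_intros)
      show ?thesis unfolding g_def
        by (rule has_derivative_eq_rhs[OF has_derivative_diff[OF 1 2]])
           (simp add: fun_eq_iff linear_simps(5)[OF B[OF A(1)]] linear_simps(5)[OF B[OF A(2)]] right_diff_distrib)
    qed
    from mvt_simple[OF s(1) this] obtain t where t: "0 < t" "t < s"
      and gt: "g s - g 0 = s * (f' (x + t *\<^sub>R v + s *\<^sub>R w) v - f' (x + t *\<^sub>R v) v)" by auto
    have a: "norm (f' (x + (t *\<^sub>R v + s *\<^sub>R w)) v - f' x v - f'' (t *\<^sub>R v + s *\<^sub>R w)) \<le> (e/C) * (s * (norm v + norm w))"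
    proof -
      have "norm (t *\<^sub>R v + s *\<^sub>R w) < d1" using nrm[of t s] t s(1) nC sC by linarith
      then have "norm (f' (x + (t *\<^sub>R v + s *\<^sub>R w)) v - f' x v - f'' (t *\<^sub>R v + s *\<^sub>R w)) \<le> (e/C) * norm (t *\<^sub>R v + s *\<^sub>R w)"
        using d1(2)[of "x + (t *\<^sub>R v + s *\<^sub>R w)"] by (simp add: add_diff_eq)
      also have "\<dots> \<le> (e/C) * (s * (norm v + norm w))"
        using nrm[of t s] t s \<open>e > 0\<close> \<open>C > 0\<close> by (intro mult_left_mono) auto
      finally show ?thesis .
    qed
    have b: "norm (f' (x + t *\<^sub>R v) v - f' x v - f'' (t *\<^sub>R v)) \<le> (e/C) * (s * (norm v + norm w))"
    proof -
      have "norm (t *\<^sub>R v) \<le> s * (norm v + norm w)" using nrm[of t 0] t s(1) by (simp del: norm_scaleR)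
      then have "norm (t *\<^sub>R v) < d1" using nC sC by linarith
      then have "norm (f' (x + (t *\<^sub>R v)) v - f' x v - f'' (t *\<^sub>R v)) \<le> (e/C) * norm (t *\<^sub>R v)"
        using d1(2)[of "x + (t *\<^sub>R v)"] by simp
      also have "\<dots> \<le> (e/C) * (s * (norm v + norm w))"
        using nrm[of t 0] t s \<open>e > 0\<close> \<open>C > 0\<close> by (intro mult_left_mono) (auto simp del: norm_scaleR)
      finally show ?thesis .
    qed
    have "\<bar>f' (x + t *\<^sub>R v + s *\<^sub>R w) v - f' (x + t *\<^sub>R v) v - s * f'' w\<bar> \<le> 2 * ((e/C) * (s * (norm v + norm w)))"
      using a b by (simp add: L.add L.scaleR add.assoc)
    also have "\<dots> \<le> (e/C) * (s * C)"
    proof -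
      have "(e/C) * (s * (2 * (norm v + norm w))) \<le> (e/C) * (s * C)"
        using \<open>e > 0\<close> \<open>C > 0\<close> s(1) by (intro mult_left_mono) (auto simp: C_def)
      then show ?thesis by (simp only: mult.left_commute[of 2])
    qed
    also have "\<dots> = e * s" using \<open>C > 0\<close> by simp
    finally have "s * \<bar>f' (x + t *\<^sub>R v + s *\<^sub>R w) v - f' (x + t *\<^sub>R v) v - s * f'' w\<bar> \<le> s * (e * s)"
      using s by (intro mult_left_mono) auto
    moreover have "s * \<bar>f' (x + t *\<^sub>R v + s *\<^sub>R w) v - f' (x + t *\<^sub>R v) v - s * f'' w\<bar> = \<bar>(g s - g 0) - s\<^sup>2 * f'' w\<bar>"
    proof -
      have eq: "(g s - g 0) - s\<^sup>2 * f'' w = s * (f' (x + t *\<^sub>R v + s *\<^sub>R w) v - f' (x + t *\<^sub>R v) v - s * f'' w)"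
        unfolding gt by (simp add: right_diff_distrib power2_eq_square)
      show ?thesis unfolding eq abs_mult using s(1) by simp
    qed
    ultimately show ?thesis unfolding g_def by (simp add: power2_eq_square algebra_simps)
  qed
  ultimately show ?thesis by blast
qed

text \<open>Both sides are limits of one second difference quotient, which is symmetric in
  \<open>v\<close> and \<open>w\<close>.\<close>

lemma second_derivative_symmetric_real:
  fixes f :: "'a::real_normed_vector \<Rightarrow> real"
  assumes W: "open W" "x \<in> W" "\<And>y. y \<in> W \<Longrightarrow> (f has_derivative f' y) (at y)"
    and f'': "\<And>v. ((\<lambda>y. f' y v) has_derivative f'' v) (at x)"
  shows "f'' v w = f'' w v"
proof (rule ccontr)
  assume ne: "f'' v w \<noteq> f'' w v"
  define e where "e = \<bar>f'' v w - f'' w v\<bar> / 3"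
  have "e > 0" using ne unfolding e_def by auto
  obtain d1 where d1: "d1 > 0" "\<And>s. 0 < s \<Longrightarrow> s < d1 \<Longrightarrow>
    \<bar>f (x + s *\<^sub>R v + s *\<^sub>R w) - f (x + s *\<^sub>R v) - f (x + s *\<^sub>R w) + f x - s\<^sup>2 * f'' v w\<bar> \<le> e * s\<^sup>2"
    using second_difference_quotient[OF W f'' \<open>e > 0\<close>] by blast
  obtain d2 where d2: "d2 > 0" "\<And>s. 0 < s \<Longrightarrow> s < d2 \<Longrightarrow>
    \<bar>f (x + s *\<^sub>R w + s *\<^sub>R v) - f (x + s *\<^sub>R w) - f (x + s *\<^sub>R v) + f x - s\<^sup>2 * f'' w v\<bar> \<le> e * s\<^sup>2"
    using second_difference_quotient[OF W f'' \<open>e > 0\<close>] by blast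
  define s where "s = min d1 d2 / 2"
  have s: "0 < s" "s < d1" "s < d2" using d1(1) d2(1) unfolding s_def by auto
  have "\<bar>s\<^sup>2 * f'' v w - s\<^sup>2 * f'' w v\<bar> \<le> 2 * (e * s\<^sup>2)"
    using d1(2)[OF s(1,2)] d2(2)[OF s(1,3)] by (simp add: algebra_simps)
  then have "s\<^sup>2 * \<bar>f'' v w - f'' w v\<bar> \<le> s\<^sup>2 * (2 * e)"
    using abs_mult[of "s\<^sup>2" "f'' v w - f'' w v"] by (simp add: algebra_simps)
  then have "\<bar>f'' v w - f'' w v\<bar> \<le> 2 * e" using s(1) by simp
  then show False using \<open>e > 0\<close> unfolding e_def by simp
qed

lemma second_derivative_symmetric:
  fixes f :: "'a::real_normed_vector \<Rightarrow> 'b::euclidean_space"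
  assumes W: "open W" "x \<in> W" "\<And>y. y \<in> W \<Longrightarrow> (f has_derivative f' y) (at y)"
    and f'': "\<And>v. ((\<lambda>y. f' y v) has_derivative f'' v) (at x)"
  shows "f'' v w = f'' w v"
proof (rule euclidean_eqI)
  fix b :: 'b assume "b \<in> Basis"
  show "f'' v w \<bullet> b = f'' w v \<bullet> b"
    by (rule second_derivative_symmetric_real[OF W(1,2), where f="\<lambda>y. f y \<bullet> b" and f'="\<lambda>y v. f' y v \<bullet> b" and f''="\<lambda>v w. f'' v w \<bullet> b"])
       (auto intro!: has_derivative_inner_left W(3) f'')
qed

text \<open>Poincare lemma by integration of \<open>w\<close> along radial segments from
  \<open>x0\<close>. The integral is C^1 on the whole ball whether or not \<open>w\<close> is closed
  there; closedness along the segments in \<open>N\<close> identifies its derivative on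
  \<open>N\<close>. In the application \<open>N\<close> is a half disc, and beyond it
  \<open>w\<close> comes from an arbitrary extension.\<close>

lemma closed_form_primitive:
  fixes w :: "'a::euclidean_space \<Rightarrow> 'a \<Rightarrow> 'b::euclidean_space"
  assumes "r > 0" and lin: "\<And>q. q \<in> ball x0 r \<Longrightarrow> linear (w q)"
    and w': "\<And>q v. q \<in> ball x0 r \<Longrightarrow> ((\<lambda>q. w q v) has_derivative (\<lambda>h. w' q h v)) (at q)"
    and cont: "\<And>h v. continuous_on (ball x0 r) (\<lambda>q. w' q h v)"
    and NB: "N \<subseteq> ball x0 r"
    and star: "\<And>q t. q \<in> N \<Longrightarrow> 0 \<le> t \<Longrightarrow> t \<le> 1 \<Longrightarrow> x0 + t *\<^sub>R (q - x0) \<in> N"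
    and closed: "\<And>q h v. q \<in> N \<Longrightarrow> w' q h v = w' q v h"
  shows "\<exists>Y Y'. (\<forall>q\<in>ball x0 r. (Y has_derivative Y' q) (at q)) \<and>
    (\<forall>v. continuous_on (ball x0 r) (\<lambda>q. Y' q v)) \<and> (\<forall>q\<in>N. \<forall>v. Y' q v = w q v)"
proof -
  define B where "B = ball x0 r"
  define p where "p = (\<lambda>q (t::real). x0 + t *\<^sub>R (q - x0))"
  have pB: "p q t \<in> B" if "q \<in> B" "t \<in> {0..1}" for q t
  proof -
    have "norm (t *\<^sub>R (q - x0)) \<le> norm (q - x0)"
      using that by (simp add: mult_left_le_one_le)
    then show ?thesis using that unfolding B_def p_def by (simp add: dist_norm norm_minus_commute)
  qed
  have wlin: "w q v = (\<Sum>b\<in>Basis. (v \<bullet> b) *\<^sub>R w q b)" if "q \<in> B" for q v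
  proof -
    have "w q (\<Sum>b\<in>Basis. (v \<bullet> b) *\<^sub>R b) = (\<Sum>b\<in>Basis. (v \<bullet> b) *\<^sub>R w q b)"
      using lin that unfolding B_def by (simp add: linear_sum linear_scale)
    then show ?thesis by (simp add: euclidean_representation)
  qed
  have w'lin1: "linear (\<lambda>h. w' q h v)" if "q \<in> B" for q v
    using has_derivative_linear[OF w'] that unfolding B_def by blast
  have w'lin2: "w' q h v = (\<Sum>b\<in>Basis. (v \<bullet> b) *\<^sub>R w' q h b)" if "q \<in> B" for q h v
  proof -
    have "((\<lambda>q. \<Sum>b\<in>Basis. (v \<bullet> b) *\<^sub>R w q b) has_derivative (\<lambda>h. \<Sum>b\<in>Basis. (v \<bullet> b) *\<^sub>R w' q h b)) (at q)"
      using w' that unfolding B_def by (intro has_derivative_sum has_derivative_scaleR_right) auto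
    then have "((\<lambda>q. w q v) has_derivative (\<lambda>h. \<Sum>b\<in>Basis. (v \<bullet> b) *\<^sub>R w' q h b)) (at q)"
      by (rule has_derivative_transform_within_open[of _ _ _ _ B]) (use that wlin in \<open>auto simp: B_def\<close>)
    from has_derivative_unique[OF this w'[of q v]] that show ?thesis
      unfolding B_def by (auto dest: fun_cong[of _ _ h])
  qed
  have contw: "continuous_on B (\<lambda>q. w q v)" for v
    using w' unfolding B_def by (meson has_derivative_continuous continuous_at_imp_continuous_on)
  \<comment> \<open>Derivative in \<open>q\<close> of the integrand \<open>F q t\<close>;
    \<open>D'\<close> repackages it as a bounded linear map for differentiation under the
    integral.\<close>
  define D where "D = (\<lambda>q t h. \<Sum>b\<in>Basis. ((q - x0) \<bullet> b) *\<^sub>R w' (p q t) (t *\<^sub>R h) b + (h \<bullet> b) *\<^sub>R w (p q t) b)"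
  define F where "F = (\<lambda>q t. \<Sum>b\<in>Basis. ((q - x0) \<bullet> b) *\<^sub>R w (p q t) b)"
  define D' where "D' = (\<lambda>q t. Blinfun (D q t))"
  define Y where "Y = (\<lambda>q. integral (cbox 0 1) (F q))"
  define Y' where "Y' = (\<lambda>q. blinfun_apply (integral (cbox 0 1) (D' q)))"
  have derF: "((\<lambda>q. F q t) has_derivative D q t) (at q)" if "q \<in> B" "t \<in> {0..1}" for q t
  proof -
    have 1: "((\<lambda>q. w (p q t) b) has_derivative (\<lambda>h. w' (p q t) (t *\<^sub>R h) b)) (at q)" for b
      by (rule has_derivative_compose[where f="\<lambda>q. p q t" and g="\<lambda>q. w q b", OF _ w'[of "p q t" b]])
         (use pB[OF that] in \<open>auto simp: p_def B_def intro!: derivative_eq_intros\<close>)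
    have 2: "((\<lambda>q. (q - x0) \<bullet> b) has_derivative (\<lambda>h. h \<bullet> b)) (at q)" for b
      by (auto intro!: derivative_eq_intros)
    show ?thesis unfolding F_def D_def
      by (intro has_derivative_sum has_derivative_scaleR 1 2)
  qed
  have D': "blinfun_apply (D' q t) = D q t" if "q \<in> B" "t \<in> {0..1}" for q t
    unfolding D'_def using has_derivative_bounded_linear[OF derF[OF that]] by (rule bounded_linear_Blinfun_apply)
  have cp: "continuous_on (B \<times> cbox 0 1) (\<lambda>x. p (fst x) (snd x))"
    unfolding p_def by (intro continuous_intros)
  have pim: "(\<lambda>x. p (fst x) (snd x)) ` (B \<times> cbox 0 1) \<subseteq> B" using pB by auto
  have cw: "continuous_on (B \<times> cbox 0 1) (\<lambda>x. w (p (fst x) (snd x)) v)" for v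
    by (rule continuous_on_compose2[OF contw cp pim])
  have cw': "continuous_on (B \<times> cbox 0 1) (\<lambda>x. w' (p (fst x) (snd x)) h v)" for h v
    by (rule continuous_on_compose2[OF _ cp pim]) (use cont in \<open>simp add: B_def\<close>)
  have D_eq: "D q t h = (\<Sum>b\<in>Basis. ((q - x0) \<bullet> b) *\<^sub>R t *\<^sub>R w' (p q t) h b + (h \<bullet> b) *\<^sub>R w (p q t) b)"
    if "q \<in> B" "t \<in> {0..1}" for q t h
    unfolding D_def using linear_scale[OF w'lin1[OF pB[OF that]]] by simp
  have cD: "continuous_on (B \<times> cbox 0 1) (\<lambda>x. D' (fst x) (snd x))"
  proof (rule continuous_on_blinfun_componentwise)
    fix h :: 'a assume "h \<in> Basis"
    have "continuous_on (B \<times> cbox 0 1) (\<lambda>x. \<Sum>b\<in>Basis. ((fst x - x0) \<bullet> b) *\<^sub>R snd x *\<^sub>R w' (p (fst x) (snd x)) h b + (h \<bullet> b) *\<^sub>R w (p (fst x) (snd x)) b)"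
      by (intro continuous_intros cw cw')
    then show "continuous_on (B \<times> cbox 0 1) (\<lambda>x. blinfun_apply (D' (fst x) (snd x)) h)"
      by (rule continuous_on_eq) (auto simp: D' D_eq)
  qed
  have cF: "continuous_on (B \<times> cbox 0 1) (\<lambda>x. F (fst x) (snd x))"
    unfolding F_def by (intro continuous_intros cw)
  have pairc: "continuous_on (cbox 0 1) (\<lambda>t::real. (q, t))" for q :: 'a
    by (intro continuous_intros)
  have cFq: "continuous_on (cbox 0 1) (F q)" if "q \<in> B" for q
    using continuous_on_compose2[OF cF pairc] that by auto
  have cDq: "continuous_on (cbox 0 1) (D' q)" if "q \<in> B" for q
    using continuous_on_compose2[OF cD pairc] that by auto
  have "(Y has_derivative Y' q) (at q)" if "q \<in> B" for q
  proof -
    have "(Y has_derivative Y' q) (at q within B)"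
      unfolding Y_def Y'_def
    proof (rule leibniz_rule[where f=F and fx=D' and a=0 and b=1])
      show "((\<lambda>x. F x t) has_derivative blinfun_apply (D' x t)) (at x within B)" if "x \<in> B" "t \<in> cbox 0 1" for x t
        using derF[of x t] D'[of x t] that by (auto intro: has_derivative_at_withinI)
      show "F x integrable_on cbox 0 1" if "x \<in> B" for x
        using cFq[OF that] by (rule integrable_continuous)
      show "continuous_on (B \<times> cbox 0 1) (\<lambda>(x, t). D' x t)"
        using cD by (simp add: case_prod_beta)
    qed (use that in \<open>auto simp: B_def\<close>)
    moreover have "open B" unfolding B_def by (rule open_ball)
    ultimately show ?thesis using that at_within_open[of q B] by (simp only:)
  qed
  moreover have "continuous_on B (\<lambda>q. Y' q v)" for v
  proof -
    have "continuous_on B (\<lambda>q. integral (cbox 0 1) (D' q))"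
      by (rule integral_continuous_on_param) (use cD in \<open>simp add: case_prod_beta\<close>)
    then show ?thesis unfolding Y'_def by (rule blinfun.continuous_on[OF _ continuous_on_const])
  qed
  moreover have "Y' q v = w q v" if "q \<in> N" for q v
  proof -
    have qB: "q \<in> B" using that NB B_def by auto
    have pN: "p q t \<in> N" if "t \<in> {0..1}" for t using star[OF \<open>q \<in> N\<close>] that by (auto simp: p_def)
    \<comment> \<open>Closedness swaps the arguments of \<open>w'\<close>, and the integrand becomes
      the derivative in \<open>t\<close> of \<open>t *\<^sub>R w (p q t) v\<close>.\<close>
    have eq: "D q t v = t *\<^sub>R w' (p q t) (q - x0) v + w (p q t) v" if "t \<in> {0..1}" for t
    proof -
      have "D q t v = t *\<^sub>R w' (p q t) v (q - x0) + w (p q t) v"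
        using D_eq[OF qB that, of v] wlin[OF pB[OF qB that], of v] w'lin2[OF pB[OF qB that], of v "q - x0"]
        by (simp add: sum.distrib scaleR_sum_right mult.commute)
      then show ?thesis using closed[OF pN[OF that]] by simp
    qed
    have "((\<lambda>t. t *\<^sub>R w (p q t) v) has_vector_derivative (t *\<^sub>R w' (p q t) (q - x0) v + w (p q t) v)) (at t within {0..1})"
      if "t \<in> {0..1}" for t
    proof -
      have "((\<lambda>t. w (p q t) v) has_derivative (\<lambda>h. w' (p q t) (h *\<^sub>R (q - x0)) v)) (at t within {0..1})"
        by (rule has_derivative_compose[where f="\<lambda>t. p q t" and g="\<lambda>q. w q v", OF _ w'[of "p q t" v]])
           (use pB[OF qB that] in \<open>auto simp: p_def B_def intro!: derivative_eq_intros\<close>)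
      then have "((\<lambda>t. w (p q t) v) has_vector_derivative (w' (p q t) (q - x0) v)) (at t within {0..1})"
        unfolding has_vector_derivative_def using linear_scale[OF w'lin1[OF pB[OF qB that]]] by simp
      then show ?thesis
        using has_vector_derivative_scaleR[of "\<lambda>t. t" 1 t "{0..1}"] by (auto intro!: derivative_eq_intros)
    qed
    from fundamental_theorem_of_calculus[OF _ this]
    have "((\<lambda>t. t *\<^sub>R w' (p q t) (q - x0) v + w (p q t) v) has_integral (w q v)) {0..1}"
      by (simp add: p_def)
    moreover have "Y' q v = integral {0..1} (\<lambda>t. D q t v)"
      unfolding Y'_def using blinfun_apply_integral[OF integrable_continuous[OF cDq[OF qB]]] D'[OF qB]
      by (auto intro!: integral_cong)
    moreover have "integral {0..1} (\<lambda>t. D q t v) = integral {0..1} (\<lambda>t. t *\<^sub>R w' (p q t) (q - x0) v + w (p q t) v)"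
      by (intro integral_cong eq)
    ultimately show ?thesis using integral_unique by metis
  qed
  ultimately show ?thesis unfolding B_def by blast
qed

section \<open>Holomorphic functions: polarisation and boundary uniqueness\<close>

lemma higher_deriv_sum_mult_right:
  assumes "finite K" "open S" "\<And>k. k \<in> K \<Longrightarrow> a k holomorphic_on S" "z \<in> S"
  shows "(deriv ^^ m) (\<lambda>z. \<Sum>k\<in>K. a k z * c k) z = (\<Sum>k\<in>K. (deriv ^^ m) (a k) z * c k)"
  using assms(4)
proof (induction m arbitrary: z)
  case (Suc m)
  have "((\<lambda>z. \<Sum>k\<in>K. (deriv ^^ m) (a k) z * c k) has_field_derivative
      (\<Sum>k\<in>K. (deriv ^^ Suc m) (a k) z * c k)) (at z)"
  proof (intro DERIV_sum DERIV_cmult_right)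
    fix k assume "k \<in> K"
    then have "(deriv ^^ m) (a k) holomorphic_on S"
      using assms by (intro holomorphic_higher_deriv) auto
    then show "((deriv ^^ m) (a k) has_field_derivative (deriv ^^ Suc m) (a k) z) (at z)"
      using holomorphic_derivI[OF _ assms(2) Suc.prems] by simp
  qed
  moreover have "eventually (\<lambda>w. (deriv ^^ m) (\<lambda>z. \<Sum>k\<in>K. a k z * c k) w = (\<Sum>k\<in>K. (deriv ^^ m) (a k) w * c k)) (nhds z)"
    using Suc.IH eventually_nhds_in_open[OF assms(2) Suc.prems] by (auto elim!: eventually_mono)
  ultimately show ?case
    by (simp add: DERIV_imp_deriv deriv_cong_ev[where x=z and y=z])
qed simp

text \<open>The sum has zero real derivative. Its values in the directions 1 and i separate the
  holomorphic part \<open>P\<close> from the antiholomorphic part \<open>Q\<close>, so both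
  vanish.\<close>

lemma sesquilinear_sum_deriv_left:
  fixes a b :: "'k \<Rightarrow> complex \<Rightarrow> complex"
  assumes "finite K" "open U" "\<And>k. k \<in> K \<Longrightarrow> a k holomorphic_on U" "\<And>k. k \<in> K \<Longrightarrow> b k holomorphic_on U"
    and zero: "\<And>z. z \<in> U \<Longrightarrow> (\<Sum>k\<in>K. a k z * cnj (b k z)) = 0" and "z \<in> U"
  shows "(\<Sum>k\<in>K. deriv (a k) z * cnj (b k z)) = 0"
proof -
  have a: "(a k has_derivative (\<lambda>h. deriv (a k) z * h)) (at z)" if "k \<in> K" for k
    using holomorphic_derivI[OF assms(3)[OF that] \<open>open U\<close> \<open>z \<in> U\<close>] by (simp add: has_field_derivative_def)
  have b: "((\<lambda>z. cnj (b k z)) has_derivative (\<lambda>h. cnj (deriv (b k) z * h))) (at z)" if "k \<in> K" for k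
    using holomorphic_derivI[OF assms(4)[OF that] \<open>open U\<close> \<open>z \<in> U\<close>]
    by (intro has_derivative_cnj) (simp add: has_field_derivative_def)
  have "((\<lambda>z. \<Sum>k\<in>K. a k z * cnj (b k z)) has_derivative
      (\<lambda>h. \<Sum>k\<in>K. a k z * cnj (deriv (b k) z * h) + deriv (a k) z * h * cnj (b k z))) (at z)"
    using a b by (intro has_derivative_sum has_derivative_mult) auto
  moreover have "((\<lambda>z. \<Sum>k\<in>K. a k z * cnj (b k z)) has_derivative (\<lambda>h. 0)) (at z)"
    by (rule has_derivative_transform_within_open[OF _ \<open>open U\<close> \<open>z \<in> U\<close>, of "\<lambda>_. 0"]) (auto simp: zero)
  ultimately have eq: "(\<lambda>h. \<Sum>k\<in>K. a k z * cnj (deriv (b k) z * h) + deriv (a k) z * h * cnj (b k z)) = (\<lambda>h. 0)"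
    by (rule has_derivative_unique)
  define P where "P = (\<Sum>k\<in>K. deriv (a k) z * cnj (b k z))"
  define Q where "Q = (\<Sum>k\<in>K. a k z * cnj (deriv (b k) z))"
  have "Q + P = 0"
    using fun_cong[OF eq, of 1] unfolding P_def Q_def by (simp add: sum.distrib)
  moreover have "\<i> * (P - Q) = 0"
    using fun_cong[OF eq, of \<i>] unfolding P_def Q_def
    by (simp add: sum.distrib sum_distrib_left sum_negf sum_subtractf right_diff_distrib mult_ac)
  ultimately have "P = 0" using mult_eq_0_iff[of \<i> "P - Q"] by auto
  then show ?thesis unfolding P_def .
qed

text \<open>Conjugation exchanges the roles of \<open>a\<close> and \<open>b\<close>, so
  differentiation of the left factor suffices: first for \<open>a\<close>, then for
  \<open>b\<close>.\<close>

lemma sesquilinear_sum_higher_deriv: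
  fixes a b :: "'k \<Rightarrow> complex \<Rightarrow> complex"
  assumes "finite K" "open U" "\<And>k. k \<in> K \<Longrightarrow> a k holomorphic_on U" "\<And>k. k \<in> K \<Longrightarrow> b k holomorphic_on U"
    and zero: "\<And>z. z \<in> U \<Longrightarrow> (\<Sum>k\<in>K. a k z * cnj (b k z)) = 0" and "z \<in> U"
  shows "(\<Sum>k\<in>K. (deriv ^^ m) (a k) z * cnj ((deriv ^^ n) (b k) z)) = 0"
proof -
  have hol: "(deriv ^^ m) (a k) holomorphic_on U" "(deriv ^^ m) (b k) holomorphic_on U" if "k \<in> K" for k m
    using assms that by (auto intro!: holomorphic_higher_deriv)
  have 1: "(\<Sum>k\<in>K. (deriv ^^ m) (a k) z * cnj (b k z)) = 0" if "z \<in> U" for z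
    using that
  proof (induction m arbitrary: z)
    case (Suc m)
    then show ?case
      using sesquilinear_sum_deriv_left[where a="\<lambda>k. (deriv ^^ m) (a k)" and b=b, OF assms(1,2) hol(1) assms(4)] by simp
  qed (simp add: zero)
  have 2: "(\<Sum>k\<in>K. (deriv ^^ n) (b k) z * cnj ((deriv ^^ m) (a k) z)) = 0" if "z \<in> U" for z
    using that
  proof (induction n arbitrary: z)
    case 0
    have "(\<Sum>k\<in>K. b k z * cnj ((deriv ^^ m) (a k) z)) = cnj (\<Sum>k\<in>K. (deriv ^^ m) (a k) z * cnj (b k z))"
      by (simp add: mult.commute)
    then show ?case using 1[OF 0] by simp
  next
    case (Suc n)
    then show ?case
      using sesquilinear_sum_deriv_left[where a="\<lambda>k. (deriv ^^ n) (b k)" and b="\<lambda>k. (deriv ^^ m) (a k)", OF assms(1,2) hol(2) hol(1)] by simp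
  qed
  have "(\<Sum>k\<in>K. (deriv ^^ m) (a k) z * cnj ((deriv ^^ n) (b k) z)) =
      cnj (\<Sum>k\<in>K. (deriv ^^ n) (b k) z * cnj ((deriv ^^ m) (a k) z))"
    by (simp add: mult.commute)
  then show ?thesis using 2[OF \<open>z \<in> U\<close>] by simp
qed

text \<open>Polarisation: all mixed derivatives \<open>\<partial>\<^sup>m \<partial>\<^sup>n\<close> (holomorphic and antiholomorphic) vanish at a
  point of \<open>U\<close>, so the identity theorem can be applied in the two variables separately.\<close>

lemma sesquilinear_sum_identity:
  fixes a b :: "'k \<Rightarrow> complex \<Rightarrow> complex"
  assumes K: "finite K" and S: "open S" "connected S"
    and a: "\<And>k. k \<in> K \<Longrightarrow> a k holomorphic_on S" and b: "\<And>k. k \<in> K \<Longrightarrow> b k holomorphic_on S"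
    and U: "open U" "U \<subseteq> S" "U \<noteq> {}"
    and zero: "\<And>z. z \<in> U \<Longrightarrow> (\<Sum>k\<in>K. a k z * cnj (b k z)) = 0" and "z \<in> S"
  shows "(\<Sum>k\<in>K. a k z * cnj (b k z)) = 0"
proof -
  obtain z0 where z0: "z0 \<in> U" using U(3) by blast
  then have "z0 \<in> S" using U(2) by blast
  have 0: "(\<Sum>k\<in>K. (deriv ^^ m) (a k) z0 * cnj ((deriv ^^ n) (b k) z0)) = 0" for m n
    using a b U by (intro sesquilinear_sum_higher_deriv[OF K U(1) _ _ zero z0]) (auto intro: holomorphic_on_subset)
  have 1: "(\<Sum>k\<in>K. a k z * cnj ((deriv ^^ n) (b k) z0)) = 0" for n
  proof (rule holomorphic_fun_eq_0_on_connected[where f="\<lambda>z. \<Sum>k\<in>K. a k z * cnj ((deriv ^^ n) (b k) z0)", OF _ S _ \<open>z0 \<in> S\<close> \<open>z \<in> S\<close>])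
    show "(\<lambda>z. \<Sum>k\<in>K. a k z * cnj ((deriv ^^ n) (b k) z0)) holomorphic_on S"
      using a by (intro holomorphic_intros) auto
    show "(deriv ^^ m) (\<lambda>z. \<Sum>k\<in>K. a k z * cnj ((deriv ^^ n) (b k) z0)) z0 = 0" for m
      using higher_deriv_sum_mult_right[where a=a and m=m and c="\<lambda>k. cnj ((deriv ^^ n) (b k) z0)", OF K S(1) a \<open>z0 \<in> S\<close>] 0 by simp
  qed
  have "(\<Sum>k\<in>K. b k z * cnj (a k z)) = 0"
  proof (rule holomorphic_fun_eq_0_on_connected[where f="\<lambda>w. \<Sum>k\<in>K. b k w * cnj (a k z)", OF _ S _ \<open>z0 \<in> S\<close> \<open>z \<in> S\<close>])
    show "(\<lambda>w. \<Sum>k\<in>K. b k w * cnj (a k z)) holomorphic_on S"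
      using b by (intro holomorphic_intros) auto
    show "(deriv ^^ n) (\<lambda>w. \<Sum>k\<in>K. b k w * cnj (a k z)) z0 = 0" for n
    proof -
      have "(\<Sum>k\<in>K. (deriv ^^ n) (b k) z0 * cnj (a k z)) = cnj (\<Sum>k\<in>K. a k z * cnj ((deriv ^^ n) (b k) z0))"
        by (simp add: mult.commute)
      then show ?thesis
        using higher_deriv_sum_mult_right[where a=b and m=n and c="\<lambda>k. cnj (a k z)", OF K S(1) b \<open>z0 \<in> S\<close>] 1 by simp
    qed
  qed
  moreover have "(\<Sum>k\<in>K. b k z * cnj (a k z)) = cnj (\<Sum>k\<in>K. a k z * cnj (b k z))"
    by (simp add: mult.commute)
  ultimately have "cnj (\<Sum>k\<in>K. a k z * cnj (b k z)) = 0" by (simp only:)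
  then show ?thesis by (rule complex_cnj_zero_iff[THEN iffD1])
qed

text \<open>Twice i times the imaginary part is the sum minus its conjugate, and the conjugate is a
  sum of the same kind with \<open>a\<close> and \<open>b\<close> exchanged. The boolean component
  of the index distinguishes the two halves.\<close>

lemma Im_sesquilinear_sum_identity:
  fixes a b :: "'k \<Rightarrow> complex \<Rightarrow> complex"
  assumes K: "finite K" and S: "open S" "connected S"
    and a: "\<And>k. k \<in> K \<Longrightarrow> a k holomorphic_on S" and b: "\<And>k. k \<in> K \<Longrightarrow> b k holomorphic_on S"
    and U: "open U" "U \<subseteq> S" "U \<noteq> {}"
    and zero: "\<And>z. z \<in> U \<Longrightarrow> Im (\<Sum>k\<in>K. a k z * cnj (b k z)) = 0" and "z \<in> S"
  shows "Im (\<Sum>k\<in>K. a k z * cnj (b k z)) = 0"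
proof -
  define a' where "a' = (\<lambda>(k, c) z. if c then a k z else - b k z)"
  define b' where "b' = (\<lambda>(k, c) z. if c then b k z else a k z)"
  have eq: "(\<Sum>k\<in>K \<times> UNIV. a' k z * cnj (b' k z)) = 2 * \<i> * of_real (Im (\<Sum>k\<in>K. a k z * cnj (b k z)))" for z
  proof -
    have "(\<Sum>k\<in>K \<times> UNIV. a' k z * cnj (b' k z)) = (\<Sum>k\<in>K. a k z * cnj (b k z)) - (\<Sum>k\<in>K. b k z * cnj (a k z))"
      using K by (simp add: sum.cartesian_product' a'_def b'_def UNIV_bool sum_subtractf sum.distrib sum_negf)
    also have "(\<Sum>k\<in>K. b k z * cnj (a k z)) = cnj (\<Sum>k\<in>K. a k z * cnj (b k z))"
      by (simp add: mult.commute)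
    finally have 1: "(\<Sum>k\<in>K \<times> UNIV. a' k z * cnj (b' k z)) = (\<Sum>k\<in>K. a k z * cnj (b k z)) - cnj (\<Sum>k\<in>K. a k z * cnj (b k z))" .
    show ?thesis unfolding 1 complex_diff_cnj by (simp only: of_real_mult of_real_numeral mult.assoc mult.commute mult.left_commute)
  qed
  have "(\<Sum>k\<in>K \<times> UNIV. a' k z * cnj (b' k z)) = 0"
  proof (rule sesquilinear_sum_identity[OF _ S _ _ U _ \<open>z \<in> S\<close>])
    show "finite (K \<times> (UNIV :: bool set))" using K by simp
    show "a' k holomorphic_on S" "b' k holomorphic_on S" if "k \<in> K \<times> UNIV" for k
      using that a[of "fst k"] b[of "fst k"] unfolding a'_def b'_def
      by (cases "snd k"; auto simp: case_prod_beta intro!: holomorphic_on_minus)+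
    show "(\<Sum>k\<in>K \<times> UNIV. a' k z * cnj (b' k z)) = 0" if "z \<in> U" for z
      unfolding eq zero[OF that] by simp
  qed
  then have "2 * \<i> * complex_of_real (Im (\<Sum>k\<in>K. a k z * cnj (b k z))) = 0" unfolding eq .
  then show ?thesis by (simp only: mult_eq_0_iff of_real_eq_0_iff complex_i_not_zero zero_neq_numeral[symmetric] simp_thms)
qed

section \<open>Complex coordinates and boundary uniqueness\<close>

lemma local_complex_coordinate:
  fixes z :: "real^2 \<Rightarrow> complex"
  assumes B: "open B" "x0 \<in> B" and z: "\<And>q. q \<in> B \<Longrightarrow> (z has_derivative D q) (at q)"
    and cont: "\<And>v. continuous_on B (\<lambda>q. D q v)" and inj: "inj (D x0)"
  obtains U g where "open U" "x0 \<in> U" "U \<subseteq> B" "open (z ` U)" "continuous_on (z ` U) g"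
    "\<And>q. q \<in> U \<Longrightarrow> g (z q) = q" "\<And>q. q \<in> U \<Longrightarrow> bij (D q)"
    "\<And>q. q \<in> U \<Longrightarrow> (g has_derivative inv (D q)) (at (z q))"
proof -
  \<comment> \<open>\<open>J\<close> identifies the complex plane with \<open>real^2\<close>, so
    that \<open>J (z q)\<close> is a map of \<open>real^2\<close> to itself as in the inverse
    function theorem.\<close>
  define J where "J = (\<lambda>w::complex. (vector [Re w, Im w] :: real^2))"
  have linJ: "linear J"
    by (rule linearI) (auto simp: J_def vec_eq_iff forall_2)
  then have blJ: "bounded_linear J" by (simp add: linear_conv_bounded_linear)
  have "inj J" unfolding J_def by (auto simp: inj_def vec_eq_iff forall_2 complex_eq_iff)
  moreover have "surj J"
  proof (rule surjI)
    show "J (Complex (y $ 1) (y $ 2)) = y" for y by (simp add: J_def vec_eq_iff forall_2)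
  qed
  ultimately have "bij J" by (simp add: bij_def)
  have blD: "bounded_linear (D q)" if "q \<in> B" for q
    using z[OF that] has_derivative_bounded_linear by blast
  define f' where "f' = (\<lambda>q. Blinfun (\<lambda>v. J (D q v)))"
  have f': "blinfun_apply (f' q) = (\<lambda>v. J (D q v))" if "q \<in> B" for q
    unfolding f'_def using bounded_linear_compose[OF blJ blD[OF that]] by (rule bounded_linear_Blinfun_apply)
  have derf: "((\<lambda>q. J (z q)) has_derivative blinfun_apply (f' q)) (at q)" if "q \<in> B" for q
    unfolding f'[OF that] using bounded_linear.has_derivative[OF blJ z[OF that]] .
  have contf: "continuous_on B f'"
  proof (rule continuous_on_blinfun_componentwise)
    fix v :: "real^2"
    have "continuous_on B (\<lambda>q. J (D q v))"
      using bounded_linear.continuous_on[OF blJ cont] .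
    then show "continuous_on B (\<lambda>q. blinfun_apply (f' q) v)"
      by (rule continuous_on_eq) (simp add: f')
  qed
  have linJD: "linear (\<lambda>v. J (D x0 v))"
    using f'[OF B(2)] blinfun.bounded_linear_right[of "f' x0"] by (simp add: linear_conv_bounded_linear)
  have injJD: "inj (\<lambda>v. J (D x0 v))"
    using inj \<open>inj J\<close> by (auto simp: inj_def)
  obtain h where h: "linear h" "h \<circ> (\<lambda>v. J (D x0 v)) = id"
    using linear_injective_left_inverse[OF linJD injJD] by blast
  have "Blinfun h o\<^sub>L f' x0 = id_blinfun"
  proof (rule blinfun_eqI)
    fix v
    have "blinfun_apply (Blinfun h) = h"
      using h(1) by (simp add: bounded_linear_Blinfun_apply linear_conv_bounded_linear)
    then show "blinfun_apply (Blinfun h o\<^sub>L f' x0) v = blinfun_apply id_blinfun v"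
      using fun_cong[OF h(2), of v] f'[OF B(2)] by simp
  qed
  from inverse_function_theorem[OF B(1) derf contf B(2) this]
  obtain U V g0 g' where U: "open U" "U \<subseteq> B" "x0 \<in> U" and V: "open V"
    and hom: "homeomorphism U V (\<lambda>q. J (z q)) g0"
    and g': "\<And>y. y \<in> V \<Longrightarrow> (g0 has_derivative (g' y)) (at y)"
      "\<And>y. y \<in> V \<Longrightarrow> g' y = inv (blinfun_apply (f' (g0 y)))"
    and bij: "\<And>y. y \<in> V \<Longrightarrow> bij (blinfun_apply (f' (g0 y)))"
    by metis
  have g0: "g0 (J (z q)) = q" "J (z q) \<in> V" if "q \<in> U" for q
    using that hom unfolding homeomorphism_def by auto
  have bijD: "bij (D q)" if "q \<in> U" for q
  proof -
    have "bij (\<lambda>v. J (D q v))" using bij[OF g0(2)[OF that]] g0(1)[OF that] f'[of q] that U(2) by auto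
    then have 1: "bij (inv J \<circ> (\<lambda>v. J (D q v)))" using \<open>bij J\<close> by (intro bij_comp bij_imp_bij_inv)
    have "inv J \<circ> (\<lambda>v. J (D q v)) = D q" using \<open>inj J\<close> by (simp add: fun_eq_iff)
    then show ?thesis using 1 by simp
  qed
  have img: "z ` U = J -` V"
  proof -
    have "(\<lambda>q. J (z q)) ` U = V" using hom by (simp add: homeomorphism_def)
    then have "V = J ` (z ` U)" by (simp add: image_image)
    then show ?thesis using \<open>inj J\<close> by (simp add: inj_vimage_image_eq)
  qed
  have contJ: "continuous_on S J" for S using blJ by (simp add: linear_continuous_on)
  show ?thesis
  proof (rule that[of U "\<lambda>w. g0 (J w)"])
    show "open (z ` U)" unfolding img using V contJ[of UNIV] by (rule open_vimage)
    have "continuous_on V g0" using hom by (simp add: homeomorphism_def)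
    then show "continuous_on (z ` U) (\<lambda>w. g0 (J w))"
      by (rule continuous_on_compose2[OF _ contJ]) (auto simp: img)
    show "((\<lambda>w. g0 (J w)) has_derivative inv (D q)) (at (z q))" if "q \<in> U" for q
    proof -
      have 1: "g' (J (z q)) = inv (\<lambda>v. J (D q v))"
        using g'(2)[OF g0(2)[OF that]] g0(1)[OF that] f'[of q] that U(2) by auto
      have 2: "((\<lambda>w. g0 (J w)) has_derivative (\<lambda>h. g' (J (z q)) (J h))) (at (z q))"
        by (rule has_derivative_compose[OF bounded_linear_imp_has_derivative[OF blJ] g'(1)[OF g0(2)[OF that]]])
      have "inv (J \<circ> D q) = inv (D q) \<circ> inv J"
        using bijD[OF that] \<open>bij J\<close> by (simp add: o_inv_distrib)
      then have "(\<lambda>h. g' (J (z q)) (J h)) = inv (D q)"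
        unfolding 1 using \<open>inj J\<close> by (simp add: fun_eq_iff o_def)
      then show ?thesis using 2 by simp
    qed
  qed (use U g0 bijD in auto)
qed

text \<open>The hypothesis on \<open>f\<close> is the Cauchy-Riemann equation df = c dz relative to
  a coordinate with differential \<open>D\<close>; it becomes complex differentiability once
  \<open>f\<close> is written in that coordinate.\<close>

lemma has_field_derivative_through_coordinate:
  assumes g: "(g has_derivative inv D) (at w)" and "g w = q" and "bij D"
    and f: "(f has_derivative (\<lambda>v. c * D v)) (at q)"
  shows "((\<lambda>w. f (g w)) has_field_derivative c) (at w)"
proof -
  have "((\<lambda>w. f (g w)) has_derivative (\<lambda>h. c * D (inv D h))) (at w)"
    using has_derivative_compose[OF g, of f "\<lambda>v. c * D v"] f assms(2) by simp
  then show ?thesis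
    using \<open>bij D\<close> by (simp add: has_field_derivative_def bij_is_surj surj_f_inv_f)
qed

text \<open>A function that is holomorphic on one side of the curve \<open>q $ 2 = 0\<close>, differentiable up to the
  curve and zero on it, has zero derivative there. Its extension by zero is therefore complex
  differentiable on both sides, and the identity theorem applies.\<close>

lemma boundary_uniqueness:
  fixes z f :: "real^2 \<Rightarrow> complex"
  assumes B: "open B" "x0 \<in> B" and z: "\<And>q. q \<in> B \<Longrightarrow> (z has_derivative D q) (at q)"
    and cont: "\<And>v. continuous_on B (\<lambda>q. D q v)" and inj: "inj (D x0)" and "x0 $ 2 = 0"
    and f: "\<And>q. q \<in> B \<Longrightarrow> q $ 2 \<ge> 0 \<Longrightarrow> \<exists>c. (f has_derivative (\<lambda>v. c * D q v)) (at q)"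
    and f0: "\<And>q. q \<in> B \<Longrightarrow> q $ 2 = 0 \<Longrightarrow> f q = 0"
  shows "\<exists>r>0. \<forall>q\<in>ball x0 r. q $ 2 \<ge> 0 \<longrightarrow> f q = 0"
proof -
  obtain U g where U: "open U" "x0 \<in> U" "U \<subseteq> B" "open (z ` U)" and cg: "continuous_on (z ` U) g"
    and g: "\<And>q. q \<in> U \<Longrightarrow> g (z q) = q" "\<And>q. q \<in> U \<Longrightarrow> bij (D q)"
      "\<And>q. q \<in> U \<Longrightarrow> (g has_derivative inv (D q)) (at (z q))"
    using local_complex_coordinate[OF B z cont inj] by blast
  obtain r where r: "r > 0" "ball x0 r \<subseteq> U" using U(1,2) open_contains_ball by blast
  define h where "h = (\<lambda>q. if q $ 2 \<ge> 0 then f q else 0)"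
  have opos: "open {q :: real^2. q $ 2 > 0}" and oneg: "open {q :: real^2. q $ 2 < 0}"
    by (intro open_Collect_less continuous_intros)+
  have h: "\<exists>c. (h has_derivative (\<lambda>v. c * D q v)) (at q)" if q: "q \<in> ball x0 r" for q
  proof -
    have qB: "q \<in> B" "q \<in> U" using q r U by auto
    consider "q $ 2 > 0" | "q $ 2 < 0" | "q $ 2 = 0" by linarith
    then show ?thesis
    proof cases
      case 1
      then obtain c where "(f has_derivative (\<lambda>v. c * D q v)) (at q)" using f[OF qB(1)] by auto
      then have "(h has_derivative (\<lambda>v. c * D q v)) (at q)"
        by (rule has_derivative_transform_within_open[OF _ opos]) (use 1 in \<open>auto simp: h_def\<close>)
      then show ?thesis by blast
    next
      case 2
      have "((\<lambda>q. 0) has_derivative (\<lambda>v. 0 * D q v)) (at q)" by simp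
      then have "(h has_derivative (\<lambda>v. 0 * D q v)) (at q)"
        by (rule has_derivative_transform_within_open[OF _ oneg]) (use 2 in \<open>auto simp: h_def\<close>)
      then show ?thesis by blast
    next
      case 3
      then obtain c where c: "(f has_derivative (\<lambda>v. c * D q v)) (at q)" using f[OF qB(1)] by auto
      have lin: "linear (D q)" using has_derivative_linear[OF z[OF qB(1)]] .
      define e where "e = (axis 1 1 :: real^2)"
      have e2: "e $ 2 = 0" "e \<noteq> 0" by (auto simp: e_def axis_def vec_eq_iff)
      have "((\<lambda>t::real. f (q + t *\<^sub>R e)) has_derivative (\<lambda>t. c * D q (t *\<^sub>R e))) (at 0)"
        by (rule has_derivative_compose[where f="\<lambda>t. q + t *\<^sub>R e" and g=f])
           (use c in \<open>auto intro!: derivative_eq_intros\<close>)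
      moreover have "((\<lambda>t::real. f (q + t *\<^sub>R e)) has_derivative (\<lambda>t. 0)) (at 0)"
      proof (rule has_derivative_transform_within_open[where f="\<lambda>_. 0"])
        show "open ((\<lambda>t::real. q + t *\<^sub>R e) -` B)"
          using B(1) by (intro open_vimage continuous_intros)
      qed (use qB f0 e2 3 in auto)
      ultimately have "(\<lambda>t. c * D q (t *\<^sub>R e)) = (\<lambda>t. 0)" by (rule has_derivative_unique)
      then have "c * D q e = 0" using fun_cong[of _ _ 1] by fastforce
      moreover have "D q e \<noteq> 0"
        using bij_is_inj[OF g(2)[OF qB(2)]] e2(2) linear_0[OF lin] by (metis injD)
      ultimately have "c = 0" by simp
      then have c0: "(f has_derivative (\<lambda>v. 0)) (at q)" using c by simp
      have "f q = 0" using f0[OF qB(1) 3] .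
      have "(h has_derivative (\<lambda>v. 0)) (at q)"
        unfolding has_derivative_at_alt
      proof (intro conjI allI impI)
        fix e :: real assume "e > 0"
        then obtain d where d: "d > 0" "\<And>y. norm (y - q) < d \<Longrightarrow> norm (f y) \<le> e * norm (y - q)"
          using c0[unfolded has_derivative_at_alt] \<open>f q = 0\<close> by auto
        then show "\<exists>d>0. \<forall>y. norm (y - q) < d \<longrightarrow> norm (h y - h q - 0) \<le> e * norm (y - q)"
          using \<open>f q = 0\<close> \<open>e > 0\<close> by (intro exI[of _ d]) (auto simp: h_def)
      qed (rule bounded_linear_zero)
      then show ?thesis by (intro exI[of _ 0]) simp
    qed
  qed
  define S where "S = z ` ball x0 r"
  have open_img: "open (z ` T)" if "open T" "T \<subseteq> U" for T
  proof -
    have "z ` T = z ` U \<inter> g -` T" using that g(1) by force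
    then show ?thesis using continuous_open_preimage[OF cg U(4) that(1)] by simp
  qed
  have cz: "continuous_on (ball x0 r) z"
    using z r U by (meson has_derivative_continuous continuous_at_imp_continuous_on subset_iff)
  have "open S" unfolding S_def using r(2) by (intro open_img) auto
  have "connected S" unfolding S_def by (intro connected_continuous_image cz connected_ball)
  have hol: "(\<lambda>w. h (g w)) holomorphic_on S"
    unfolding holomorphic_on_def
  proof
    fix w assume "w \<in> S"
    then obtain q where q: "q \<in> ball x0 r" "w = z q" unfolding S_def by blast
    then have qU: "q \<in> U" using r by blast
    obtain c where "(h has_derivative (\<lambda>v. c * D q v)) (at q)" using h[OF q(1)] by blast
    then have "((\<lambda>w. h (g w)) has_field_derivative c) (at w)"
      unfolding q(2) by (rule has_field_derivative_through_coordinate[OF g(3)[OF qU] g(1)[OF qU] g(2)[OF qU]])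
    then show "(\<lambda>w. h (g w)) field_differentiable at w within S"
      using field_differentiable_at_within field_differentiable_def by blast
  qed
  define T where "T = ball x0 r \<inter> {q. q $ 2 < 0}"
  have "open (z ` T)" using oneg r(2) unfolding T_def by (intro open_img) auto
  have "x0 - (r/2) *\<^sub>R axis 2 1 \<in> T"
    using r(1) \<open>x0 $ 2 = 0\<close> by (simp add: T_def dist_norm)
  then have neT: "z ` T \<noteq> {}" by blast
  have TS: "z ` T \<subseteq> S" unfolding T_def S_def by blast
  have T0: "h (g w) = 0" if "w \<in> z ` T" for w
    using that r(2) g(1) by (auto simp: T_def h_def subset_iff)
  have "h (g w) = 0" if "w \<in> S" for w
    using analytic_continuation_open[where f="\<lambda>w. h (g w)" and g="\<lambda>_. 0", OF \<open>open (z ` T)\<close> \<open>open S\<close> neT \<open>connected S\<close> TS hol _ T0 that]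
    by simp
  then have "\<forall>q\<in>ball x0 r. q $ 2 \<ge> 0 \<longrightarrow> f q = 0"
    using g(1) r(2) unfolding S_def h_def by (smt (verit) imageI subsetD)
  then show ?thesis using r(1) by blast
qed

section \<open>Coordinate patches of minimal surfaces\<close>

unbundle cross3_syntax

section \<open>Half discs and unique continuation\<close>

lemma has_derivative_unique_half_disc:
  fixes f :: "real^2 \<Rightarrow> 'b::real_normed_vector"
  assumes "(f has_derivative f') (at q within S)" "(f has_derivative f'') (at q within S)"
    and "e > 0" "ball q e \<inter> {q. q $ 2 \<ge> 0} \<subseteq> S" "q $ 2 \<ge> 0"
  shows "f' = f''"
proof (rule frechet_derivative_unique_within[OF assms(1,2)])
  fix i :: "real^2" and d :: real assume i: "i \<in> Basis" and "d > 0"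
  define s where "s = min d e / 2"
  have s: "s > 0" "s < d" "s < e" unfolding s_def using \<open>d > 0\<close> \<open>e > 0\<close> by auto
  \<comment> \<open>Both coordinate vectors point into the half-plane, so a short positive step
    along them stays in \<open>S\<close> even at a boundary point.\<close>
  have "i $ 2 \<ge> 0" using i by (auto simp: Basis_vec_def axis_def)
  then have "(q + s *\<^sub>R i) $ 2 \<ge> 0" using s \<open>q $ 2 \<ge> 0\<close> by simp
  moreover have "q + s *\<^sub>R i \<in> ball q e" using s i by (simp add: dist_norm)
  ultimately show "\<exists>d'. 0 < \<bar>d'\<bar> \<and> \<bar>d'\<bar> < d \<and> q + d' *\<^sub>R i \<in> S"
    using s assms(4) by (intro exI[of _ s]) auto
qed

abbreviation upper_half_ball :: "real^2 \<Rightarrow> real \<Rightarrow> (real^2) set" where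
  "upper_half_ball x0 \<rho> \<equiv> ball x0 \<rho> \<inter> {q. q $ 2 > 0}"

lemma open_upper_half_plane: "open {q :: real^2. q $ 2 > 0}"
  by (intro open_Collect_less continuous_intros)

lemma convex_upper_half_plane: "convex {q :: real^2. q $ 2 > 0}"
  using convex_halfspace_gt[of 0 "axis 2 1 :: real^2"] by (simp add: inner_axis')

lemma half_disc_limit_zero:
  fixes w :: "real^2 \<Rightarrow> real"
  assumes "continuous_on (ball x0 \<rho>) w" and zero: "\<And>q. q \<in> upper_half_ball x0 \<rho> \<Longrightarrow> w q = 0"
    and q: "q \<in> ball x0 \<rho>" "q $ 2 \<ge> 0"
  shows "w q = 0"
proof -
  define p where "p = (\<lambda>s::real. q + s *\<^sub>R axis 2 1)"
  have "isCont w q" using assms(1) q continuous_on_interior by (metis interior_ball)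
  moreover have "(p \<longlongrightarrow> q) (at_right 0)"
    unfolding p_def by (rule tendsto_eq_intros | simp)+
  ultimately have "((\<lambda>s. w (p s)) \<longlongrightarrow> w q) (at_right 0)"
    by (rule isCont_tendsto_compose)
  moreover have "eventually (\<lambda>s. p s \<in> ball x0 \<rho>) (at_right 0)"
    using topological_tendstoD[OF \<open>(p \<longlongrightarrow> q) (at_right 0)\<close> open_ball q(1)] .
  then have "eventually (\<lambda>s. w (p s) = 0) (at_right 0)"
    using eventually_at_right_less[of 0]
  proof eventually_elim
    case (elim s)
    then show ?case using zero[of "p s"] q(2) by (simp add: p_def)
  qed
  then have "((\<lambda>s. w (p s)) \<longlongrightarrow> 0) (at_right 0)" by (simp add: tendsto_eventually)
  ultimately show ?thesis using tendsto_unique[of "at_right (0::real)"] by simp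
qed

text \<open>Local identity theorem on a half disc, boundary points included; \<open>q0\<close>
  witnesses that \<open>T\<close> meets the closed half-plane. The radius \<open>\<rho>\<close> is
  chosen before \<open>T\<close>, as the open-closed argument over a connected surface
  requires.\<close>

definition unique_continuation :: "real^2 \<Rightarrow> real \<Rightarrow> (real^2 \<Rightarrow> bool) \<Rightarrow> bool" where
  "unique_continuation x0 r Z \<longleftrightarrow> (\<exists>\<rho>>0. \<rho> \<le> r \<and> (\<forall>T q0 q. open T \<longrightarrow> T \<subseteq> ball x0 \<rho> \<longrightarrow> q0 \<in> T \<longrightarrow>
     q0 $ 2 \<ge> 0 \<longrightarrow> (\<forall>q\<in>T. q $ 2 \<ge> 0 \<longrightarrow> Z q) \<longrightarrow> q \<in> ball x0 \<rho> \<longrightarrow> q $ 2 \<ge> 0 \<longrightarrow> Z q))"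

text \<open>A nonvanishing multiple \<open>m * w\<close> is of sesquilinear form, with
  \<open>m\<close> depending on the point. This suffices because only the zero set is continued.
  Points with \<open>q $ 2 = 0\<close> are reached by continuity.\<close>

lemma half_disc_propagation:
  fixes z :: "real^2 \<Rightarrow> complex" and w :: "real^2 \<Rightarrow> real" and x0 :: "real^2" and \<rho> :: real
  defines "S \<equiv> upper_half_ball x0 \<rho>"
  assumes conn: "connected (z ` S)" and op: "\<And>T. open T \<Longrightarrow> T \<subseteq> ball x0 \<rho> \<Longrightarrow> open (z ` T)"
    and K: "finite K" and h: "\<And>k. k \<in> K \<Longrightarrow> h k holomorphic_on z ` S" and b: "\<And>k. k \<in> K \<Longrightarrow> b k holomorphic_on z ` S"
    and w: "\<And>q. q \<in> S \<Longrightarrow> \<exists>m. m \<noteq> 0 \<and> m * w q = Im (\<Sum>k\<in>K. h k (z q) * cnj (b k (z q)))"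
    and cont: "continuous_on (ball x0 \<rho>) w"
    and T: "open T" "T \<subseteq> ball x0 \<rho>" "q0 \<in> T" "q0 $ 2 \<ge> 0" and zero: "\<And>q. q \<in> T \<Longrightarrow> q $ 2 \<ge> 0 \<Longrightarrow> w q = 0"
    and q: "q \<in> ball x0 \<rho>" "q $ 2 \<ge> 0"
  shows "w q = 0"
proof (rule half_disc_limit_zero[OF cont _ q])
  note opos = open_upper_half_plane
  obtain e where e: "e > 0" "ball q0 e \<subseteq> T" using T(1,3) open_contains_ball by blast
  \<comment> \<open>\<open>q0\<close> may lie on the boundary line; a small shift upwards stays in
    \<open>T\<close> and gives an interior point.\<close>
  have inT: "q0 + (e/2) *\<^sub>R axis 2 1 \<in> T"
    using e by (intro subsetD[OF e(2)]) (simp add: dist_norm)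
  have "q0 + (e/2) *\<^sub>R axis 2 1 \<in> T \<inter> S"
    using inT subsetD[OF T(2) inT] e(1) T(4) by (simp add: S_def)
  then have ne: "z ` (T \<inter> S) \<noteq> {}" by blast
  have "open S" unfolding S_def using opos by auto
  then have open1: "open (z ` S)" by (intro op) (auto simp: S_def)
  have open2: "open (z ` (T \<inter> S))" using T(1,2) \<open>open S\<close> by (intro op) auto
  fix q assume q: "q \<in> upper_half_ball x0 \<rho>"
  then have zq: "z q \<in> z ` S" by (simp add: S_def)
  have "Im (\<Sum>k\<in>K. h k (z q) * cnj (b k (z q))) = 0"
  proof (rule Im_sesquilinear_sum_identity[where a=h and b=b and S="z ` S" and U="z ` (T \<inter> S)", OF K open1 conn h b open2 _ ne])
    fix y assume "y \<in> z ` (T \<inter> S)"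
    then obtain p where p: "p \<in> T" "p \<in> S" "y = z p" by blast
    have "w p = 0" using zero[OF p(1)] p(2) by (simp add: S_def)
    then show "Im (\<Sum>k\<in>K. h k y * cnj (b k y)) = 0" using w[OF p(2)] p(3) by auto
  qed (use zq in auto)
  then show "w q = 0" using w[of q] q by (auto simp: S_def)
qed

section \<open>Cross products and the complex structure of a tangent plane\<close>

lemma cross_cross_unit:
  fixes n t :: "real^3"
  assumes "norm n = 1" "t \<bullet> n = 0"
  shows "(t \<times> n) \<times> n = - t" "n \<times> (t \<times> n) = t" "t \<times> (t \<times> n) = - (t \<bullet> t) *\<^sub>R n"
proof -
  have nn: "n \<bullet> n = 1" using assms(1) by (simp add: norm_eq_1)
  have "n \<bullet> t = 0" using assms(2) by (simp add: inner_commute)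
  then show 1: "n \<times> (t \<times> n) = t" using nn by (simp add: Lagrange)
  show "t \<times> (t \<times> n) = - (t \<bullet> t) *\<^sub>R n" using assms(2) by (simp add: Lagrange)
  show "(t \<times> n) \<times> n = - t" using 1 cross_skew[of "t \<times> n" n] by simp
qed

text \<open>\<open>t\<close> and \<open>t \<times> n\<close> are orthogonal, of equal length, and
  lie in the plane orthogonal to \<open>n\<close>; the factor \<open>t \<bullet> t\<close> avoids a
  division.\<close>

lemma orthogonal_frame_expansion:
  fixes n t s :: "real^3"
  assumes n: "norm n = 1" and t: "t \<bullet> n = 0" and s: "s \<bullet> n = 0"
  shows "(t \<bullet> t) *\<^sub>R s = (s \<bullet> t) *\<^sub>R t + (s \<bullet> (t \<times> n)) *\<^sub>R (t \<times> n)"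
proof -
  have "(t \<times> (t \<times> n)) \<times> s = (t \<bullet> s) *\<^sub>R (t \<times> n) - ((t \<times> n) \<bullet> s) *\<^sub>R t"
    unfolding cross_skew[of "t \<times> (t \<times> n)" s] Lagrange[of s t "t \<times> n"] by (simp add: inner_commute)
  then have eq: "(t \<bullet> t) *\<^sub>R (n \<times> s) = ((t \<times> n) \<bullet> s) *\<^sub>R t - (t \<bullet> s) *\<^sub>R (t \<times> n)"
    using cross_cross_unit(3)[OF n t] by (simp add: cross_mult_left algebra_simps)
  have "n \<times> (n \<times> s) = - s"
    using cross_cross_unit(2)[OF n s] cross_skew[of n s] by simp
  then have "(t \<bullet> t) *\<^sub>R s = - (n \<times> ((t \<bullet> t) *\<^sub>R (n \<times> s)))"
    by (simp add: cross_mult_right)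
  also have "\<dots> = (t \<bullet> s) *\<^sub>R (n \<times> (t \<times> n)) - ((t \<times> n) \<bullet> s) *\<^sub>R (n \<times> t)"
    unfolding eq by (simp add: Cross3.right_diff_distrib cross_mult_right)
  also have "\<dots> = (s \<bullet> t) *\<^sub>R t + (s \<bullet> (t \<times> n)) *\<^sub>R (t \<times> n)"
    using cross_cross_unit(2)[OF n t] cross_skew[of n t] by (simp add: inner_commute)
  finally show ?thesis .
qed

text \<open>The complexified tangent vector \<open>t + i t \<times> n\<close>, tested against \<open>a\<close>. Multiplication by complex
  numbers corresponds to rotation and scaling of \<open>t\<close> in the plane orthogonal to \<open>n\<close>.\<close>

definition ctan :: "real^3 \<Rightarrow> real^3 \<Rightarrow> real^3 \<Rightarrow> complex" where
  "ctan n a t = Complex (a \<bullet> t) (a \<bullet> (t \<times> n))"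

lemma ctan_mult:
  assumes "norm n = 1" "t \<bullet> n = 0"
  shows "Complex x y * ctan n a t = ctan n a (x *\<^sub>R t - y *\<^sub>R (t \<times> n))"
  using cross_cross_unit(1)[OF assms]
  by (simp add: ctan_def complex_eq_iff inner_diff_right inner_add_right Cross3.left_diff_distrib cross_mult_left)

text \<open>A tangent plane is a complex line: the factor \<open>c\<close> relating two tangent
  vectors does not depend on the test vector \<open>a\<close>. This makes the coordinates of the
  null curve holomorphic functions of one another away from critical points.\<close>

lemma ctan_proportional:
  assumes n: "norm n = 1" and t: "t \<bullet> n = 0" "t \<noteq> 0" and s: "s \<bullet> n = 0"
  obtains c where "\<And>a. ctan n a s = c * ctan n a t" "s \<noteq> 0 \<Longrightarrow> c \<noteq> 0"
proof -
  define x where "x = (s \<bullet> t) / (t \<bullet> t)"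
  define y where "y = - (s \<bullet> (t \<times> n)) / (t \<bullet> t)"
  have tt: "t \<bullet> t \<noteq> 0" using t by simp
  have "s = (1 / (t \<bullet> t)) *\<^sub>R ((t \<bullet> t) *\<^sub>R s)" using tt by simp
  also have "\<dots> = x *\<^sub>R t - y *\<^sub>R (t \<times> n)"
    unfolding orthogonal_frame_expansion[OF n t(1) s] x_def y_def by (simp add: scaleR_add_right)
  finally have s_eq: "s = x *\<^sub>R t - y *\<^sub>R (t \<times> n)" .
  show ?thesis
  proof (rule that[of "Complex x y"])
    show "ctan n a s = Complex x y * ctan n a t" for a
      unfolding ctan_mult[OF n t(1)] s_eq[symmetric] ..
    show "Complex x y \<noteq> 0" if "s \<noteq> 0"
      using s_eq that by (auto simp: complex_eq_iff)
  qed
qed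

lemma ctan_self_nonzero: "t \<noteq> 0 \<Longrightarrow> ctan n t t \<noteq> 0"
  by (simp add: ctan_def complex_eq_iff)

text \<open>\<open>X\<close> and \<open>N\<close> are extended past the line
  \<open>q $ 2 = 0\<close>: differentiability is required on the whole disc, the geometric
  conditions only where \<open>q $ 2 \<ge> 0\<close>. The same notion serves interior and boundary
  points \<open>x0\<close>. In \<open>X'' q h v\<close> the first differentiation is along
  \<open>v\<close>, the second along \<open>h\<close>.\<close>

locale immersed_patch =
  fixes x0 :: "real^2" and r :: real and X N :: "real^2 \<Rightarrow> real^3"
    and X' N' :: "real^2 \<Rightarrow> real^2 \<Rightarrow> real^3" and X'' :: "real^2 \<Rightarrow> real^2 \<Rightarrow> real^2 \<Rightarrow> real^3"
  assumes r: "r > 0" and x0: "x0 $ 2 \<ge> 0"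
    and X': "\<And>q. q \<in> ball x0 r \<Longrightarrow> (X has_derivative X' q) (at q)"
    and X'': "\<And>q v. q \<in> ball x0 r \<Longrightarrow> ((\<lambda>q. X' q v) has_derivative (\<lambda>h. X'' q h v)) (at q)"
    and N': "\<And>q. q \<in> ball x0 r \<Longrightarrow> (N has_derivative N' q) (at q)"
    and contX'': "\<And>h v. continuous_on (ball x0 r) (\<lambda>q. X'' q h v)"
    and contN': "\<And>v. continuous_on (ball x0 r) (\<lambda>q. N' q v)"
    and unit: "\<And>q. q \<in> ball x0 r \<Longrightarrow> q $ 2 \<ge> 0 \<Longrightarrow> norm (N q) = 1"
    and normal: "\<And>q v. q \<in> ball x0 r \<Longrightarrow> q $ 2 \<ge> 0 \<Longrightarrow> X' q v \<bullet> N q = 0"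
    and immersed: "\<And>q. q \<in> ball x0 r \<Longrightarrow> q $ 2 \<ge> 0 \<Longrightarrow> inj (X' q)"
begin

abbreviation "B \<equiv> ball x0 r"
abbreviation "half \<equiv> ball x0 r \<inter> {q. q $ 2 \<ge> 0}"

lemma X''_sym: "q \<in> B \<Longrightarrow> X'' q h v = X'' q v h"
  using second_derivative_symmetric[where f=X and f'=X' and f''="\<lambda>v h. X'' q h v" and x=q and W=B] X' X'' by auto

lemma contX: "continuous_on B X" and contN: "continuous_on B N" and contX': "continuous_on B (\<lambda>q. X' q v)"
  using X' N' X'' by (meson has_derivative_continuous continuous_at_imp_continuous_on)+

lemma linX': "q \<in> B \<Longrightarrow> linear (X' q)" and linN': "q \<in> B \<Longrightarrow> linear (N' q)"
  using X' N' has_derivative_linear by blast+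

lemma half_disc_nbhd:
  assumes "q \<in> half"
  obtains e where "e > 0" "ball q e \<inter> {q. q $ 2 \<ge> 0} \<subseteq> half"
proof -
  obtain e where "e > 0" "ball q e \<subseteq> B" using assms openE[OF open_ball, of q x0 r] by auto
  then show ?thesis using that by blast
qed

text \<open>A half disc determines the full derivative, so identities known only for
  \<open>q $ 2 \<ge> 0\<close> may be differentiated in every direction.\<close>

lemma derivative_zero_on_half:
  fixes f :: "real^2 \<Rightarrow> 'b::real_normed_vector"
  assumes "\<And>q. q \<in> half \<Longrightarrow> f q = c" "q \<in> half" "(f has_derivative f') (at q)"
  shows "f' v = 0"
proof -
  obtain e where e: "e > 0" "ball q e \<inter> {q. q $ 2 \<ge> 0} \<subseteq> half" using half_disc_nbhd[OF assms(2)] .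
  have "(f has_derivative (\<lambda>_. 0)) (at q within half)"
    by (rule has_derivative_transform[OF _ _ has_derivative_const[of c]]) (use assms in auto)
  then have "f' = (\<lambda>_. 0)"
    using has_derivative_unique_half_disc[OF has_derivative_at_withinI[OF assms(3)] _ e] assms(2) by auto
  then show ?thesis by simp
qed

lemma normal_derivative_tangent: "q \<in> half \<Longrightarrow> N' q v \<bullet> N q = 0"
proof -
  assume q: "q \<in> half"
  have "((\<lambda>q. N q \<bullet> N q) has_derivative (\<lambda>v. N q \<bullet> N' q v + N' q v \<bullet> N q)) (at q)"
    using N' q by (intro has_derivative_inner) auto
  moreover have "N q \<bullet> N q = 1" if "q \<in> half" for q using unit[of q] that by (simp add: norm_eq_1)
  ultimately have "N q \<bullet> N' q v + N' q v \<bullet> N q = 0"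
    using derivative_zero_on_half[where c=1 and f="\<lambda>q. N q \<bullet> N q"] q by blast
  then show ?thesis by (simp add: inner_commute)
qed

text \<open>Weingarten's equation, from differentiating
  \<open>X' q v \<bullet> N q = 0\<close>.\<close>

lemma second_fundamental_form: "q \<in> half \<Longrightarrow> X' q v \<bullet> N' q h = - (X'' q h v \<bullet> N q)"
proof -
  assume q: "q \<in> half"
  have "((\<lambda>q. X' q v \<bullet> N q) has_derivative (\<lambda>h. X' q v \<bullet> N' q h + X'' q h v \<bullet> N q)) (at q)"
    using N' X'' q by (intro has_derivative_inner) auto
  then have "X' q v \<bullet> N' q h + X'' q h v \<bullet> N q = 0"
    using derivative_zero_on_half[where c=0 and f="\<lambda>q. X' q v \<bullet> N q"] q normal by blast
  then show ?thesis by simp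
qed

lemma second_fundamental_form_sym: "q \<in> half \<Longrightarrow> X' q v \<bullet> N' q h = X' q h \<bullet> N' q v"
  using second_fundamental_form X''_sym by auto

lemma tangent_surj:
  assumes "q \<in> half" "s \<bullet> N q = 0"
  obtains v where "X' q v = s"
proof -
  define P where "P = {s. N q \<bullet> s = 0}"
  have "N q \<noteq> 0" using unit[of q] assms by auto
  then have "dim P = 2" unfolding P_def by (simp add: dim_hyperplane)
  moreover have "dim (range (X' q)) = 2"
    using dim_image_eq[OF linX', of q UNIV] immersed[of q] assms by simp
  moreover have "subspace P" unfolding P_def by (rule subspace_hyperplane)
  moreover have "subspace (range (X' q))" "range (X' q) \<subseteq> P"
    using linX' assms normal by (auto simp: P_def linear_subspace_image inner_commute)
  ultimately have "range (X' q) = P" by (intro subspace_dim_equal) auto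
  then show ?thesis using assms that by (force simp: P_def inner_commute)
qed

lemma X'_nonzero: "q \<in> half \<Longrightarrow> v \<noteq> 0 \<Longrightarrow> X' q v \<noteq> 0"
  using immersed[of q] linX'[of q] linear_injective_0 by blast

lemma coordinate_fields_independent:
  assumes q: "q \<in> half"
  shows "X' q (axis 2 1) \<noteq> c *\<^sub>R X' q (axis 1 1)"
proof
  assume "X' q (axis 2 1) = c *\<^sub>R X' q (axis 1 1)"
  then have "X' q (axis 2 1) = X' q (c *\<^sub>R axis 1 1)" using linear_scale[OF linX'] q by simp
  then have "axis 2 1 = (c *\<^sub>R axis 1 1 :: real^2)" using immersed[of q] q by (auto dest: injD)
  then have "(axis 2 1 :: real^2) $ 2 = (c *\<^sub>R axis 1 1 :: real^2) $ 2" by simp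
  then show False by (simp add: axis_def)
qed

text \<open>The trace is the mean curvature times det g, and the conclusion says that the form dX
  \<times> N is closed. Up to sign, \<open>Z\<close> is the exterior derivative of that form on the
  coordinate vectors. It is a multiple of \<open>N q\<close>, so its product with
  \<open>x1 \<times> x2\<close> detects it, and Lagrange's identity turns this product into minus
  the trace.\<close>

lemma minimal_of_trace:
  assumes q: "q \<in> half"
    and trace: "(X' q (axis 2 1) \<bullet> X' q (axis 2 1)) * (X'' q (axis 1 1) (axis 1 1) \<bullet> N q)
      - 2 * (X' q (axis 1 1) \<bullet> X' q (axis 2 1)) * (X'' q (axis 1 1) (axis 2 1) \<bullet> N q)
      + (X' q (axis 1 1) \<bullet> X' q (axis 1 1)) * (X'' q (axis 2 1) (axis 2 1) \<bullet> N q) = 0"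
  shows "X' q v \<times> N' q w = X' q w \<times> N' q v"
proof -
  define x1 x2 n1 n2 where "x1 = X' q (axis 1 1)" and "x2 = X' q (axis 2 1)"
    and "n1 = N' q (axis 1 1)" and "n2 = N' q (axis 2 1)"
  have nn: "N q \<bullet> N q = 1" using unit[of q] q by (simp add: norm_eq_1)
  have perp: "x1 \<bullet> N q = 0" "x2 \<bullet> N q = 0" "n1 \<bullet> N q = 0" "n2 \<bullet> N q = 0"
    using normal[of q] normal_derivative_tangent[OF q] q by (auto simp: x1_def x2_def n1_def n2_def)
  have par: "a \<times> b = ((a \<times> b) \<bullet> N q) *\<^sub>R N q" if "a \<bullet> N q = 0" "b \<bullet> N q = 0" for a b
  proof -
    have "N q \<times> (a \<times> b) = 0" using that by (simp add: Lagrange inner_commute)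
    then have "0 = (N q \<bullet> (a \<times> b)) *\<^sub>R N q - (N q \<bullet> N q) *\<^sub>R (a \<times> b)"
      unfolding Lagrange[of "N q" "N q" "a \<times> b", symmetric] by simp
    then show ?thesis using nn by (simp add: inner_commute)
  qed
  define Z where "Z = x1 \<times> n2 - x2 \<times> n1"
  have Z: "Z = (Z \<bullet> N q) *\<^sub>R N q"
    using par[OF perp(1,4)] par[OF perp(2,3)] by (simp add: Z_def inner_diff_left scaleR_diff_left)
  have x12: "x1 \<times> x2 \<noteq> 0"
  proof
    assume "x1 \<times> x2 = 0"
    then have "collinear {0, x1, x2}" by (simp add: cross_eq_0)
    moreover have "x1 \<noteq> 0" "x2 \<noteq> 0" using X'_nonzero[OF q] by (simp_all add: x1_def x2_def axis_eq_0_iff)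
    ultimately obtain c where "x2 = c *\<^sub>R x1" by (auto simp: collinear_lemma)
    then show False using coordinate_fields_independent[OF q] by (simp add: x1_def x2_def)
  qed
  have h: "x1 \<bullet> n1 = - (X'' q (axis 1 1) (axis 1 1) \<bullet> N q)" "x2 \<bullet> n2 = - (X'' q (axis 2 1) (axis 2 1) \<bullet> N q)"
    "x2 \<bullet> n1 = - (X'' q (axis 1 1) (axis 2 1) \<bullet> N q)" "x1 \<bullet> n2 = - (X'' q (axis 1 1) (axis 2 1) \<bullet> N q)"
    using second_fundamental_form[OF q] X''_sym[of q] q by (auto simp: x1_def x2_def n1_def n2_def)
  have "(x1 \<times> x2) \<bullet> Z = (x1 \<bullet> x1) * (x2 \<bullet> n2) - (x1 \<bullet> n2) * (x1 \<bullet> x2) - (x1 \<bullet> x2) * (x2 \<bullet> n1) + (x1 \<bullet> n1) * (x2 \<bullet> x2)"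
    by (simp add: Z_def cross3_simps)
  also have "\<dots> = 0" using trace unfolding h x1_def[symmetric] x2_def[symmetric] by (simp add: algebra_simps)
  finally have "(x1 \<times> x2) \<bullet> Z = 0" .
  moreover have "(x1 \<times> x2) \<bullet> Z = (Z \<bullet> N q) * ((x1 \<times> x2) \<bullet> N q)"
    using arg_cong[OF Z, of "\<lambda>y. (x1 \<times> x2) \<bullet> y"] by simp
  moreover have "(x1 \<times> x2) \<bullet> N q \<noteq> 0" using par[OF perp(1,2)] x12 by force
  ultimately have "Z = 0" using Z by simp
  have vw: "X' q y = y $ 1 *\<^sub>R x1 + y $ 2 *\<^sub>R x2" "N' q y = y $ 1 *\<^sub>R n1 + y $ 2 *\<^sub>R n2" for y
  proof -
    have y: "y = y $ 1 *\<^sub>R axis 1 1 + y $ 2 *\<^sub>R axis 2 1" by (simp add: vec_eq_iff forall_2 axis_def)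
    have lin: "linear (X' q)" "linear (N' q)" using linX' linN' q by auto
    show "X' q y = y $ 1 *\<^sub>R x1 + y $ 2 *\<^sub>R x2"
      using arg_cong[OF y, of "X' q"] by (simp only: linear_add[OF lin(1)] linear_scale[OF lin(1)] x1_def x2_def)
    show "N' q y = y $ 1 *\<^sub>R n1 + y $ 2 *\<^sub>R n2"
      using arg_cong[OF y, of "N' q"] by (simp only: linear_add[OF lin(2)] linear_scale[OF lin(2)] n1_def n2_def)
  qed
  have "X' q v \<times> N' q w - X' q w \<times> N' q v = (v $ 1 * w $ 2 - v $ 2 * w $ 1) *\<^sub>R Z"
    unfolding vw Z_def
    by (simp add: cross_add_left cross_add_right cross_mult_left cross_mult_right scaleR_diff_right scaleR_diff_left algebra_simps)
  then show ?thesis using \<open>Z = 0\<close> by simp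
qed

end

section \<open>Minimal patches: conjugate surface and holomorphic coordinates\<close>

locale minimal_patch = immersed_patch +
  assumes minimal: "\<And>q v w. q \<in> ball x0 r \<Longrightarrow> q $ 2 \<ge> 0 \<Longrightarrow> X' q v \<times> N' q w = X' q w \<times> N' q v"
begin

text \<open>\<open>Y\<close> is the conjugate minimal surface. The derivative of the form has two
  summands: the first is symmetric by equality of mixed derivatives, the second by
  minimality.\<close>

lemma conjugate_exists:
  "\<exists>Y Y'. (\<forall>q\<in>B. (Y has_derivative Y' q) (at q)) \<and>
    (\<forall>v. continuous_on B (\<lambda>q. Y' q v)) \<and> (\<forall>q\<in>half. \<forall>v. Y' q v = X' q v \<times> N q)"
proof (rule closed_form_primitive[where w="\<lambda>q v. X' q v \<times> N q" and w'="\<lambda>q h v. X'' q h v \<times> N q + X' q v \<times> N' q h", OF r])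
  have bb: "bounded_bilinear (\<times>)" using bilinear_cross by (simp add: bilinear_conv_bounded_bilinear)
  show "linear (\<lambda>v. X' q v \<times> N q)" if "q \<in> B" for q
    using linX'[OF that] by (auto intro!: linearI simp: linear_add linear_scale cross_add_left cross_mult_left)
  show "((\<lambda>q. X' q v \<times> N q) has_derivative (\<lambda>h. X'' q h v \<times> N q + X' q v \<times> N' q h)) (at q)"
    if "q \<in> B" for q v
    using bounded_bilinear.FDERIV[OF bb X''[OF that] N'[OF that]] by (simp add: add.commute)
  show "continuous_on B (\<lambda>q. X'' q h v \<times> N q + X' q v \<times> N' q h)" for h v
    by (intro continuous_intros continuous_on_cross contX'' contX' contN contN')
  show "x0 + t *\<^sub>R (q - x0) \<in> half" if "q \<in> half" "0 \<le> t" "t \<le> 1" for q t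
  proof -
    have "convex half" by (intro convex_Int convex_ball) (auto simp: convex_alt)
    moreover have "x0 \<in> half" using r x0 by simp
    ultimately have "(1 - t) *\<^sub>R x0 + t *\<^sub>R q \<in> half" using that by (simp add: convex_alt)
    then show ?thesis by (simp add: algebra_simps)
  qed
  show "X'' q h v \<times> N q + X' q v \<times> N' q h = X'' q v h \<times> N q + X' q h \<times> N' q v" if "q \<in> half" for q h v
    using X''_sym[of q h v] minimal[of q v h] that by simp
qed auto

definition Y where "Y = (SOME Y. \<exists>Y'. (\<forall>q\<in>B. (Y has_derivative Y' q) (at q)) \<and>
    (\<forall>v. continuous_on B (\<lambda>q. Y' q v)) \<and> (\<forall>q\<in>half. \<forall>v. Y' q v = X' q v \<times> N q))"

definition Y' where "Y' = (SOME Y'. (\<forall>q\<in>B. (Y has_derivative Y' q) (at q)) \<and>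
    (\<forall>v. continuous_on B (\<lambda>q. Y' q v)) \<and> (\<forall>q\<in>half. \<forall>v. Y' q v = X' q v \<times> N q))"

lemma Y': "q \<in> B \<Longrightarrow> (Y has_derivative Y' q) (at q)"
  and contY': "continuous_on B (\<lambda>q. Y' q v)"
  and Y'_eq: "q \<in> half \<Longrightarrow> Y' q v = X' q v \<times> N q"
proof -
  have "\<exists>Y'. (\<forall>q\<in>B. (Y has_derivative Y' q) (at q)) \<and>
    (\<forall>v. continuous_on B (\<lambda>q. Y' q v)) \<and> (\<forall>q\<in>half. \<forall>v. Y' q v = X' q v \<times> N q)"
    unfolding Y_def using conjugate_exists by (rule someI_ex)
  then have "(\<forall>q\<in>B. (Y has_derivative Y' q) (at q)) \<and>
    (\<forall>v. continuous_on B (\<lambda>q. Y' q v)) \<and> (\<forall>q\<in>half. \<forall>v. Y' q v = X' q v \<times> N q)"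
    unfolding Y'_def by (rule someI_ex)
  then show "q \<in> B \<Longrightarrow> (Y has_derivative Y' q) (at q)"
    and "continuous_on B (\<lambda>q. Y' q v)" and "q \<in> half \<Longrightarrow> Y' q v = X' q v \<times> N q" by auto
qed

text \<open>Over \<open>half\<close>, the component along \<open>a\<close> of the null curve X + i
  Y.\<close>

definition \<Psi> where "\<Psi> a q = Complex (a \<bullet> X q) (a \<bullet> Y q)"
definition \<Psi>' where "\<Psi>' a q v = Complex (a \<bullet> X' q v) (a \<bullet> Y' q v)"

lemma \<Psi>': "q \<in> B \<Longrightarrow> (\<Psi> a has_derivative \<Psi>' a q) (at q)"
proof -
  assume q: "q \<in> B"
  have "((\<lambda>q. complex_of_real (a \<bullet> X q) + \<i> * complex_of_real (a \<bullet> Y q)) has_derivative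
      (\<lambda>v. complex_of_real (a \<bullet> X' q v) + \<i> * complex_of_real (a \<bullet> Y' q v))) (at q)"
    using X'[OF q] Y'[OF q]
    by (intro has_derivative_add has_derivative_mult_right has_derivative_of_real has_derivative_inner_right)
  then show ?thesis unfolding \<Psi>_def \<Psi>'_def Complex_eq .
qed

lemma cont\<Psi>': "continuous_on B (\<lambda>q. \<Psi>' a q v)"
  unfolding \<Psi>'_def Complex_eq by (intro continuous_intros contX' contY')

lemma \<Psi>'_ctan: "q \<in> half \<Longrightarrow> \<Psi>' a q v = ctan (N q) a (X' q v)"
  by (simp add: \<Psi>'_def ctan_def Y'_eq)

text \<open>The Cauchy-Riemann equation of \<open>\<Psi> a\<close> relative to the coordinate
  \<open>\<Psi> e\<close>; the quotient is its complex derivative.\<close>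

lemma \<Psi>'_proportional:
  assumes q: "q \<in> half" and ne: "\<Psi>' e q v0 \<noteq> 0"
  shows "\<Psi>' a q v = \<Psi>' a q v0 / \<Psi>' e q v0 * \<Psi>' e q v"
proof -
  have "v0 \<noteq> 0" using ne linear_0[OF linX', of q] q by (auto simp: \<Psi>'_ctan ctan_def complex_eq_iff)
  then have t0: "X' q v0 \<noteq> 0" using X'_nonzero[OF q] by blast
  obtain c where "\<And>a. ctan (N q) a (X' q v) = c * ctan (N q) a (X' q v0)"
    using ctan_proportional[OF unit normal t0 normal] q by (metis Int_iff mem_Collect_eq)
  then show ?thesis using ne q by (simp add: \<Psi>'_ctan)
qed

lemma inj_\<Psi>':
  assumes q: "q \<in> half" and ne: "\<Psi>' e q v0 \<noteq> 0"
  shows "inj (\<Psi>' e q)"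
proof -
  have "v0 \<noteq> 0" using ne linear_0[OF linX', of q] q by (auto simp: \<Psi>'_ctan ctan_def complex_eq_iff)
  have lin: "linear (\<Psi>' e q)" using \<Psi>' q has_derivative_linear by blast
  have "v = 0" if "\<Psi>' e q v = 0" for v
  proof (rule ccontr)
    assume "v \<noteq> 0"
    then have nz: "X' q v0 \<noteq> 0" "X' q v \<noteq> 0" using X'_nonzero[OF q] \<open>v0 \<noteq> 0\<close> by blast+
    obtain c where "\<And>a. ctan (N q) a (X' q v) = c * ctan (N q) a (X' q v0)" "c \<noteq> 0"
      using ctan_proportional[OF unit normal nz(1) normal] q nz(2) by (metis Int_iff mem_Collect_eq)
    then show False using that ne q by (simp add: \<Psi>'_ctan)
  qed
  then show ?thesis using lin linear_injective_0 by blast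
qed

lemma coordinate_derivative:
  assumes q: "q \<in> half" and ne: "\<Psi>' e q v0 \<noteq> 0"
  shows "(\<Psi> a has_derivative (\<lambda>v. \<Psi>' a q v0 / \<Psi>' e q v0 * \<Psi>' e q v)) (at q)"
proof -
  have "\<Psi>' a q = (\<lambda>v. \<Psi>' a q v0 / \<Psi>' e q v0 * \<Psi>' e q v)"
    using \<Psi>'_proportional[OF assms] by blast
  then show ?thesis using \<Psi>'[of q a] q by simp
qed

lemma conformal_coordinate:
  assumes ne: "\<Psi>' e x0 v0 \<noteq> 0"
  obtains U g where "open U" "x0 \<in> U" "U \<subseteq> B" "open (\<Psi> e ` U)" "continuous_on (\<Psi> e ` U) g"
    "\<And>q. q \<in> U \<Longrightarrow> g (\<Psi> e q) = q" "\<And>q. q \<in> U \<Longrightarrow> bij (\<Psi>' e q)"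
    "\<And>q. q \<in> U \<Longrightarrow> (g has_derivative inv (\<Psi>' e q)) (at (\<Psi> e q))" "\<And>q. q \<in> U \<Longrightarrow> \<Psi>' e q v0 \<noteq> 0"
proof -
  have x0h: "x0 \<in> half" and x0B: "x0 \<in> B" using r x0 by auto
  have v0: "v0 \<noteq> 0" using ne linear_0[OF has_derivative_linear[OF \<Psi>'[OF x0B]]] by metis
  obtain U g where U: "open U" "x0 \<in> U" "U \<subseteq> B" "open (\<Psi> e ` U)" "continuous_on (\<Psi> e ` U) g"
    "\<And>q. q \<in> U \<Longrightarrow> g (\<Psi> e q) = q" "\<And>q. q \<in> U \<Longrightarrow> bij (\<Psi>' e q)"
    "\<And>q. q \<in> U \<Longrightarrow> (g has_derivative inv (\<Psi>' e q)) (at (\<Psi> e q))"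
    by (rule local_complex_coordinate[OF open_ball x0B \<Psi>' cont\<Psi>' inj_\<Psi>'[OF x0h ne]]) auto
  have "\<Psi>' e q v0 \<noteq> 0" if "q \<in> U" for q
  proof -
    have "linear (\<Psi>' e q)" using \<Psi>' U(3) that has_derivative_linear by blast
    then show ?thesis using U(7)[OF that] v0 linear_injective_0 bij_is_inj by blast
  qed
  then show ?thesis using that[OF U] by blast
qed

text \<open>\<open>F a\<close> is \<open>\<Psi> a\<close> written in the coordinate
  \<open>\<Psi> e\<close>. Its derivative at \<open>z q\<close> tests \<open>a\<close> against t + i
  t \<times> N q, a null vector from which \<open>N q\<close> can be recovered; this is how the
  normal enters statements about holomorphic functions.\<close>

lemma interior_coordinate:
  obtains \<rho> z F where "\<rho> > 0" "\<rho> \<le> r"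
    "connected (z ` (upper_half_ball x0 \<rho>))"
    "\<And>T. open T \<Longrightarrow> T \<subseteq> ball x0 \<rho> \<Longrightarrow> open (z ` T)"
    "\<And>a. F a holomorphic_on z ` (upper_half_ball x0 \<rho>)"
    "\<And>a q. q \<in> ball x0 \<rho> \<Longrightarrow> Re (F a (z q)) = a \<bullet> X q"
    "\<And>q. q \<in> upper_half_ball x0 \<rho> \<Longrightarrow>
       \<exists>t. t \<noteq> 0 \<and> t \<bullet> N q = 0 \<and> (\<forall>a. deriv (F a) (z q) = Complex (a \<bullet> t) (a \<bullet> (t \<times> N q)))"
proof -
  define v0 :: "real^2" where "v0 = axis 1 1"
  \<comment> \<open>Testing against this vector makes the real part of
    \<open>\<Psi>' e x0 v0\<close> its squared length, hence nonzero.\<close>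
  define e where "e = X' x0 v0"
  have v0: "v0 \<noteq> 0" by (simp add: v0_def axis_eq_0_iff)
  have x0h: "x0 \<in> half" using r x0 by simp
  have "\<Psi>' e x0 v0 \<noteq> 0"
    using ctan_self_nonzero[OF X'_nonzero[OF x0h v0]] \<Psi>'_ctan[OF x0h] by (simp add: e_def)
  from conformal_coordinate[OF this]
  obtain U g where U: "open U" "x0 \<in> U" "U \<subseteq> B" "open (\<Psi> e ` U)" and cg: "continuous_on (\<Psi> e ` U) g"
    and g: "\<And>q. q \<in> U \<Longrightarrow> g (\<Psi> e q) = q" "\<And>q. q \<in> U \<Longrightarrow> bij (\<Psi>' e q)"
      "\<And>q. q \<in> U \<Longrightarrow> (g has_derivative inv (\<Psi>' e q)) (at (\<Psi> e q))" and ne: "\<And>q. q \<in> U \<Longrightarrow> \<Psi>' e q v0 \<noteq> 0"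
    by blast
  obtain \<rho> where \<rho>: "\<rho> > 0" "ball x0 \<rho> \<subseteq> U" using U(1,2) open_contains_ball by blast
  define \<rho>' where "\<rho>' = min \<rho> r"
  have \<rho>': "\<rho>' > 0" "\<rho>' \<le> r" "ball x0 \<rho>' \<subseteq> U" using \<rho> r by (auto simp: \<rho>'_def)
  define S where "S = upper_half_ball x0 \<rho>'"
  have SU: "q \<in> U" "q \<in> half" if "q \<in> S" for q using that \<rho>' U by (auto simp: S_def)
  define F where "F = (\<lambda>a w. \<Psi> a (g w))"
  have open_img: "open (\<Psi> e ` T)" if "open T" "T \<subseteq> ball x0 \<rho>'" for T
  proof -
    have "\<Psi> e ` T = \<Psi> e ` U \<inter> g -` T" using that g(1) \<rho>'(3) by force
    then show ?thesis using continuous_open_preimage[OF cg U(4) that(1)] by simp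
  qed
  have derF: "(F a has_field_derivative \<Psi>' a q v0 / \<Psi>' e q v0) (at (\<Psi> e q))" if "q \<in> S" for a q
    unfolding F_def
    by (rule has_field_derivative_through_coordinate[OF g(3) g(1) g(2) coordinate_derivative]) (use SU ne that in auto)
  note open_upper_half_plane
  then have "open S" unfolding S_def by auto
  show ?thesis
  proof (rule that[of \<rho>' "\<Psi> e" F])
    have "continuous_on S (\<Psi> e)"
      using \<Psi>' SU by (meson Int_iff has_derivative_continuous continuous_at_imp_continuous_on)
    moreover have "connected S"
      unfolding S_def by (intro convex_connected convex_Int convex_ball convex_upper_half_plane)
    ultimately show "connected (\<Psi> e ` (upper_half_ball x0 \<rho>'))"
      unfolding S_def by (rule connected_continuous_image)
    show "F a holomorphic_on \<Psi> e ` (upper_half_ball x0 \<rho>')" for a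
      unfolding S_def[symmetric] holomorphic_on_def using derF
      by (auto simp: field_differentiable_def intro: field_differentiable_at_within)
        (meson field_differentiable_at_within field_differentiable_def)
    show "Re (F a (\<Psi> e q)) = a \<bullet> X q" if "q \<in> ball x0 \<rho>'" for a q
      using that \<rho>' g(1) by (auto simp: F_def \<Psi>_def subset_iff)
    show "\<exists>t. t \<noteq> 0 \<and> t \<bullet> N q = 0 \<and> (\<forall>a. deriv (F a) (\<Psi> e q) = Complex (a \<bullet> t) (a \<bullet> (t \<times> N q)))"
      if "q \<in> upper_half_ball x0 \<rho>'" for q
    proof -
      have q: "q \<in> S" using that by (simp add: S_def)
      define t0 where "t0 = X' q v0"
      define c where "c = inverse (\<Psi>' e q v0)"
      \<comment> \<open>Division by \<open>\<Psi>' e q v0\<close> in terms of vectors: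
        multiplication by \<open>c\<close> rotates and scales \<open>t0\<close> in the tangent
        plane.\<close>
      define t where "t = Re c *\<^sub>R t0 - Im c *\<^sub>R (t0 \<times> N q)"
      have u: "norm (N q) = 1" "t0 \<bullet> N q = 0" using unit normal SU(2)[OF q] by (auto simp: t0_def)
      have *: "deriv (F a) (\<Psi> e q) = ctan (N q) a t" for a
      proof -
        have "deriv (F a) (\<Psi> e q) = c * ctan (N q) a t0"
          using DERIV_imp_deriv[OF derF[OF q, of a]] \<Psi>'_ctan[OF SU(2)[OF q], of a v0]
          by (simp only: c_def t0_def divide_inverse mult.commute)
        also have "\<dots> = ctan (N q) a t"
          using ctan_mult[OF u, of "Re c" "Im c" a] unfolding t_def by (simp only: complex.collapse)
        finally show ?thesis .
      qed
      have "ctan (N q) e t \<noteq> 0"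
        using DERIV_imp_deriv[OF derF[OF q, of e]] * ne[OF SU(1)[OF q]] by simp
      then have "t \<noteq> 0" by (auto simp: ctan_def complex_eq_iff)
      moreover have "t \<bullet> N q = 0" using u by (simp add: t_def inner_diff_left dot_cross_self)
      ultimately show ?thesis using * unfolding ctan_def by blast
    qed
  qed (use \<rho>' open_img in auto)
qed

lemma height_unique_continuation: "unique_continuation x0 r (\<lambda>q. a \<bullet> X q - c = 0)"
proof -
  obtain \<rho> z F where \<rho>: "\<rho> > 0" "\<rho> \<le> r"
    and zF: "connected (z ` (upper_half_ball x0 \<rho>))"
    "\<And>T. open T \<Longrightarrow> T \<subseteq> ball x0 \<rho> \<Longrightarrow> open (z ` T)"
    and hol: "\<And>a. F a holomorphic_on z ` (upper_half_ball x0 \<rho>)"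
    and F: "\<And>a q. q \<in> ball x0 \<rho> \<Longrightarrow> Re (F a (z q)) = a \<bullet> X q"
    using interior_coordinate by metis
  show ?thesis
    unfolding unique_continuation_def
  proof (intro exI[of _ \<rho>] conjI allI impI \<rho>)
    fix T q0 q
    assume A: "open T" "T \<subseteq> ball x0 \<rho>" "q0 \<in> T" "q0 $ 2 \<ge> 0"
      "\<forall>q\<in>T. q $ 2 \<ge> 0 \<longrightarrow> a \<bullet> X q - c = 0" "q \<in> ball x0 \<rho>" "q $ 2 \<ge> 0"
    \<comment> \<open>The factor i turns the real part \<open>a \<bullet> X q - c\<close> into an
      imaginary part; one summand with constant second factor 1 is enough.\<close>
    show "a \<bullet> X q - c = 0"
    proof (rule half_disc_propagation[where z=z and K="UNIV :: unit set" and h="\<lambda>_ y. \<i> * (F a y - of_real c)" and b="\<lambda>_ _. 1", OF zF])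
      show "continuous_on (ball x0 \<rho>) (\<lambda>q. a \<bullet> X q - c)"
        using \<rho> by (intro continuous_intros continuous_on_subset[OF contX]) auto
      show "\<exists>m. m \<noteq> 0 \<and> m * (a \<bullet> X q - c) = Im (\<Sum>k\<in>(UNIV :: unit set). \<i> * (F a (z q) - of_real c) * cnj 1)"
        if "q \<in> upper_half_ball x0 \<rho>" for q
        using F[of q a] that by (intro exI[of _ 1]) simp
    qed (use A hol in \<open>auto intro!: holomorphic_intros\<close>)
  qed
qed

text \<open>Write f = X + i Y and \<phi> = f' = t + i u with u = t \<times> N. Then \<phi> \<times>
  cnj \<phi> = - 2 i (t \<times> u) = 2 i |t|^2 N, so ((n \<times> f) \<times> \<phi>) \<bullet> cnj
  \<phi> has imaginary part 2 |t|^2 (n \<times> X) \<bullet> N.\<close>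

lemma rotation_field_unique_continuation: "unique_continuation x0 r (\<lambda>q. (n \<times> X q) \<bullet> N q = 0)"
proof -
  obtain \<rho> z F where \<rho>: "\<rho> > 0" "\<rho> \<le> r"
    and zF: "connected (z ` (upper_half_ball x0 \<rho>))"
    "\<And>T. open T \<Longrightarrow> T \<subseteq> ball x0 \<rho> \<Longrightarrow> open (z ` T)"
    and hol: "\<And>a. F a holomorphic_on z ` (upper_half_ball x0 \<rho>)"
    and F: "\<And>a q. q \<in> ball x0 \<rho> \<Longrightarrow> Re (F a (z q)) = a \<bullet> X q"
    and F': "\<And>q. q \<in> upper_half_ball x0 \<rho> \<Longrightarrow>
       \<exists>t. t \<noteq> 0 \<and> t \<bullet> N q = 0 \<and> (\<forall>a. deriv (F a) (z q) = Complex (a \<bullet> t) (a \<bullet> (t \<times> N q)))"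
    using interior_coordinate by metis
  define f :: "3 \<Rightarrow> complex \<Rightarrow> complex" where "f = (\<lambda>k. F (axis k 1))"
  define \<phi> where "\<phi> = (\<lambda>k. deriv (f k))"
  \<comment> \<open>\<open>m\<close> is n \<times> f and \<open>h\<close> is m \<times> \<phi>,
    spelled out in coordinates because the entries are complex.\<close>
  define m :: "3 \<Rightarrow> complex \<Rightarrow> complex" where "m = (\<lambda>k y.
     if k = 1 then of_real (n $ 2) * f 3 y - of_real (n $ 3) * f 2 y
     else if k = 2 then of_real (n $ 3) * f 1 y - of_real (n $ 1) * f 3 y
     else of_real (n $ 1) * f 2 y - of_real (n $ 2) * f 1 y)"
  define h where "h = (\<lambda>k::3. \<lambda>y.
     if k = 1 then m 2 y * \<phi> 3 y - m 3 y * \<phi> 2 y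
     else if k = 2 then m 3 y * \<phi> 1 y - m 1 y * \<phi> 3 y
     else m 1 y * \<phi> 2 y - m 2 y * \<phi> 1 y)"
  note open_upper_half_plane
  then have ope: "open (z ` (upper_half_ball x0 \<rho>))" by (intro zF(2)) auto
  have holf: "f k holomorphic_on z ` (upper_half_ball x0 \<rho>)" for k
    unfolding f_def by (rule hol)
  have hol\<phi>: "\<phi> k holomorphic_on z ` (upper_half_ball x0 \<rho>)" for k
    unfolding \<phi>_def by (intro holomorphic_deriv holf ope)
  have holm: "m k holomorphic_on z ` (upper_half_ball x0 \<rho>)" for k
    unfolding m_def by (cases "k = 1"; cases "k = 2"; auto intro!: holomorphic_intros holf)
  have holh: "h k holomorphic_on z ` (upper_half_ball x0 \<rho>)" for k
    unfolding h_def by (cases "k = 1"; cases "k = 2"; auto intro!: holomorphic_intros holm hol\<phi>)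
  have key: "\<exists>c. c \<noteq> 0 \<and> c * ((n \<times> X q) \<bullet> N q) = Im (\<Sum>k\<in>UNIV. h k (z q) * cnj (\<phi> k (z q)))"
    if q: "q \<in> upper_half_ball x0 \<rho>" for q
  proof -
    obtain t where t: "t \<noteq> 0" "t \<bullet> N q = 0" and d: "\<And>a. deriv (F a) (z q) = Complex (a \<bullet> t) (a \<bullet> (t \<times> N q))"
      using F'[OF q] by blast
    define u where "u = t \<times> N q"
    have \<phi>: "\<phi> k (z q) = Complex (t $ k) (u $ k)" for k
      unfolding \<phi>_def f_def d u_def by (simp add: inner_axis')
    have Ref: "Re (f k (z q)) = X q $ k" for k
      using F[of q "axis k 1"] q by (simp add: f_def inner_axis')
    have "Im (\<Sum>k\<in>UNIV. h k (z q) * cnj (\<phi> k (z q))) = - 2 * ((n \<times> X q) \<bullet> (t \<times> u))"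
      unfolding sum_3 h_def m_def \<phi> by (simp add: Ref cross3_simps) 
    also have "t \<times> u = - (t \<bullet> t) *\<^sub>R N q"
      unfolding u_def using unit[of q] q \<rho> t(2) by (intro cross_cross_unit(3)) auto
    finally have "(2 * (t \<bullet> t)) * ((n \<times> X q) \<bullet> N q) = Im (\<Sum>k\<in>UNIV. h k (z q) * cnj (\<phi> k (z q)))"
      by simp
    then show ?thesis using t(1) by (intro exI[of _ "2 * (t \<bullet> t)"]) auto
  qed
  show ?thesis
    unfolding unique_continuation_def
  proof (intro exI[of _ \<rho>] conjI allI impI \<rho>)
    fix T q0 q
    assume A: "open T" "T \<subseteq> ball x0 \<rho>" "q0 \<in> T" "q0 $ 2 \<ge> 0"
      "\<forall>q\<in>T. q $ 2 \<ge> 0 \<longrightarrow> (n \<times> X q) \<bullet> N q = 0" "q \<in> ball x0 \<rho>" "q $ 2 \<ge> 0"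
    show "(n \<times> X q) \<bullet> N q = 0"
    proof (rule half_disc_propagation[where z=z and K="UNIV :: 3 set" and h=h and b=\<phi>, OF zF _ holh hol\<phi> key _ A(1-4) _ A(6,7)])
      show "continuous_on (ball x0 \<rho>) (\<lambda>q. (n \<times> X q) \<bullet> N q)"
        using \<rho> by (intro continuous_intros continuous_on_cross continuous_on_subset[OF contX] continuous_on_subset[OF contN]) auto
    qed (use A(5) in auto)
  qed
qed

text \<open>Strong maximum principle for the harmonic function a \<bullet> X: the modulus of exp (F
  a) is exp (a \<bullet> X), so the maximum modulus principle applies. The radius
  \<open>\<rho>\<close> does not depend on \<open>a\<close>.\<close>

lemma interior_maximum:
  assumes "x0 $ 2 > 0"
  obtains \<rho> where "\<rho> > 0" "\<rho> \<le> r"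
    "\<And>a q. (\<And>q. q \<in> half \<Longrightarrow> a \<bullet> X q \<le> a \<bullet> X x0) \<Longrightarrow> q \<in> ball x0 \<rho> \<Longrightarrow> q $ 2 > 0 \<Longrightarrow> a \<bullet> X q = a \<bullet> X x0"
proof -
  obtain \<rho> z F where \<rho>: "\<rho> > 0" "\<rho> \<le> r"
    and zF: "connected (z ` (upper_half_ball x0 \<rho>))"
    "\<And>T. open T \<Longrightarrow> T \<subseteq> ball x0 \<rho> \<Longrightarrow> open (z ` T)"
    and hol: "\<And>a. F a holomorphic_on z ` (upper_half_ball x0 \<rho>)"
    and F: "\<And>a q. q \<in> ball x0 \<rho> \<Longrightarrow> Re (F a (z q)) = a \<bullet> X q"
    using interior_coordinate by metis
  define S where "S = upper_half_ball x0 \<rho>"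
  note open_upper_half_plane
  then have ope: "open (z ` S)" unfolding S_def by (intro zF(2)) auto
  have x0S: "x0 \<in> S" using assms \<rho> by (simp add: S_def)
  show ?thesis
  proof (rule that[OF \<rho>])
    fix a q assume max: "\<And>q. q \<in> half \<Longrightarrow> a \<bullet> X q \<le> a \<bullet> X x0" and q: "q \<in> ball x0 \<rho>" "q $ 2 > 0"
    have nrm: "norm (exp (F a (z p))) = exp (a \<bullet> X p)" if "p \<in> S" for p
      using F[of p a] that by (simp add: S_def)
    have "(\<lambda>y. exp (F a y)) constant_on z ` S"
    proof (rule maximum_modulus_principle[OF _ ope _ ope order_refl])
      show "(\<lambda>y. exp (F a y)) holomorphic_on z ` S"
        using hol[of a] unfolding S_def by (intro holomorphic_intros)
      show "connected (z ` S)" using zF(1) by (simp add: S_def)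
      show "z x0 \<in> z ` S" using x0S by blast
      fix y assume "y \<in> z ` S"
      then obtain p where p: "p \<in> S" "y = z p" by blast
      then show "norm (exp (F a y)) \<le> norm (exp (F a (z x0)))"
        using nrm x0S max[of p] \<rho> by (auto simp: S_def)
    qed
    then have "exp (F a (z q)) = exp (F a (z x0))"
      using x0S q unfolding constant_on_def S_def by auto
    then have "exp (a \<bullet> X q) = exp (a \<bullet> X x0)" using nrm x0S q by (metis (mono_tags, lifting) IntI S_def mem_Collect_eq)
    then show "a \<bullet> X q = a \<bullet> X x0" by simp
  qed
qed

end

section \<open>Free boundary arcs\<close>

lemma derivative_zero_half_ball:
  fixes f :: "real^2 \<Rightarrow> 'b::real_normed_vector"
  assumes f: "\<And>q. q \<in> ball x0 \<rho> \<Longrightarrow> q $ 2 \<ge> 0 \<Longrightarrow> f q = c" and q: "q \<in> ball x0 \<rho>" "q $ 2 \<ge> 0"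
    and "(f has_derivative f') (at q)"
  shows "f' v = 0"
proof -
  let ?S = "ball x0 \<rho> \<inter> {q. q $ 2 \<ge> 0}"
  obtain e where e: "e > 0" "ball q e \<subseteq> ball x0 \<rho>" using q openE[OF open_ball, of q x0 \<rho>] by auto
  have "(f has_derivative (\<lambda>_. 0)) (at q within ?S)"
    by (rule has_derivative_transform[OF _ _ has_derivative_const[of c]]) (use assms in auto)
  then have "f' = (\<lambda>_. 0)"
    using e q by (intro has_derivative_unique_half_disc[OF has_derivative_at_withinI[OF assms(4)] _ e(1)]) auto
  then show ?thesis by simp
qed

lemma orthonormal_pair_spans:
  fixes x y v :: "real^3"
  assumes "norm x = 1" "norm y = 1" "x \<bullet> y = 0"
  shows "v = (v \<bullet> x) *\<^sub>R x + (v \<bullet> y) *\<^sub>R y + (v \<bullet> (x \<times> y)) *\<^sub>R (x \<times> y)"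
proof -
  define s where "s = v - (v \<bullet> y) *\<^sub>R y"
  have n: "x \<bullet> x = 1" "y \<bullet> y = 1" using assms by (auto simp: norm_eq_1)
  have sy: "s \<bullet> y = 0" using n by (simp add: s_def inner_diff_left)
  have "s = (s \<bullet> x) *\<^sub>R x + (s \<bullet> (x \<times> y)) *\<^sub>R (x \<times> y)"
    using orthogonal_frame_expansion[OF assms(2,3) sy] n by simp
  then show ?thesis using assms(3)
    by (simp add: s_def inner_diff_left dot_cross_self inner_commute algebra_simps)
qed

locale free_boundary_patch = minimal_patch +
  assumes x0_bd: "x0 $ 2 = 0"
    and sphere: "\<And>q. q \<in> ball x0 r \<Longrightarrow> q $ 2 = 0 \<Longrightarrow> norm (X q) = 1"
    and in_ball: "\<And>q. q \<in> ball x0 r \<Longrightarrow> q $ 2 \<ge> 0 \<Longrightarrow> norm (X q) \<le> 1"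
    and free_bd: "\<And>q. q \<in> ball x0 r \<Longrightarrow> q $ 2 = 0 \<Longrightarrow> N q \<bullet> X q = 0"
begin

abbreviation "bd \<equiv> ball x0 r \<inter> {q. q $ 2 = 0}"
abbreviation d :: "real^2" where "d \<equiv> axis 1 1"

lemma x0_in: "x0 \<in> bd" using r x0_bd by simp

lemma bd_half: "q \<in> bd \<Longrightarrow> q \<in> half" by auto

lemma derivative_along_bd:
  fixes f :: "real^2 \<Rightarrow> 'b::real_normed_vector"
  assumes f: "\<And>q. q \<in> bd \<Longrightarrow> f q = c" and q: "q \<in> bd" and f': "(f has_derivative f') (at q)"
  shows "f' d = 0"
proof -
  have "((\<lambda>t::real. f (q + t *\<^sub>R d)) has_derivative (\<lambda>t. f' (t *\<^sub>R d))) (at 0)"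
    by (rule has_derivative_compose[where f="\<lambda>t. q + t *\<^sub>R d" and g=f])
       (use f' in \<open>auto intro!: derivative_eq_intros\<close>)
  moreover have "((\<lambda>t::real. f (q + t *\<^sub>R d)) has_derivative (\<lambda>t. 0)) (at 0)"
  proof (rule has_derivative_transform_within_open[where f="\<lambda>_. c"])
    show "open ((\<lambda>t::real. q + t *\<^sub>R d) -` ball x0 r)"
      by (intro open_vimage continuous_intros open_ball)
    show "c = f (q + t *\<^sub>R d)" if "t \<in> (\<lambda>t::real. q + t *\<^sub>R d) -` ball x0 r" for t
      using f[of "q + t *\<^sub>R d"] q that by (simp add: axis_def)
  qed (use q in auto)
  ultimately have "(\<lambda>t::real. f' (t *\<^sub>R d)) = (\<lambda>t. 0)" by (rule has_derivative_unique)
  then show ?thesis using fun_cong[of _ _ 1] by fastforce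
qed

lemma constant_along_bd:
  fixes f :: "real^2 \<Rightarrow> 'b::real_normed_vector"
  assumes f': "\<And>q. q \<in> bd \<Longrightarrow> (f has_derivative f' q) (at q)" and zero: "\<And>q. q \<in> bd \<Longrightarrow> f' q d = 0"
    and q: "q \<in> bd"
  shows "f q = f x0"
proof -
  define I where "I = {t::real. x0 + t *\<^sub>R d \<in> ball x0 r}"
  have I: "I = ball 0 r" by (auto simp: I_def dist_norm)
  have bd: "x0 + t *\<^sub>R d \<in> bd" if "t \<in> I" for t
    using that x0_bd by (auto simp: I_def axis_def)
  have "((\<lambda>t. f (x0 + t *\<^sub>R d)) has_derivative (\<lambda>_. 0)) (at t within I)" if "t \<in> I" for t
  proof -
    have lin: "linear (f' (x0 + t *\<^sub>R d))" using f'[OF bd[OF that]] has_derivative_linear by blast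
    have "((\<lambda>t. f (x0 + t *\<^sub>R d)) has_derivative (\<lambda>h. f' (x0 + t *\<^sub>R d) (h *\<^sub>R d))) (at t)"
      by (rule has_derivative_compose[where f="\<lambda>t. x0 + t *\<^sub>R d" and g=f])
         (use f'[OF bd[OF that]] in \<open>auto intro!: derivative_eq_intros\<close>)
    then show ?thesis using zero[OF bd[OF that]] linear_scale[OF lin] by (simp add: has_derivative_at_withinI)
  qed
  moreover have "convex I" unfolding I by (rule convex_ball)
  ultimately obtain c where c: "\<And>t. t \<in> I \<Longrightarrow> f (x0 + t *\<^sub>R d) = c"
    using has_derivative_zero_constant[of I "\<lambda>t. f (x0 + t *\<^sub>R d)"] by meson
  have qeq: "q = x0 + (q $ 1 - x0 $ 1) *\<^sub>R d"
    using q x0_bd by (simp add: vec_eq_iff forall_2 axis_def)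
  then have "q $ 1 - x0 $ 1 \<in> I" using q unfolding I_def by auto
  moreover have "0 \<in> I" using r by (simp add: I)
  ultimately show ?thesis using c[of "q $ 1 - x0 $ 1"] c[of 0] qeq by simp
qed

text \<open>Along \<open>bd\<close>, the vectors \<open>X\<close>, \<open>N\<close> and
  \<open>\<tau>\<close> are the outward conormal, the normal and a unit tangent of the boundary
  curve; \<open>\<l>\<close> is the signed speed of the coordinate line relative to
  \<open>\<tau>\<close>.\<close>

definition \<tau> where "\<tau> q = N q \<times> X q"
definition \<l> where "\<l> q = X' q d \<bullet> \<tau> q"

lemma frame:
  assumes "q \<in> bd"
  shows "N q \<bullet> N q = 1" "X q \<bullet> X q = 1" "N q \<bullet> X q = 0" "X q \<bullet> N q = 0"
    "\<tau> q \<bullet> \<tau> q = 1" "\<tau> q \<bullet> X q = 0" "\<tau> q \<bullet> N q = 0" "X q \<bullet> \<tau> q = 0" "N q \<bullet> \<tau> q = 0"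
    "\<tau> q \<times> X q = - N q" "N q \<times> \<tau> q = - X q" "\<tau> q \<times> N q = X q"
proof -
  show 1: "N q \<bullet> N q = 1" using unit[of q] assms by (simp add: norm_eq_1)
  show 2: "X q \<bullet> X q = 1" using sphere[of q] assms by (simp add: norm_eq_1)
  show 3: "N q \<bullet> X q = 0" using free_bd[of q] assms by simp
  then show 4: "X q \<bullet> N q = 0" by (simp add: inner_commute)
  show "\<tau> q \<times> X q = - N q" unfolding \<tau>_def
    using cross_cross_unit(1)[of "X q" "N q"] sphere[of q] 3 assms by simp
  show 5: "N q \<times> \<tau> q = - X q" unfolding \<tau>_def using 1 3 by (simp add: Lagrange)
  then show "\<tau> q \<times> N q = X q" using cross_skew[of "\<tau> q" "N q"] by simp
  show "\<tau> q \<bullet> X q = 0" "\<tau> q \<bullet> N q = 0" "X q \<bullet> \<tau> q = 0" "N q \<bullet> \<tau> q = 0"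
    by (simp_all add: \<tau>_def dot_cross_self)
  show "\<tau> q \<bullet> \<tau> q = 1"
    using norm_cross_dot[of "N q" "X q"] 1 2 3 by (simp add: \<tau>_def power2_norm_eq_inner norm_eq_sqrt_inner)
qed

lemma frame_expansion:
  assumes "q \<in> bd"
  shows "v = (v \<bullet> X q) *\<^sub>R X q + (v \<bullet> N q) *\<^sub>R N q + (v \<bullet> \<tau> q) *\<^sub>R \<tau> q"
  using orthonormal_pair_spans[of "N q" "X q" v] frame[OF assms] unit[of q] sphere[of q] assms
  by (simp add: \<tau>_def add.commute)

lemma T_eq: 
  assumes q: "q \<in> bd" shows "X' q d = \<l> q *\<^sub>R \<tau> q" "\<l> q \<noteq> 0"
proof -
  have "((\<lambda>q. X q \<bullet> X q) has_derivative (\<lambda>v. X q \<bullet> X' q v + X' q v \<bullet> X q)) (at q)"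
    using X' q by (intro has_derivative_inner) auto
  from derivative_along_bd[OF _ q this, of 1] have "X' q d \<bullet> X q = 0"
    using frame(2) by (simp add: inner_commute)
  moreover have "X' q d \<bullet> N q = 0" using normal[of q] q by auto
  ultimately show 1: "X' q d = \<l> q *\<^sub>R \<tau> q"
    using frame_expansion[OF q, of "X' q d"] by (simp add: \<l>_def)
  have "d \<noteq> 0" by (simp add: axis_eq_0_iff)
  then show "\<l> q \<noteq> 0" using X'_nonzero[OF bd_half[OF q]] 1 by force
qed

text \<open>\<open>X q\<close> is orthogonal to \<open>N q\<close>, hence the image of some
  \<open>w\<close>. It is orthogonal to the boundary direction, so \<open>w $ 2 \<noteq> 0\<close>.
  If \<open>w\<close> pointed into the half-plane, |X|^2 would grow along it with slope 2 from its
  boundary value 1, and the surface would leave the ball.\<close>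

lemma conormal_exists:
  assumes q: "q \<in> bd"
  obtains w where "w $ 2 < 0" "X' q w = X q"
proof -
  obtain w where w: "X' q w = X q" using tangent_surj[OF bd_half[OF q]] frame(4)[OF q] by blast
  have lin: "linear (X' q)" using linX' q by auto
  have "w $ 2 \<noteq> 0"
  proof
    assume "w $ 2 = 0"
    then have weq: "w = w $ 1 *\<^sub>R d" by (simp add: vec_eq_iff forall_2 axis_def)
    have "X q = X' q (w $ 1 *\<^sub>R d)" unfolding w[symmetric] by (rule arg_cong[OF weq])
    also have "\<dots> = (w $ 1 * \<l> q) *\<^sub>R \<tau> q"
      unfolding linear_scale[OF lin] T_eq(1)[OF q] by simp
    finally have "X q \<bullet> X q = ((w $ 1 * \<l> q) *\<^sub>R \<tau> q) \<bullet> X q" by (rule arg_cong[where f="\<lambda>y. y \<bullet> X q"])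
    then have "X q \<bullet> X q = 0" using frame(6)[OF q] by simp
    then show False using frame(2)[OF q] by simp
  qed
  moreover have "\<not> w $ 2 > 0"
  proof
    assume w2: "w $ 2 > 0"
    define f where "f = (\<lambda>s::real. X (q + s *\<^sub>R w) \<bullet> X (q + s *\<^sub>R w))"
    have X1: "((\<lambda>s. X (q + s *\<^sub>R w)) has_derivative (\<lambda>s. X' q (s *\<^sub>R w))) (at 0)"
      by (rule has_derivative_compose[where f="\<lambda>s. q + s *\<^sub>R w" and g=X])
         (use X'[of q] q in \<open>auto intro!: derivative_eq_intros\<close>)
    have "(f has_derivative (\<lambda>s. X q \<bullet> X' q (s *\<^sub>R w) + X' q (s *\<^sub>R w) \<bullet> X q)) (at 0)"
      unfolding f_def using has_derivative_inner[OF X1 X1] by simp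
    then have "(f has_real_derivative 2) (at 0)"
      unfolding has_field_derivative_def
      by (rule has_derivative_eq_rhs) (use frame(2)[OF q] in \<open>auto simp: linear_scale[OF lin] w\<close>)
    then obtain e where e: "e > 0" "\<And>s. 0 < s \<Longrightarrow> s < e \<Longrightarrow> f 0 < f (0 + s)"
      using DERIV_pos_inc_right[of f 2 0] by auto
    have "open ((\<lambda>t::real. q + t *\<^sub>R w) -` ball x0 r)" by (intro open_vimage continuous_intros open_ball)
    moreover have "0 \<in> (\<lambda>t::real. q + t *\<^sub>R w) -` ball x0 r" using q by simp
    ultimately obtain e' where e': "e' > 0" "ball 0 e' \<subseteq> (\<lambda>t::real. q + t *\<^sub>R w) -` ball x0 r"
      using open_contains_ball by blast
    define s where "s = min e e' / 2"
    have s: "0 < s" "s < e" "s < e'" using e(1) e'(1) by (auto simp: s_def)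
    then have "q + s *\<^sub>R w \<in> ball x0 r" using e'(2) by (auto simp: subset_iff)
    moreover have "(q + s *\<^sub>R w) $ 2 \<ge> 0" using q w2 s by simp
    ultimately have "norm (X (q + s *\<^sub>R w)) \<le> 1" by (rule in_ball)
    then have "f s \<le> 1" unfolding f_def by (simp add: power2_norm_eq_inner[symmetric] power_le_one)
    then show False using e(2)[OF s(1,2)] frame(2)[OF q] by (simp add: f_def)
  qed
  ultimately show ?thesis using that w by force
qed

lemma conormal_unique:
  assumes q: "q \<in> bd" and w: "w $ 2 < 0" "X' q w = X q"
    and w': "w' $ 2 < 0" "norm (X' q w') = 1" "\<And>v. v $ 2 = 0 \<Longrightarrow> X' q w' \<bullet> X' q v = 0"
  shows "w' = w"
proof -
  define c where "c = X' q w' \<bullet> X q"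
  have "X' q w' \<bullet> X' q d = 0" by (rule w'(3)) (simp add: axis_def)
  then have "X' q w' \<bullet> \<tau> q = 0" using T_eq[OF q] by simp
  moreover have "X' q w' \<bullet> N q = 0" using normal[of q] q by auto
  ultimately have 1: "X' q w' = c *\<^sub>R X q" using frame_expansion[OF q, of "X' q w'"] by (simp add: c_def)
  have "norm (X q) = 1" using sphere q by auto
  then have "\<bar>c\<bar> = 1" using w'(2) unfolding 1 by simp
  have "X' q w' = X' q (c *\<^sub>R w)" unfolding 1 using linear_scale[OF linX', of q] q w(2) by simp
  then have "w' = c *\<^sub>R w" using immersed[of q] q by (auto dest: injD)
  moreover from this have "c * w $ 2 < 0" using w'(1) by simp
  ultimately show ?thesis using \<open>\<bar>c\<bar> = 1\<close> w(1) by (auto simp: abs_if split: if_splits)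
qed

lemma conormal_orthogonal:
  assumes q: "q \<in> bd" and "v $ 2 = 0"
  shows "X q \<bullet> X' q v = 0"
proof -
  have "v = v $ 1 *\<^sub>R d" using assms(2) by (simp add: vec_eq_iff forall_2 axis_def)
  then have "X' q v = v $ 1 *\<^sub>R X' q d" using linear_scale[OF linX', of q] q by (metis Int_iff)
  then show ?thesis using T_eq(1)[OF q] frame(8)[OF q] by simp
qed

end

section \<open>Boundary arcs under the Steklov condition\<close>

locale boundary_patch = free_boundary_patch +
  fixes M :: "real^3^3"
  assumes steklov: "\<And>q w. q \<in> ball x0 r \<Longrightarrow> q $ 2 = 0 \<Longrightarrow> w $ 2 < 0 \<Longrightarrow> X' q w = X q \<Longrightarrow> N' q w = M *v N q"
begin

definition \<kappa> where "\<kappa> q = X q \<bullet> (M *v N q)"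

text \<open>Joachimsthal's argument: differentiating N \<bullet> X = 0 along the boundary shows that
  \<open>N' q d\<close> has no conormal component, so the boundary direction and the conormal are
  principal directions. Minimality makes the two principal curvatures opposite, and a single
  \<kappa> describes both derivatives.\<close>

lemma curvature_relation:
  assumes q: "q \<in> bd"
  shows "N' q d = - \<kappa> q *\<^sub>R X' q d" "M *v N q = \<kappa> q *\<^sub>R X q"
proof -
  obtain w where w: "w $ 2 < 0" "X' q w = X q" using conormal_exists[OF q] .
  have MN: "N' q w = M *v N q" using steklov[of q w] q w by auto
  have "((\<lambda>q. N q \<bullet> X q) has_derivative (\<lambda>v. N q \<bullet> X' q v + N' q v \<bullet> X q)) (at q)"
    using X' N' q by (intro has_derivative_inner) auto
  from derivative_along_bd[OF _ q this, of 0] have "N q \<bullet> X' q d + N' q d \<bullet> X q = 0"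
    using frame(3) by simp
  then have NX: "N' q d \<bullet> X q = 0" using T_eq(1)[OF q] frame(9)[OF q] by simp
  have NN: "N' q v \<bullet> N q = 0" for v using normal_derivative_tangent[OF bd_half[OF q]] .
  define m where "m = N' q d \<bullet> \<tau> q"
  have Nd: "N' q d = m *\<^sub>R \<tau> q" using frame_expansion[OF q, of "N' q d"] NX NN[of d] by (simp add: m_def)
  have "X' q d \<bullet> N' q w = X' q w \<bullet> N' q d"
    using second_fundamental_form_sym[OF bd_half[OF q]] .
  then have "\<tau> q \<bullet> N' q w = 0" using T_eq[OF q] NX w by (simp add: inner_commute)
  then have Nw: "N' q w = (N' q w \<bullet> X q) *\<^sub>R X q"
    using frame_expansion[OF q, of "N' q w"] NN[of w] by (simp add: inner_commute)
  then show MNX: "M *v N q = \<kappa> q *\<^sub>R X q" unfolding MN \<kappa>_def by (simp add: inner_commute)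
  have "X' q d \<times> N' q w = X' q w \<times> N' q d" using minimal[of q d w] q by auto
  then have "(\<l> q * \<kappa> q) *\<^sub>R (\<tau> q \<times> X q) = m *\<^sub>R (X q \<times> \<tau> q)"
    unfolding T_eq(1)[OF q] MN MNX w(2) Nd by (simp add: cross_mult_left cross_mult_right mult.commute)
  then have "(\<l> q * \<kappa> q + m) *\<^sub>R N q = 0"
    using frame(10)[OF q] cross_skew[of "X q" "\<tau> q"] by (simp add: scaleR_add_left add_eq_0_iff)
  then have "m = - (\<l> q * \<kappa> q)" using frame(1)[OF q] by auto
  then show "N' q d = - \<kappa> q *\<^sub>R X' q d" using Nd T_eq(1)[OF q] by (simp add: mult.commute)
qed

lemma \<tau>_derivative:
  assumes q: "q \<in> bd"
  shows "(\<tau> has_derivative (\<lambda>v. N q \<times> X' q v + N' q v \<times> X q)) (at q)"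
    "N q \<times> X' q d + N' q d \<times> X q = \<l> q *\<^sub>R (\<kappa> q *\<^sub>R N q - X q)"
proof -
  have bb: "bounded_bilinear (\<times>)" using bilinear_cross by (simp add: bilinear_conv_bounded_bilinear)
  show "(\<tau> has_derivative (\<lambda>v. N q \<times> X' q v + N' q v \<times> X q)) (at q)"
    unfolding \<tau>_def using bounded_bilinear.FDERIV[OF bb N' X'] q by auto
  show "N q \<times> X' q d + N' q d \<times> X q = \<l> q *\<^sub>R (\<kappa> q *\<^sub>R N q - X q)"
    unfolding curvature_relation(1)[OF q] T_eq(1)[OF q] using frame(10,11)[OF q]
    by (simp add: cross_mult_left cross_mult_right scaleR_diff_right)
qed

lemma M_derivative: "(f has_derivative f') (at q) \<Longrightarrow> ((\<lambda>q. M *v f q) has_derivative (\<lambda>v. M *v f' v)) (at q)"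
  using bounded_linear.has_derivative[OF matrix_vector_mul_bounded_linear] .

text \<open>Along \<open>bd\<close>, \<open>M *v N q\<close> has a component along
  \<open>X q\<close> only; differentiating the resulting orthogonality relations gives entries of M
  in the moving frame. The derivative of \<kappa>, about which nothing is known yet, is avoided or
  multiplied by zero.\<close>

lemma M_frame:
  assumes q: "q \<in> bd" and "\<kappa> q \<noteq> 0"
  shows "(M *v \<tau> q) \<bullet> \<tau> q = -1" "(M *v \<tau> q) \<bullet> N q = 0" "(M *v X q) \<bullet> N q = \<kappa> q" "(\<kappa> q)\<^sup>2 = det M"
proof -
  have qB: "q \<in> B" using q by simp
  note MN = curvature_relation(2) and N1 = curvature_relation(1)
  have MNN: "(M *v N q) \<bullet> N q = 0" "(M *v N q) \<bullet> \<tau> q = 0" "(M *v N q) \<bullet> X q = \<kappa> q" if "q \<in> bd" for q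
    using MN[OF that] frame[OF that] by auto
  have MT: "M *v X' q d = \<l> q *\<^sub>R (M *v \<tau> q)" if "q \<in> bd" for q
    unfolding T_eq(1)[OF that] by (simp add: matrix_vector_mult_scaleR)
  have MN': "M *v N' q d = (- \<kappa> q * \<l> q) *\<^sub>R (M *v \<tau> q)" if "q \<in> bd" for q
    unfolding N1[OF that] matrix_vector_mult_scaleR MT[OF that] by simp
  \<comment> \<open>With the factor \<open>\<kappa> q\<close> the relation holds on all of
    \<open>bd\<close>, zeros of \<kappa> included, and can itself be differentiated along
    \<open>bd\<close> for \<open>iii\<close>.\<close>
  have i: "\<kappa> q * ((M *v \<tau> q) \<bullet> N q) = 0" if q: "q \<in> bd" for q
  proof -
    have "((\<lambda>q. (M *v N q) \<bullet> N q) has_derivative (\<lambda>v. (M *v N q) \<bullet> N' q v + (M *v N' q v) \<bullet> N q)) (at q)"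
      using N' q by (intro has_derivative_inner M_derivative) auto
    from derivative_along_bd[OF _ q this, of 0]
    have "(M *v N q) \<bullet> N' q d + (M *v N' q d) \<bullet> N q = 0" using MNN by simp
    then show ?thesis
      unfolding MN'[OF q] unfolding N1[OF q] T_eq(1)[OF q] using MNN[OF q] T_eq(2)[OF q] by simp
  qed
  show ii: "(M *v \<tau> q) \<bullet> \<tau> q = -1"
  proof -
    have "((\<lambda>q. (M *v N q) \<bullet> \<tau> q) has_derivative (\<lambda>v. (M *v N q) \<bullet> (N q \<times> X' q v + N' q v \<times> X q) + (M *v N' q v) \<bullet> \<tau> q)) (at q)"
      using N'[OF qB] \<tau>_derivative(1)[OF q] by (intro has_derivative_inner M_derivative) auto
    from derivative_along_bd[OF _ q this, of 0]
    have "(M *v N q) \<bullet> (N q \<times> X' q d + N' q d \<times> X q) + (M *v N' q d) \<bullet> \<tau> q = 0" using MNN by simp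
    then have "\<l> q * \<kappa> q * (1 + (M *v \<tau> q) \<bullet> \<tau> q) = 0"
      unfolding \<tau>_derivative(2)[OF q] MN'[OF q] using MNN[OF q]
      by (simp add: inner_diff_right algebra_simps)
    then show ?thesis using T_eq(2)[OF q] \<open>\<kappa> q \<noteq> 0\<close> by simp
  qed
  show iN: "(M *v \<tau> q) \<bullet> N q = 0" using i[OF q] \<open>\<kappa> q \<noteq> 0\<close> by simp
  show iii: "(M *v X q) \<bullet> N q = \<kappa> q"
  proof -
    have "(\<kappa> has_derivative (\<lambda>v. X q \<bullet> (M *v N' q v) + X' q v \<bullet> (M *v N q))) (at q)"
      unfolding \<kappa>_def using X'[OF qB] N'[OF qB] by (intro has_derivative_inner M_derivative) auto
    moreover have "((\<lambda>q. (M *v \<tau> q) \<bullet> N q) has_derivative (\<lambda>v. (M *v \<tau> q) \<bullet> N' q v + (M *v (N q \<times> X' q v + N' q v \<times> X q)) \<bullet> N q)) (at q)"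
      using N'[OF qB] \<tau>_derivative(1)[OF q] by (intro has_derivative_inner M_derivative) auto
    ultimately have "((\<lambda>q. \<kappa> q * ((M *v \<tau> q) \<bullet> N q)) has_derivative (\<lambda>v. \<kappa> q * ((M *v \<tau> q) \<bullet> N' q v + (M *v (N q \<times> X' q v + N' q v \<times> X q)) \<bullet> N q) +
        (X q \<bullet> (M *v N' q v) + X' q v \<bullet> (M *v N q)) * ((M *v \<tau> q) \<bullet> N q))) (at q)"
      by (rule has_derivative_mult)
    from derivative_along_bd[OF i q this]
    have "(M *v \<tau> q) \<bullet> N' q d + (M *v (N q \<times> X' q d + N' q d \<times> X q)) \<bullet> N q = 0"
      using iN \<open>\<kappa> q \<noteq> 0\<close> by simp
    then have "\<l> q * (\<kappa> q - (M *v X q) \<bullet> N q) = 0"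
      unfolding \<tau>_derivative(2)[OF q] unfolding N1[OF q] T_eq(1)[OF q] using MNN[OF q] ii
      by (simp add: matrix_vector_mult_scaleR matrix_vector_mult_diff_distrib inner_diff_left algebra_simps)
    then show ?thesis using T_eq(2)[OF q] by simp
  qed
  have "M *v \<tau> q = ((M *v \<tau> q) \<bullet> X q) *\<^sub>R X q - \<tau> q"
    using frame_expansion[OF q, of "M *v \<tau> q"] ii iN by simp
  then have "(M *v \<tau> q) \<times> (M *v N q) = (((M *v \<tau> q) \<bullet> X q) *\<^sub>R X q - \<tau> q) \<times> (\<kappa> q *\<^sub>R X q)"
    using MN[OF q] by metis
  also have "\<dots> = \<kappa> q *\<^sub>R N q"
    using frame(10)[OF q] by (simp add: Cross3.left_diff_distrib cross_mult_left cross_mult_right)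
  \<comment> \<open>The transpose of M maps M a \<times> M b to det M times a \<times> b; here a
    \<times> b = \<tau> \<times> N = X. The product with X then gives \<kappa>^2 = det M.\<close>
  finally have "transpose M *v (\<kappa> q *\<^sub>R N q) = det M *\<^sub>R X q"
    using cross_matrix_mult[of M "\<tau> q" "N q"] frame(12)[OF q] by simp
  then have "X q \<bullet> (transpose M *v (\<kappa> q *\<^sub>R N q)) = det M" using frame(2)[OF q] by simp
  moreover have "X q \<bullet> (transpose M *v (\<kappa> q *\<^sub>R N q)) = (M *v X q) \<bullet> (\<kappa> q *\<^sub>R N q)"
    unfolding transpose_matrix_vector inner_commute[of "X q"] dot_lmul_matrix by (rule inner_commute)
  ultimately show "(\<kappa> q)\<^sup>2 = det M" using iii by (simp add: power2_eq_square)
qed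

text \<open>On a connected arc the continuous function \<kappa> takes at most the values 0, sqrt
  (det M) and - sqrt (det M). In particular no arc changes from \<kappa> \<noteq> 0 to \<kappa> =
  0.\<close>

lemma constant_curvature:
  assumes "\<kappa> x0 \<noteq> 0" and q: "q \<in> bd"
  shows "\<kappa> q = \<kappa> x0"
proof -
  have "continuous_on bd \<kappa>"
    unfolding \<kappa>_def
    by (intro continuous_intros continuous_on_subset[OF contX] bounded_linear.continuous_on[OF matrix_vector_mul_bounded_linear] continuous_on_subset[OF contN]) auto
  moreover have "connected bd"
  proof -
    have "{q::real^2. q $ 2 = 0} = {q. axis 2 1 \<bullet> q = 0}" by (simp add: inner_axis')
    then show ?thesis by (intro convex_connected convex_Int convex_ball) (simp add: convex_hyperplane)
  qed
  moreover have "finite (\<kappa> ` bd)"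
  proof (rule finite_subset)
    show "\<kappa> ` bd \<subseteq> {0, sqrt (det M), - sqrt (det M)}"
    proof
      fix k assume "k \<in> \<kappa> ` bd"
      then obtain p where "p \<in> bd" "k = \<kappa> p" by blast
      then have "k = 0 \<or> k\<^sup>2 = det M" using M_frame(4) by blast
      then show "k \<in> {0, sqrt (det M), - sqrt (det M)}"
        by (metis insertCI minus_minus abs_if real_sqrt_abs)
    qed
  qed simp
  ultimately have "\<kappa> constant_on bd"
    by (intro continuous_finite_range_constant)
  then show ?thesis using q x0_in unfolding constant_on_def by auto
qed

lemma axis_constant:
  assumes "\<kappa> x0 \<noteq> 0" and q: "q \<in> bd"
  shows "N q + \<kappa> x0 *\<^sub>R X q = N x0 + \<kappa> x0 *\<^sub>R X x0"
proof (rule constant_along_bd[where f="\<lambda>q. N q + \<kappa> x0 *\<^sub>R X q" and f'="\<lambda>q v. N' q v + \<kappa> x0 *\<^sub>R X' q v", OF _ _ q])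
  fix q assume q: "q \<in> bd"
  show "((\<lambda>q. N q + \<kappa> x0 *\<^sub>R X q) has_derivative (\<lambda>v. N' q v + \<kappa> x0 *\<^sub>R X' q v)) (at q)"
    using N' X' q by (intro has_derivative_add has_derivative_scaleR_right) auto
  show "N' q d + \<kappa> x0 *\<^sub>R X' q d = 0"
    using curvature_relation(1)[OF q] constant_curvature[OF assms(1) q] by simp
qed

text \<open>The eigenvalue relation \<open>\<kappa> X = M \<nu>\<close> along one curved boundary arc determines \<open>M\<close>, and \<open>M\<close>
  determines the axis of the arc.\<close>

lemma steklov_matrix:
  assumes k: "\<kappa> x0 \<noteq> 0" and n: "n = N x0 + \<kappa> x0 *\<^sub>R X x0"
  shows "M *v v = (v \<bullet> n) *\<^sub>R n - v"
proof -
  define k where "k = \<kappa> x0"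
  note q = x0_in
  have MNk: "M *v N q - k *\<^sub>R X q = 0" if "q \<in> bd" for q
    using curvature_relation(2)[OF that] constant_curvature[OF assms(1) that] by (simp add: k_def)
  have Nk: "N' q d = (- k * \<l> q) *\<^sub>R \<tau> q" if "q \<in> bd" for q
    using curvature_relation(1)[OF that] constant_curvature[OF assms(1) that] T_eq(1)[OF that] by (simp add: k_def)
  \<comment> \<open>The first derivative of M \<nu> = k X along the arc gives M on \<tau>; the
    second, taken below, gives M on k N - X. With M N = k X itself, the matrix is known on the whole
    frame.\<close>
  have Mt: "M *v \<tau> q + \<tau> q = 0" if q: "q \<in> bd" for q
  proof -
    have "((\<lambda>q. M *v N q - k *\<^sub>R X q) has_derivative (\<lambda>v. M *v N' q v - k *\<^sub>R X' q v)) (at q)"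
      using N' X' q by (intro has_derivative_diff has_derivative_scaleR_right M_derivative) auto
    from derivative_along_bd[OF MNk q this] have "M *v N' q d - k *\<^sub>R X' q d = 0" .
    then have "(- k * \<l> q) *\<^sub>R (M *v \<tau> q + \<tau> q) = 0"
      unfolding Nk[OF q] T_eq(1)[OF q] matrix_vector_mult_scaleR by (simp add: algebra_simps)
    then show ?thesis using T_eq(2)[OF q] assms(1) unfolding k_def by (simp only: scaleR_eq_0_iff) simp
  qed
  have "((\<lambda>q. M *v \<tau> q + \<tau> q) has_derivative (\<lambda>v. M *v (N x0 \<times> X' x0 v + N' x0 v \<times> X x0) + (N x0 \<times> X' x0 v + N' x0 v \<times> X x0))) (at x0)"
    using \<tau>_derivative(1)[OF q] by (intro has_derivative_add M_derivative)
  from derivative_along_bd[OF Mt q this]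
  have "\<l> x0 *\<^sub>R (M *v (k *\<^sub>R N x0 - X x0) + (k *\<^sub>R N x0 - X x0)) = 0"
    unfolding \<tau>_derivative(2)[OF q] k_def[symmetric] matrix_vector_mult_scaleR by (simp add: scaleR_add_right)
  then have "M *v (k *\<^sub>R N x0 - X x0) + (k *\<^sub>R N x0 - X x0) = 0" using T_eq(2)[OF q] by simp
  then have MX: "M *v X x0 = k *\<^sub>R (k *\<^sub>R X x0) + k *\<^sub>R N x0 - X x0"
    using MNk[OF q] by (simp add: matrix_vector_mult_diff_distrib matrix_vector_mult_scaleR algebra_simps)
  have Mt0: "M *v \<tau> x0 = - \<tau> x0" using Mt[OF q] by (simp add: add_eq_0_iff2)
  have MN0: "M *v N x0 = k *\<^sub>R X x0" using MNk[OF q] by simp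
  have v: "v = (v \<bullet> X x0) *\<^sub>R X x0 + (v \<bullet> N x0) *\<^sub>R N x0 + (v \<bullet> \<tau> x0) *\<^sub>R \<tau> x0"
    using frame_expansion[OF q] .
  have "M *v v = (v \<bullet> X x0) *\<^sub>R (M *v X x0) + (v \<bullet> N x0) *\<^sub>R (M *v N x0) + (v \<bullet> \<tau> x0) *\<^sub>R (M *v \<tau> x0)"
    using arg_cong[OF v, of "(*v) M"] by (simp only: matrix_vector_right_distrib matrix_vector_mult_scaleR)
  also have "\<dots> + v = (v \<bullet> n) *\<^sub>R n"
    using arg_cong[OF v, of "\<lambda>y. (v \<bullet> X x0) *\<^sub>R (M *v X x0) + (v \<bullet> N x0) *\<^sub>R (M *v N x0) + (v \<bullet> \<tau> x0) *\<^sub>R (M *v \<tau> x0) + y"]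
    unfolding MX Mt0 MN0 n k_def[symmetric]
    by (simp add: inner_add_right algebra_simps)
  finally have "M *v v + v = (v \<bullet> n) *\<^sub>R n" .
  then show ?thesis by (simp add: algebra_simps)
qed

text \<open>Comparing the formula for M at \<open>N x0\<close> with M \<nu> = \<kappa> X gives (N
  \<bullet> n) n = N + \<kappa> X, and the cross product with X makes a multiple of n \<times> X
  equal to \<tau>. This works for any value of \<open>\<kappa> x0\<close>, hence on every boundary
  arc and not just on the one that determined M.\<close>

lemma tangent_of_axis:
  assumes M: "\<And>v. M *v v = (v \<bullet> n) *\<^sub>R n - v"
  shows "\<exists>s. n \<times> X x0 = s *\<^sub>R X' x0 d"
proof -
  note q = x0_in
  have "(N x0 \<bullet> n) *\<^sub>R n = N x0 + \<kappa> x0 *\<^sub>R X x0"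
    using M[of "N x0"] curvature_relation(2)[OF q] by (simp add: algebra_simps)
  then have "(N x0 \<bullet> n) *\<^sub>R (n \<times> X x0) = \<tau> x0"
    unfolding \<tau>_def using cross_mult_left[of "N x0 \<bullet> n" n "X x0"] by (simp add: cross_add_left cross_mult_left)
  moreover have "\<tau> x0 \<noteq> 0" using frame(5)[OF q] by auto
  ultimately have "N x0 \<bullet> n \<noteq> 0" by auto
  then have "n \<times> X x0 = (1 / (N x0 \<bullet> n)) *\<^sub>R ((N x0 \<bullet> n) *\<^sub>R (n \<times> X x0))" by simp
  also have "\<dots> = (1 / (N x0 \<bullet> n)) *\<^sub>R \<tau> x0" unfolding \<open>(N x0 \<bullet> n) *\<^sub>R (n \<times> X x0) = \<tau> x0\<close> ..
  finally have "n \<times> X x0 = (1 / (N x0 \<bullet> n)) *\<^sub>R \<tau> x0" .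
  then have "n \<times> X x0 = (1 / (N x0 \<bullet> n) / \<l> x0) *\<^sub>R X' x0 d"
    using T_eq[OF q] by simp
  then show ?thesis by blast
qed

text \<open>Along the arc the normal is a constant n, and the derivative of \<Psi> n is \<l> times n
  \<bullet> \<tau> + i n \<bullet> X, which vanishes. So \<Psi> n is constant on the arc and, by
  boundary uniqueness, near \<open>x0\<close>; its real part there is N \<bullet> X = 0.\<close>

lemma flat_boundary_height:
  assumes flat: "\<And>q. q \<in> bd \<Longrightarrow> \<kappa> q = 0"
  shows "\<exists>\<rho>>0. \<rho> \<le> r \<and> (\<forall>q\<in>ball x0 \<rho>. q $ 2 \<ge> 0 \<longrightarrow> N x0 \<bullet> X q = 0)"
proof -
  define n where "n = N x0"
  have Nn: "N q = n" if "q \<in> bd" for q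
    unfolding n_def
    by (rule constant_along_bd[where f=N and f'=N', OF N' _ that]) (use curvature_relation(1) flat in auto)
  define e where "e = X' x0 d"
  have d0: "d \<noteq> 0" by (simp add: axis_eq_0_iff)
  have x0h: "x0 \<in> half" using x0_in by (rule bd_half)
  have ne0: "\<Psi>' e x0 d \<noteq> 0"
    using ctan_self_nonzero[OF X'_nonzero[OF x0h d0]] \<Psi>'_ctan[OF x0h] by (simp add: e_def)
  note inj = inj_\<Psi>'[OF x0h ne0]
  obtain U where U: "open U" "x0 \<in> U" "U \<subseteq> B" and ne: "\<And>q. q \<in> U \<Longrightarrow> \<Psi>' e q d \<noteq> 0"
    by (rule conformal_coordinate[OF ne0]) auto
  have bd0: "\<Psi> n q - \<Psi> n x0 = 0" if "q \<in> bd" for q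
  proof -
    have "\<Psi> n q = \<Psi> n x0"
    proof (rule constant_along_bd[where f="\<Psi> n" and f'="\<Psi>' n", OF \<Psi>' _ that])
      fix q assume q: "q \<in> bd"
      show "\<Psi>' n q d = 0"
        unfolding \<Psi>'_ctan[OF bd_half[OF q]] ctan_def T_eq(1)[OF q] using frame(9,4)[OF q] frame(12)[OF q] Nn[OF q]
        by (simp add: cross_mult_left complex_eq_iff inner_commute)
    qed auto
    then show ?thesis by simp
  qed
  have "\<exists>\<rho>>0. \<forall>q\<in>ball x0 \<rho>. q $ 2 \<ge> 0 \<longrightarrow> \<Psi> n q - \<Psi> n x0 = 0"
  proof (rule boundary_uniqueness[where z="\<Psi> e" and D="\<Psi>' e", OF U(1,2) _ _ inj x0_bd])
    show "(\<Psi> e has_derivative \<Psi>' e q) (at q)" if "q \<in> U" for q using that U(3) \<Psi>' by auto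
    show "continuous_on U (\<lambda>q. \<Psi>' e q v)" for v using cont\<Psi>' U(3) by (rule continuous_on_subset)
    show "\<exists>c. ((\<lambda>q. \<Psi> n q - \<Psi> n x0) has_derivative (\<lambda>v. c * \<Psi>' e q v)) (at q)" if "q \<in> U" "q $ 2 \<ge> 0" for q
    proof -
      have "q \<in> half" using that U(3) by auto
      note der = has_derivative_diff[OF coordinate_derivative[OF this ne[OF that(1)], of n] has_derivative_const[of "\<Psi> n x0"], unfolded diff_zero]
      show ?thesis by (rule exI[where x="\<Psi>' n q d / \<Psi>' e q d"], rule der)
    qed
    show "\<Psi> n q - \<Psi> n x0 = 0" if "q \<in> U" "q $ 2 = 0" for q using bd0 that U(3) by auto
  qed
  then obtain \<rho> where \<rho>: "\<rho> > 0" "\<And>q. q \<in> ball x0 \<rho> \<Longrightarrow> q $ 2 \<ge> 0 \<Longrightarrow> \<Psi> n q = \<Psi> n x0" by auto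
  have "n \<bullet> X x0 = 0" using frame(3)[OF x0_in] by (simp add: n_def)
  then have "N x0 \<bullet> X q = 0" if "q \<in> ball x0 \<rho>" "q $ 2 \<ge> 0" for q
    using \<rho>(2)[OF that] by (simp add: \<Psi>_def n_def)
  then show ?thesis using \<rho>(1) r by (intro exI[of _ "min \<rho> r"]) auto
qed

text \<open>Along a curved boundary arc with axis \<open>n\<close> the complexified position \<open>\<Psi>\<close> satisfies a linear
  ordinary differential equation, solved by exponentials of the holomorphic function \<open>\<Psi> n\<close>. By
  boundary uniqueness the solution formula persists in the interior (it is the parametrisation of a
  catenoid), and it exhibits the rotation field of the axis as a tangential field.\<close>

lemma curved_boundary_rotation:
  assumes k0: "\<kappa> x0 \<noteq> 0" and n: "n = N x0 + \<kappa> x0 *\<^sub>R X x0"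
  shows "\<exists>\<rho>>0. \<rho> \<le> r \<and> (\<forall>q\<in>ball x0 \<rho>. q $ 2 \<ge> 0 \<longrightarrow> (n \<times> X q) \<bullet> N q = 0)"
proof -
  define k where "k = \<kappa> x0"
  have k: "k \<noteq> 0" using k0 by (simp add: k_def)
  have n_eq: "n = N q + k *\<^sub>R X q" if "q \<in> bd" for q
    using axis_constant[OF k0 that] by (simp add: n k_def)
  \<comment> \<open>a, b and n / L form an orthonormal basis, in which the map n \<times> acts on
    the plane of a and b as a quarter turn times L.\<close>
  define L where "L = norm n"
  define a where "a = \<tau> x0"
  define b where "b = (1/L) *\<^sub>R (n \<times> a)"
  have nn: "n \<bullet> n = 1 + k\<^sup>2"
    using frame[OF x0_in] by (simp add: n_eq[OF x0_in] inner_add_left inner_add_right power2_eq_square)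
  then have "n \<noteq> 0" using add_pos_nonneg[of 1 "k\<^sup>2"] by fastforce
  then have L: "L > 0" by (simp add: L_def)
  have LL: "L * L = n \<bullet> n" by (simp add: L_def power2_norm_eq_inner[symmetric] power2_eq_square)
  have aa: "a \<bullet> a = 1" "a \<bullet> n = 0"
    using frame[OF x0_in] by (simp_all add: a_def n_eq[OF x0_in] inner_add_right)
  have na: "n \<bullet> a = 0" using aa(2) by (simp add: inner_commute)
  have an: "n \<times> a = L *\<^sub>R b" using L by (simp add: b_def)
  have bn: "b \<times> n = L *\<^sub>R a"
  proof -
    have "n \<times> (n \<times> a) = - (L * L) *\<^sub>R a" unfolding LL using na by (simp add: Lagrange)
    then have "(n \<times> a) \<times> n = (L * L) *\<^sub>R a" using cross_skew[of "n \<times> a" n] by simp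
    then show ?thesis unfolding b_def cross_mult_left using L by simp
  qed
  have ax: "a \<bullet> (n \<times> x) = - L * (b \<bullet> x)" for x
  proof -
    have "a \<bullet> (n \<times> x) = - ((n \<times> a) \<bullet> x)" by (simp add: cross3_simps)
    then show ?thesis by (simp add: an)
  qed
  have bx: "b \<bullet> (n \<times> x) = L * (a \<bullet> x)" for x
  proof -
    have "b \<bullet> (n \<times> x) = (b \<times> n) \<bullet> x" by (simp add: cross3_simps)
    then show ?thesis by (simp add: bn)
  qed
  have abn: "y = 0" if "a \<bullet> y = 0" "b \<bullet> y = 0" "n \<bullet> y = 0" for y
  proof -
    define m where "m = (1/L) *\<^sub>R n"
    have "norm m = 1" using L by (simp add: m_def L_def)
    moreover have "a \<bullet> m = 0" "y \<bullet> m = 0" using aa that by (simp_all add: m_def inner_commute)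
    moreover have "y \<bullet> (a \<times> m) = 0"
      using cross_skew[of a n] that(2) by (simp add: m_def cross_mult_right an inner_commute)
    ultimately show "y = 0"
      using orthogonal_frame_expansion[of m a y] that(1) aa(1) by (simp add: inner_commute)
  qed
  have T: "X' q d = \<l> q *\<^sub>R (n \<times> X q)" "X' q d \<times> N q = \<l> q *\<^sub>R X q" "n \<bullet> X q = k" if q: "q \<in> bd" for q
  proof -
    have "n \<times> X q = \<tau> q" by (simp add: n_eq[OF q] cross_add_left cross_mult_left \<tau>_def)
    then show "X' q d = \<l> q *\<^sub>R (n \<times> X q)" using T_eq(1)[OF q] by simp
    show "X' q d \<times> N q = \<l> q *\<^sub>R X q" unfolding T_eq(1)[OF q] cross_mult_left frame(12)[OF q] ..
    show "n \<bullet> X q = k" using frame[OF q] by (simp add: n_eq[OF q] inner_add_left)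
  qed
  \<comment> \<open>For \<open>c = n\<close> this is i k times \<open>\<l> q\<close>, which is
    nonzero, so \<Psi> n itself serves as complex coordinate.\<close>
  have \<Psi>'d: "\<Psi>' c q d = \<l> q *\<^sub>R Complex (c \<bullet> (n \<times> X q)) (c \<bullet> X q)" if q: "q \<in> bd" for c q
    unfolding \<Psi>'_ctan[OF bd_half[OF q]] ctan_def T(2)[OF q] unfolding T(1)[OF q]
    by (simp add: complex_eq_iff)
  have ne0: "\<Psi>' n x0 d \<noteq> 0"
    using \<Psi>'d[OF x0_in, of n] T(3)[OF x0_in] k T_eq(2)[OF x0_in] by (simp add: complex_eq_iff)
  note inj = inj_\<Psi>'[OF bd_half[OF x0_in] ne0]
  obtain U where U: "open U" "x0 \<in> U" "U \<subseteq> B" "\<And>q. q \<in> U \<Longrightarrow> bij (\<Psi>' n q)"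
    and ne: "\<And>q. q \<in> U \<Longrightarrow> \<Psi>' n q d \<noteq> 0"
    by (rule conformal_coordinate[OF ne0]) auto
  \<comment> \<open>The imaginary constants normalise the free constant of \<open>Y\<close> at
    \<open>x0\<close> so that \<open>PQ\<close> holds along the whole arc. There the derivatives
    along \<open>d\<close> are - L \<l> Q for P and L \<l> P for Q.\<close>
  define P where "P = (\<lambda>q. \<Psi> a q + \<i> * of_real ((b \<bullet> X x0) / L - a \<bullet> Y x0))"
  define Q where "Q = (\<lambda>q. \<Psi> b q + \<i> * of_real (- (a \<bullet> X x0) / L - b \<bullet> Y x0))"
  have Y'd: "Y' q d = \<l> q *\<^sub>R X q" if q: "q \<in> bd" for q
    unfolding Y'_eq[OF bd_half[OF q]] T(2)[OF q] ..
  have PQ: "P q = Complex (a \<bullet> X q) (b \<bullet> X q / L)" "Q q = Complex (b \<bullet> X q) (- (a \<bullet> X q) / L)" if q: "q \<in> bd" for q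
  proof -
    have "a \<bullet> Y q - b \<bullet> X q / L = a \<bullet> Y x0 - b \<bullet> X x0 / L"
    proof (rule constant_along_bd[where f="\<lambda>q. a \<bullet> Y q - b \<bullet> X q / L" and f'="\<lambda>q v. a \<bullet> Y' q v - b \<bullet> X' q v / L", OF _ _ q])
      fix q assume q: "q \<in> bd"
      show "((\<lambda>q. a \<bullet> Y q - b \<bullet> X q / L) has_derivative (\<lambda>v. a \<bullet> Y' q v - b \<bullet> X' q v / L)) (at q)"
        using X' Y' q L by (auto intro!: derivative_eq_intros)
      show "a \<bullet> Y' q d - b \<bullet> X' q d / L = 0" using L by (simp add: Y'd[OF q] T(1)[OF q] bx)
    qed
    then show "P q = Complex (a \<bullet> X q) (b \<bullet> X q / L)" by (simp add: P_def \<Psi>_def complex_eq_iff)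
    have "b \<bullet> Y q + a \<bullet> X q / L = b \<bullet> Y x0 + a \<bullet> X x0 / L"
    proof (rule constant_along_bd[where f="\<lambda>q. b \<bullet> Y q + a \<bullet> X q / L" and f'="\<lambda>q v. b \<bullet> Y' q v + a \<bullet> X' q v / L", OF _ _ q])
      fix q assume q: "q \<in> bd"
      show "((\<lambda>q. b \<bullet> Y q + a \<bullet> X q / L) has_derivative (\<lambda>v. b \<bullet> Y' q v + a \<bullet> X' q v / L)) (at q)"
        using X' Y' q L by (auto intro!: derivative_eq_intros)
      show "b \<bullet> Y' q d + a \<bullet> X' q d / L = 0" using L by (simp add: Y'd[OF q] T(1)[OF q] ax)
    qed
    then show "Q q = Complex (b \<bullet> X q) (- (a \<bullet> X q) / L)" by (simp add: Q_def \<Psi>_def complex_eq_iff)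
  qed
  have P': "(P has_derivative \<Psi>' a q) (at q)" and Q': "(Q has_derivative \<Psi>' b q) (at q)" if "q \<in> B" for q
    unfolding P_def Q_def
    using has_derivative_add[OF \<Psi>'[OF that] has_derivative_const] by simp_all
  \<comment> \<open>Along the arc d(\<Psi> n) = i k \<l>, so for s = 1 and s = -1 the function y = P
    + s i Q satisfies dy = s \<alpha> y d(\<Psi> n) with \<alpha> = L / k. The integrating factor
    makes \<open>E s\<close> constant.\<close>
  define \<alpha> where "\<alpha> = complex_of_real (L / k)"
  define E where "E = (\<lambda>s q. (P q + s * \<i> * Q q) * exp (- (s * \<alpha> * \<Psi> n q)))"
  define E' where "E' = (\<lambda>s q v. (\<Psi>' a q v + s * \<i> * \<Psi>' b q v - s * \<alpha> * \<Psi>' n q v * (P q + s * \<i> * Q q)) * exp (- (s * \<alpha> * \<Psi> n q)))"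
  have E': "(E s has_derivative E' s q) (at q)" if "q \<in> B" for s q
  proof -
    have e: "((\<lambda>q. exp (- (s * \<alpha> * \<Psi> n q))) has_derivative (\<lambda>v. exp (- (s * \<alpha> * \<Psi> n q)) * (- (s * \<alpha> * \<Psi>' n q v)))) (at q)"
      by (rule has_derivative_compose[where f="\<lambda>q. - (s * \<alpha> * \<Psi> n q)" and g=exp])
         (use \<Psi>'[OF that, of n] DERIV_exp in \<open>auto simp: has_field_derivative_def intro!: derivative_eq_intros\<close>)
    have p: "((\<lambda>q. P q + s * \<i> * Q q) has_derivative (\<lambda>v. \<Psi>' a q v + s * \<i> * \<Psi>' b q v)) (at q)"
      using P'[OF that] Q'[OF that] by (intro has_derivative_add has_derivative_mult_right)
    show ?thesis
      unfolding E_def E'_def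
      by (rule has_derivative_eq_rhs[OF has_derivative_mult[OF p e]]) (simp add: fun_eq_iff algebra_simps)
  qed
  have E_bd: "E s q - E s x0 = 0" if s: "s = 1 \<or> s = -1" and q: "q \<in> bd" for s q
  proof -
    have "E s q = E s x0"
    proof (rule constant_along_bd[where f="E s" and f'="E' s", OF E' _ q])
      fix q assume q: "q \<in> bd"
      have "\<Psi>' a q d + s * \<i> * \<Psi>' b q d - s * \<alpha> * \<Psi>' n q d * (P q + s * \<i> * Q q) = 0"
        unfolding \<Psi>'d[OF q] PQ[OF q] using s k L
        by (elim disjE) (simp_all add: complex_eq_iff \<alpha>_def ax bx T(3)[OF q] dot_cross_self field_simps)
      then show "E' s q d = 0" by (simp add: E'_def)
    qed auto
    then show ?thesis by simp
  qed
  have E_lin: "\<exists>c. ((\<lambda>q. E s q - E s x0) has_derivative (\<lambda>v. c * \<Psi>' n q v)) (at q)" if "q \<in> U" "q $ 2 \<ge> 0" for s q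
  proof -
    have q: "q \<in> half" using that U(3) by auto
    let ?C = "(\<Psi>' a q d / \<Psi>' n q d + s * \<i> * (\<Psi>' b q d / \<Psi>' n q d) - s * \<alpha> * (P q + s * \<i> * Q q)) * exp (- (s * \<alpha> * \<Psi> n q))"
    have p: "\<Psi>' c q v = \<Psi>' c q d / \<Psi>' n q d * \<Psi>' n q v" for c v
      using \<Psi>'_proportional[OF q ne[OF that(1)]] .
    have "E' s q v = ?C * \<Psi>' n q v" for v
      unfolding E'_def p[of a v] p[of b v] by (simp add: algebra_simps)
    then have eq: "E' s q = (\<lambda>v. ?C * \<Psi>' n q v)"
      by blast
    have "((\<lambda>q. E s q - E s x0) has_derivative (\<lambda>v. E' s q v - 0)) (at q)"
      by (rule has_derivative_diff[OF E' has_derivative_const]) (use q in auto)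
    then have der: "((\<lambda>q. E s q - E s x0) has_derivative E' s q) (at q)" by (simp only: diff_zero)
    show ?thesis
      by (rule exI[where x="?C"])
        (rule der[unfolded eq])
  qed
  have "\<exists>\<rho>>0. \<forall>q\<in>ball x0 \<rho>. q $ 2 \<ge> 0 \<longrightarrow> E s q - E s x0 = 0" if s: "s = 1 \<or> s = -1" for s
  proof (rule boundary_uniqueness[where z="\<Psi> n" and D="\<Psi>' n", OF U(1,2) _ _ inj x0_bd E_lin])
    show "(\<Psi> n has_derivative \<Psi>' n q) (at q)" if "q \<in> U" for q using that U(3) \<Psi>' by auto
    show "continuous_on U (\<lambda>q. \<Psi>' n q v)" for v using cont\<Psi>' U(3) by (rule continuous_on_subset)
    show "E s q - E s x0 = 0" if "q \<in> U" "q $ 2 = 0" for q using E_bd[OF s] that U(3) by auto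
  qed
  from this[of 1] this[of "-1"] obtain \<rho>1 \<rho>2 where \<rho>12: "\<rho>1 > 0" "\<rho>2 > 0"
    "\<And>q. q \<in> ball x0 \<rho>1 \<Longrightarrow> q $ 2 \<ge> 0 \<Longrightarrow> E 1 q = E 1 x0"
    "\<And>q. q \<in> ball x0 \<rho>2 \<Longrightarrow> q $ 2 \<ge> 0 \<Longrightarrow> E (-1) q = E (-1) x0" by auto
  obtain \<rho>3 where \<rho>3: "\<rho>3 > 0" "ball x0 \<rho>3 \<subseteq> U" using U(1,2) open_contains_ball by blast
  define \<rho> where "\<rho> = min (min \<rho>1 \<rho>2) (min \<rho>3 r)"
  have "(n \<times> X q) \<bullet> N q = 0" if q: "q \<in> ball x0 \<rho>" "q $ 2 \<ge> 0" for q
  proof -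
    have qU: "q \<in> U" and qh: "q \<in> half" using q \<rho>3(2) by (auto simp: \<rho>_def)
    have 0: "E' s q v = 0" if "s = 1 \<or> s = -1" for s v
      using that \<rho>12 q qh by (intro derivative_zero_half_ball[OF _ q E', of s "E s x0"]) (auto simp: \<rho>_def)
    \<comment> \<open>Along this \<open>v\<close> the coordinate \<Psi> n changes as on the arc at
      \<l> = 1. Then \<open>E' s q v = 0\<close> for both signs gives the system for P and Q, whose
      real parts say X' v = n \<times> X.\<close>
    obtain v where v: "\<Psi>' n q v = \<i> * of_real k" using bij_is_surj[OF U(4)[OF qU]] by (metis surjD)
    have \<alpha>v: "\<alpha> * (\<i> * of_real k) = \<i> * of_real L" using k by (simp add: \<alpha>_def)
    have p: "\<Psi>' a q v + \<i> * \<Psi>' b q v = \<i> * of_real L * (P q + \<i> * Q q)"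
      using 0[of 1 v] \<alpha>v by (simp add: E'_def v)
    have m: "\<Psi>' a q v - \<i> * \<Psi>' b q v = - (\<i> * of_real L) * (P q - \<i> * Q q)"
      using 0[of "-1" v] \<alpha>v by (simp add: E'_def v) (simp add: algebra_simps eq_neg_iff_add_eq_0)
    have "2 * \<Psi>' a q v = - 2 * of_real L * Q q"
      using arg_cong2[OF p m, of "(+)"] by (simp add: algebra_simps)
    then have 1: "\<Psi>' a q v = - of_real L * Q q" by simp
    have "2 * \<i> * \<Psi>' b q v = 2 * \<i> * (of_real L * P q)"
      using arg_cong2[OF p m, of "(-)"] by (simp add: algebra_simps)
    then have 2: "\<Psi>' b q v = of_real L * P q" by simp
    have ReQ: "Re (Q q) = b \<bullet> X q" "Re (P q) = a \<bullet> X q" by (simp_all add: P_def Q_def \<Psi>_def)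
    have "X' q v - n \<times> X q = 0"
    proof (rule abn)
      show "a \<bullet> (X' q v - n \<times> X q) = 0"
        using arg_cong[OF 1, of Re] ReQ ax[of "X q"] by (simp add: \<Psi>'_def inner_diff_right)
      show "b \<bullet> (X' q v - n \<times> X q) = 0"
        using arg_cong[OF 2, of Re] ReQ bx[of "X q"] by (simp add: \<Psi>'_def inner_diff_right)
      show "n \<bullet> (X' q v - n \<times> X q) = 0"
        using arg_cong[OF v, of Re] by (simp add: \<Psi>'_def inner_diff_right dot_cross_self)
    qed
    then have "n \<times> X q = X' q v" by simp
    then show ?thesis using normal[of q v] qh by simp
  qed
  moreover have "\<rho> > 0" "\<rho> \<le> r" using \<rho>12 \<rho>3 r by (auto simp: \<rho>_def)
  ultimately show ?thesis by blast
qed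

end

section \<open>From charts to coordinate patches\<close>

lemma chart_inv_simps:
  assumes "is_chart c"
  shows "q \<in> chart_image c \<Longrightarrow> snd c (chart_inv c q) = q" "q \<in> chart_image c \<Longrightarrow> chart_inv c q \<in> fst c"
    "p \<in> fst c \<Longrightarrow> chart_inv c (snd c p) = p" "p \<in> fst c \<Longrightarrow> snd c p \<in> chart_image c"
    "q \<in> chart_image c \<Longrightarrow> q $ 2 \<ge> 0"
proof -
  have "chart_image c \<subseteq> half_plane" using assms openin_imp_subset unfolding is_chart_def by blast
  then show "q \<in> chart_image c \<Longrightarrow> q $ 2 \<ge> 0" by (auto simp: half_plane_def)
qed (use assms in \<open>auto simp: is_chart_def homeomorphism_def\<close>)

lemma chart_image_nbhd:
  assumes "is_chart c" "q \<in> chart_image c"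
  obtains e where "e > 0" "ball q e \<inter> {q. q $ 2 \<ge> 0} \<subseteq> chart_image c"
proof -
  obtain T where T: "open T" "chart_image c = half_plane \<inter> T"
    using assms(1) unfolding is_chart_def openin_open by blast
  then obtain e where "e > 0" "ball q e \<subseteq> T" using assms(2) open_contains_ball by blast
  then show ?thesis using that[of e] T(2) unfolding half_plane_def by auto
qed

text \<open>\<open>chart_deriv\<close> is a derivative within the chart image, which contains a half
  disc around \<open>q\<close>. Derivatives are unique there, so any differentiable extension
  \<open>F\<close> computes it.\<close>

lemma chart_deriv_eq:
  assumes c: "is_chart c" and q: "q \<in> chart_image c" and F: "(F has_derivative F') (at q)"
    and e: "e > 0" and eq: "\<And>y. y \<in> chart_image c \<Longrightarrow> dist y q < e \<Longrightarrow> F y = f (chart_inv c y)"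
  shows "chart_deriv c f (chart_inv c q) = F'"
proof -
  have der: "((f \<circ> chart_inv c) has_derivative F') (at q within chart_image c)"
    by (rule has_derivative_transform_within[OF has_derivative_at_withinI[OF F] e q]) (simp add: eq)
  obtain e' where e': "e' > 0" "ball q e' \<inter> {q. q $ 2 \<ge> 0} \<subseteq> chart_image c"
    using chart_image_nbhd[OF c q] .
  have "frechet_derivative (f \<circ> chart_inv c) (at q within chart_image c) = F'"
    by (rule has_derivative_unique_half_disc[OF _ der e' chart_inv_simps(5)[OF c q]])
       (use der frechet_derivative_works differentiableI in blast)
  then show ?thesis unfolding chart_deriv_def chart_inv_simps(1)[OF c q] by simp
qed

text \<open>Cramer's rule inverts the 2 by 2 metric, and the mean curvature is multiplied by det
  g.\<close>

lemma mean_curvature_trace: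
  assumes H: "mean_curvature c X \<nu> p = 0"
    and D: "(pd c 1 X p \<bullet> pd c 1 X p) * (pd c 2 X p \<bullet> pd c 2 X p) - (pd c 1 X p \<bullet> pd c 2 X p)\<^sup>2 \<noteq> 0"
  shows "(pd c 2 X p \<bullet> pd c 2 X p) * second_ff c X \<nu> p $ 1 $ 1
    - (pd c 1 X p \<bullet> pd c 2 X p) * (second_ff c X \<nu> p $ 1 $ 2 + second_ff c X \<nu> p $ 2 $ 1)
    + (pd c 1 X p \<bullet> pd c 1 X p) * second_ff c X \<nu> p $ 2 $ 2 = 0"
proof -
  define E F G where "E = pd c 1 X p \<bullet> pd c 1 X p" and "F = pd c 1 X p \<bullet> pd c 2 X p" and "G = pd c 2 X p \<bullet> pd c 2 X p"
  define g where "g = metric c X p"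
  have g: "g $ 1 $ 1 = E" "g $ 1 $ 2 = F" "g $ 2 $ 1 = F" "g $ 2 $ 2 = G"
    by (simp_all add: g_def metric_def E_def F_def G_def inner_commute)
  have "det g = E * G - F\<^sup>2" by (simp add: det_2 g power2_eq_square)
  then have "invertible g" using D by (simp add: invertible_det_nz E_def F_def G_def)
  then have "g ** matrix_inv g = mat 1"
    unfolding invertible_def matrix_inv_def by (rule someI2_ex) blast
  then have "(g ** matrix_inv g) $ i $ j = (if i = j then 1 else 0)" for i j by (simp add: mat_def)
  from this[of 1 1] this[of 1 2] this[of 2 1] this[of 2 2]
  have gi: "E * matrix_inv g $ 1 $ 1 + F * matrix_inv g $ 2 $ 1 = 1"
    "E * matrix_inv g $ 1 $ 2 + F * matrix_inv g $ 2 $ 2 = 0"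
    "F * matrix_inv g $ 1 $ 1 + G * matrix_inv g $ 2 $ 1 = 0"
    "F * matrix_inv g $ 1 $ 2 + G * matrix_inv g $ 2 $ 2 = 1"
    by (simp_all add: matrix_matrix_mult_def sum_2 g)
  define h where "h = second_ff c X \<nu> p"
  have "matrix_inv g $ 1 $ 1 * h $ 1 $ 1 + matrix_inv g $ 1 $ 2 * h $ 1 $ 2 + (matrix_inv g $ 2 $ 1 * h $ 2 $ 1 + matrix_inv g $ 2 $ 2 * h $ 2 $ 2) = 0"
    using H unfolding mean_curvature_def metric_inv_def g_def[symmetric] h_def[symmetric] by (simp add: sum_2)
  moreover have "(E * G - F * F) * matrix_inv g $ 1 $ 1 = G" "(E * G - F * F) * matrix_inv g $ 2 $ 1 = - F"
    "(E * G - F * F) * matrix_inv g $ 1 $ 2 = - F" "(E * G - F * F) * matrix_inv g $ 2 $ 2 = E"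
    using gi by algebra+
  ultimately have "G * h $ 1 $ 1 - F * (h $ 1 $ 2 + h $ 2 $ 1) + E * h $ 2 $ 2 = 0"
    by algebra
  then show ?thesis unfolding E_def F_def G_def h_def .
qed

text \<open>By Lagrange's identity the Gram determinant is the squared length of
  \<open>x \<times> y\<close>.\<close>

lemma Gram_nonzero:
  fixes x y :: "real^3"
  assumes "x \<noteq> 0" "\<And>c. y \<noteq> c *\<^sub>R x"
  shows "(x \<bullet> x) * (y \<bullet> y) - (x \<bullet> y)\<^sup>2 \<noteq> 0"
proof
  assume "(x \<bullet> x) * (y \<bullet> y) - (x \<bullet> y)\<^sup>2 = 0"
  then have "(norm (x \<times> y))\<^sup>2 = 0"
    using norm_cross_dot[of x y] by (simp add: power_mult_distrib power2_norm_eq_inner)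
  then have "collinear {0, x, y}" by (simp add: cross_eq_0)
  then show False using assms by (auto simp: collinear_lemma dest: spec[of _ 0])
qed

section \<open>Patches of a free boundary surface and the Steklov matrix\<close>

locale free_boundary_surface =
  fixes A :: "'m::{t2_space, second_countable_topology} chart set" and X \<nu> :: "'m \<Rightarrow> real^3"
  assumes free_boundary_minimal: "free_boundary_minimal_surface A X \<nu>"
begin

lemma charts: "c \<in> A \<Longrightarrow> is_chart c"
  and cover: "\<exists>c\<in>A. p \<in> fst c"
  and connected_surface: "connected (UNIV :: 'm set)"
  and smooth_X: "smooth_fun A X" and smooth_\<nu>: "smooth_fun A \<nu>"
  and immersion: "c \<in> A \<Longrightarrow> p \<in> fst c \<Longrightarrow> inj (chart_deriv c X p)"
  and unit_\<nu>: "norm (\<nu> p) = 1"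
  and normal_\<nu>: "c \<in> A \<Longrightarrow> p \<in> fst c \<Longrightarrow> chart_deriv c X p v \<bullet> \<nu> p = 0"
  and mean_curvature_zero: "c \<in> A \<Longrightarrow> p \<in> fst c \<Longrightarrow> mean_curvature c X \<nu> p = 0"
  and boundary_sphere: "X ` surface_boundary A = range X \<inter> sphere 0 1"
  and boundary_orthogonal: "p \<in> surface_boundary A \<Longrightarrow> \<nu> p \<bullet> X p = 0"
  and proper: "proper_map euclidean (top_of_set (cball 0 1)) X"
  using free_boundary_minimal unfolding free_boundary_minimal_surface_def smooth_surface_def smooth_immersion_def unit_normal_def
  by auto

lemma range_ball: "range X \<subseteq> cball 0 1" and compact_range: "compact (range X)"
proof -
  have "closedin (top_of_set (cball 0 1)) (X ` UNIV)"
    using proper unfolding proper_map_def closed_map_def by (metis closedin_topspace topspace_euclidean)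
  then show "range X \<subseteq> cball 0 1" "compact (range X)"
    by (rule closedin_imp_subset, rule closedin_compact[OF compact_cball])
qed

lemma smooth_extension:
  assumes "smooth_fun A f" "c \<in> A" "x \<in> chart_image c"
  obtains r F where "r > 0" "\<And>k. Ck_on_open k (ball x r) F" "\<And>y. y \<in> chart_image c \<Longrightarrow> y \<in> ball x r \<Longrightarrow> F y = f (chart_inv c y)"
proof -
  obtain W F where W: "open W" "x \<in> W" "\<And>k. Ck_on_open k W F" "\<And>y. y \<in> chart_image c \<inter> W \<Longrightarrow> F y = f (chart_inv c y)"
    using assms unfolding smooth_fun_def smooth_map_on_def by fastforce
  obtain r where r: "r > 0" "ball x r \<subseteq> W" using W(1,2) open_contains_ball by blast
  have mono: "Ck_on_open k W G \<Longrightarrow> Ck_on_open k (ball x r) G" for k and G :: "real^2 \<Rightarrow> 'a"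
    by (induction k arbitrary: G) (use r(2) continuous_on_subset in auto)
  show ?thesis using that[OF r(1), of F] mono W(3,4) r(2) by blast
qed

text \<open>\<open>F\<close> and \<open>G\<close> are smooth extensions of \<open>X\<close> and \<open>\<nu>\<close>, read in the chart, to a full disc; at a boundary
  point their values for \<open>q $ 2 < 0\<close> have no geometric meaning.\<close>

definition is_patch :: "'m chart \<Rightarrow> 'm \<Rightarrow> real \<Rightarrow> (real^2 \<Rightarrow> real^3) \<Rightarrow> (real^2 \<Rightarrow> real^3) \<Rightarrow>
    (real^2 \<Rightarrow> real^2 \<Rightarrow> real^3) \<Rightarrow> (real^2 \<Rightarrow> real^2 \<Rightarrow> real^3) \<Rightarrow> (real^2 \<Rightarrow> real^2 \<Rightarrow> real^2 \<Rightarrow> real^3) \<Rightarrow> bool" where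
  "is_patch c p r F G F' G' F'' \<longleftrightarrow> c \<in> A \<and> p \<in> fst c \<and> minimal_patch (snd c p) r F G F' G' F'' \<and>
     (\<forall>q\<in>ball (snd c p) r \<inter> {q. q $ 2 \<ge> 0}. q \<in> chart_image c \<and> F q = X (chart_inv c q) \<and> G q = \<nu> (chart_inv c q) \<and>
        chart_deriv c X (chart_inv c q) = F' q)"

lemma patch_exists:
  assumes c: "c \<in> A" and p: "p \<in> fst c"
  shows "\<exists>r F G F' G' F''. is_patch c p r F G F' G' F''"
proof -
  define x0 where "x0 = snd c p"
  note ch = charts[OF c] and inv = chart_inv_simps[OF charts[OF c]]
  have x0: "x0 \<in> chart_image c" using inv(4)[OF p] by (simp add: x0_def)
  obtain r1 F where F: "r1 > 0" "\<And>k. Ck_on_open k (ball x0 r1) F" "\<And>y. y \<in> chart_image c \<Longrightarrow> y \<in> ball x0 r1 \<Longrightarrow> F y = X (chart_inv c y)"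
    using smooth_extension[OF smooth_X c x0] by blast
  obtain r2 G where G: "r2 > 0" "\<And>k. Ck_on_open k (ball x0 r2) G" "\<And>y. y \<in> chart_image c \<Longrightarrow> y \<in> ball x0 r2 \<Longrightarrow> G y = \<nu> (chart_inv c y)"
    using smooth_extension[OF smooth_\<nu> c x0] by blast
  obtain e where e: "e > 0" "ball x0 e \<inter> {q. q $ 2 \<ge> 0} \<subseteq> chart_image c" using chart_image_nbhd[OF ch x0] .
  define r where "r = min e (min r1 r2)"
  have r: "r > 0" "ball x0 r \<subseteq> ball x0 r1" "ball x0 r \<subseteq> ball x0 r2" "ball x0 r \<subseteq> ball x0 e"
    using e F(1) G(1) by (auto simp: r_def)
  define F' where "F' = (\<lambda>q. frechet_derivative F (at q))"
  define G' where "G' = (\<lambda>q. frechet_derivative G (at q))"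
  define F'' where "F'' = (\<lambda>q h v. frechet_derivative (\<lambda>q. F' q v) (at q) h)"
  have dF: "(F has_derivative F' q) (at q)" if "q \<in> ball x0 r" for q
    using F(2)[of "Suc 0"] that r(2) unfolding F'_def by (auto simp: frechet_derivative_works[symmetric])
  have dG: "(G has_derivative G' q) (at q)" if "q \<in> ball x0 r" for q
    using G(2)[of "Suc 0"] that r(3) unfolding G'_def by (auto simp: frechet_derivative_works[symmetric])
  have dF': "((\<lambda>q. F' q v) has_derivative (\<lambda>h. F'' q h v)) (at q)" if "q \<in> ball x0 r" for q v
    using F(2)[of "Suc (Suc 0)"] that r(2) unfolding F''_def F'_def by (auto simp: frechet_derivative_works[symmetric])
  have half: "q \<in> chart_image c" "F q = X (chart_inv c q)" "G q = \<nu> (chart_inv c q)"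
    if "q \<in> ball x0 r" "q $ 2 \<ge> 0" for q
  proof -
    show 1: "q \<in> chart_image c" using that e r by auto
    show "F q = X (chart_inv c q)" using F(3)[OF 1] that r by auto
    show "G q = \<nu> (chart_inv c q)" using G(3)[OF 1] that r by auto
  qed
  have near: "\<exists>e>0. \<forall>y\<in>chart_image c. dist y q < e \<longrightarrow> y \<in> ball x0 r \<and> y $ 2 \<ge> 0" if q: "q \<in> ball x0 r" for q
  proof -
    obtain e where e: "e > 0" "ball q e \<subseteq> ball x0 r" using openE[OF open_ball q] by blast
    then show ?thesis using inv(5) by (intro exI[of _ e]) (auto simp: subset_iff dist_commute)
  qed
  have cd: "chart_deriv c X (chart_inv c q) = F' q" if q: "q \<in> ball x0 r" "q $ 2 \<ge> 0" for q
  proof -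
    obtain e where e: "e > 0" "\<forall>y\<in>chart_image c. dist y q < e \<longrightarrow> y \<in> ball x0 r \<and> y $ 2 \<ge> 0" using near[OF q(1)] by blast
    show ?thesis by (rule chart_deriv_eq[OF ch half(1)[OF q] dF[OF q(1)] e(1)]) (use e(2) half(2) in blast)
  qed
  have imm: "immersed_patch x0 r F G F' G' F''"
  proof
    show "x0 $ 2 \<ge> 0" using inv(5)[OF x0] .
    show "continuous_on (ball x0 r) (\<lambda>q. F'' q h v)" for h v
      by (rule continuous_on_subset[OF _ r(2)]) (use F(2)[of "Suc (Suc 0)"] in \<open>simp add: F''_def F'_def\<close>)
    show "continuous_on (ball x0 r) (\<lambda>q. G' q v)" for v
      by (rule continuous_on_subset[OF _ r(3)]) (use G(2)[of "Suc 0"] in \<open>simp add: G'_def\<close>)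
    fix q :: "real^2" assume q: "q \<in> ball x0 r" "q $ 2 \<ge> 0"
    show "norm (G q) = 1" using half(3)[OF q] unit_\<nu> by simp
    show "F' q v \<bullet> G q = 0" for v
      using half(3)[OF q] cd[OF q] normal_\<nu>[OF c inv(2)[OF half(1)[OF q]]] by simp
    show "inj (F' q)" using cd[OF q] immersion[OF c inv(2)[OF half(1)[OF q]]] by simp
  qed (use r dF dG dF' in auto)
  interpret I: immersed_patch x0 r F G F' G' F'' by (rule imm)
  have "minimal_patch x0 r F G F' G' F''"
  proof
    fix q v w assume q: "q \<in> ball x0 r" "q $ 2 \<ge> 0"
    define p' where "p' = chart_inv c q"
    have p': "p' \<in> fst c" using inv(2)[OF half(1)[OF q]] by (simp add: p'_def)
    have pd1: "pd c i X p' = F' q (axis i 1)" for i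
      unfolding pd_def p'_def cd[OF q] ..
    obtain e where e: "e > 0" "\<forall>y\<in>chart_image c. dist y q < e \<longrightarrow> y \<in> ball x0 r \<and> y $ 2 \<ge> 0" using near[OF q(1)] by blast
    have "chart_deriv c (pd c j X) p' = (\<lambda>h. F'' q h (axis j 1))" for j
      unfolding p'_def
      by (rule chart_deriv_eq[OF ch half(1)[OF q] dF'[OF q(1)] e(1)]) (use e(2) cd in \<open>auto simp: pd_def\<close>)
    then have pd2: "second_ff c X \<nu> p' $ i $ j = F'' q (axis i 1) (axis j 1) \<bullet> G q" for i j
      unfolding second_ff_def using half(3)[OF q] by (simp add: pd_def p'_def)
    have qh: "q \<in> I.half" using q by simp
    have ne1: "F' q (axis 1 1) \<noteq> 0" by (rule I.X'_nonzero[OF qh]) (simp add: axis_eq_0_iff)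
    have "(pd c 1 X p' \<bullet> pd c 1 X p') * (pd c 2 X p' \<bullet> pd c 2 X p') - (pd c 1 X p' \<bullet> pd c 2 X p')\<^sup>2 \<noteq> 0"
      unfolding pd1 by (rule Gram_nonzero[OF ne1 I.coordinate_fields_independent[OF qh]])
    from mean_curvature_trace[OF mean_curvature_zero[OF c p'] this]
    show "F' q v \<times> G' q w = F' q w \<times> G' q v"
      unfolding pd1 pd2 using I.X''_sym[OF q(1), of "axis 1 1" "axis 2 1"]
      by (intro I.minimal_of_trace[OF qh]) (simp add: algebra_simps)
  qed
  then have "is_patch c p r F G F' G' F''"
    unfolding is_patch_def using c p half cd by (auto simp: x0_def)
  then show ?thesis by blast
qed

lemma patch_derivative:
  assumes P: "is_patch c p r F G F' G' F''" and q: "q \<in> ball (snd c p) r" "q $ 2 \<ge> 0"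
  shows "chart_deriv c (\<lambda>p. a \<bullet> \<nu> p) (chart_inv c q) = (\<lambda>v. a \<bullet> G' q v)"
proof -
  interpret minimal_patch "snd c p" r F G F' G' F'' using P by (simp add: is_patch_def)
  have ch: "is_chart c" using P charts by (simp add: is_patch_def)
  have qc: "q \<in> chart_image c" using P q by (auto simp: is_patch_def)
  obtain e where e: "e > 0" "ball q e \<subseteq> ball (snd c p) r" using openE[OF open_ball q(1)] by blast
  have "((\<lambda>q. a \<bullet> G q) has_derivative (\<lambda>v. a \<bullet> G' q v)) (at q)"
    using N'[OF q(1)] by (rule has_derivative_inner_right)
  then show ?thesis
  proof (rule chart_deriv_eq[OF ch qc _ e(1)])
    fix y assume "y \<in> chart_image c" "dist y q < e"
    then have "y \<in> ball (snd c p) r \<inter> {q. q $ 2 \<ge> 0}"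
      using e(2) chart_inv_simps(5)[OF ch] by (auto simp: dist_commute subset_iff)
    then show "a \<bullet> G y = a \<bullet> \<nu> (chart_inv c y)" using P unfolding is_patch_def by auto
  qed
qed

lemma boundary_point:
  assumes "p \<in> surface_boundary A"
  shows "norm (X p) = 1" "\<nu> p \<bullet> X p = 0"
  using assms boundary_sphere boundary_orthogonal[OF assms] by auto

lemma patch_free_boundary:
  assumes P: "is_patch c p r F G F' G' F''" and "snd c p $ 2 = 0"
  shows "free_boundary_patch (snd c p) r F G F' G' F''"
proof -
  interpret minimal_patch "snd c p" r F G F' G' F'' using P by (simp add: is_patch_def)
  have c: "c \<in> A" and ch: "is_chart c" using P charts by (auto simp: is_patch_def)
  have eq: "F q = X (chart_inv c q)" "G q = \<nu> (chart_inv c q)" "q \<in> chart_image c" if "q \<in> half" for q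
    using P that unfolding is_patch_def by auto
  have bdp: "chart_inv c q \<in> surface_boundary A" if "q \<in> half" "q $ 2 = 0" for q
    using chart_inv_simps(1,2)[OF ch eq(3)[OF that(1)]] c that(2) unfolding surface_boundary_def by auto
  show ?thesis
  proof
    show "norm (F q) = 1" "G q \<bullet> F q = 0" if "q \<in> ball (snd c p) r" "q $ 2 = 0" for q
      using boundary_point[OF bdp] eq that by auto
    show "norm (F q) \<le> 1" if "q \<in> ball (snd c p) r" "q $ 2 \<ge> 0" for q
    proof -
      have "X (chart_inv c q) \<in> cball 0 1" using range_ball by blast
      then show ?thesis using eq(1)[of q] that by auto
    qed
  qed (rule assms(2))
qed

text \<open>Along the boundary the outward conormal is the position vector, so by
  \<open>conormal_unique\<close> the definite description of its coordinates selects
  \<open>w\<close>.\<close>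

lemma conormal_deriv_eq:
  assumes P: "is_patch c p r F G F' G' F''" and "snd c p $ 2 = 0"
    and q: "q \<in> ball (snd c p) r" "q $ 2 = 0" and w: "w $ 2 < 0" "F' q w = F q"
  shows "conormal_deriv c X (\<lambda>p. a \<bullet> \<nu> p) (chart_inv c q) = a \<bullet> G' q w"
proof -
  interpret free_boundary_patch "snd c p" r F G F' G' F'' using patch_free_boundary[OF assms(1,2)] .
  have cd: "chart_deriv c X (chart_inv c q) = F' q" using P q unfolding is_patch_def by auto
  have "conormal_coords c X (chart_inv c q) = w"
    unfolding conormal_coords_def cd
  proof (rule the_equality)
    have "norm (F q) = 1" using sphere[of q] q by auto
    then show "w $ 2 < 0 \<and> norm (F' q w) = 1 \<and> (\<forall>v. v $ 2 = 0 \<longrightarrow> F' q w \<bullet> F' q v = 0)"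
      using w conormal_orthogonal[of q] q by auto
    show "w' = w" if "w' $ 2 < 0 \<and> norm (F' q w') = 1 \<and> (\<forall>v. v $ 2 = 0 \<longrightarrow> F' q w' \<bullet> F' q v = 0)" for w'
      using that q w by (intro conormal_unique) auto
  qed
  then show ?thesis using patch_derivative[OF P, of q a] q by (simp add: conormal_deriv_def)
qed

lemma normal_component_span_eq: "u \<in> normal_component_span \<nu> \<Longrightarrow> \<exists>a. u = (\<lambda>p. a \<bullet> \<nu> p)"
  unfolding normal_component_span_def
proof (induction rule: fun_space.span_induct_alt)
  case base
  then show ?case by (intro exI[of _ 0]) (simp add: fun_eq_iff)
next
  case (step k x y)
  then obtain a i where "y = (\<lambda>p. a \<bullet> \<nu> p)" "x = (\<lambda>p. \<nu> p $ i)" by blast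
  then show ?case
    by (intro exI[of _ "k *\<^sub>R axis i 1 + a"])
       (simp add: fun_scale_def fun_eq_iff inner_add_left inner_axis')
qed

text \<open>\<open>L\<close> stands for the conormal derivative of \<nu> at \<open>p\<close>. Each
  basis eigenfunction is \<open>a u \<bullet> \<nu>\<close>, and each component of \<nu> is a finite
  combination of basis functions with coefficients k; so row i of M is the sum of the vectors k
  \<mu> a.\<close>

lemma steklov_matrix_exists:
  assumes "eigen_subspace A X \<nu> (normal_component_span \<nu>)"
  obtains M where "\<And>c p L. c \<in> A \<Longrightarrow> p \<in> fst c \<Longrightarrow> p \<in> surface_boundary A \<Longrightarrow>
     (\<And>a. conormal_deriv c X (\<lambda>p. a \<bullet> \<nu> p) p = a \<bullet> L) \<Longrightarrow> L = M *v \<nu> p"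
proof -
  obtain B where B: "fun_space.span B = normal_component_span \<nu>"
    and eig: "\<And>u. u \<in> B \<Longrightarrow> \<exists>\<mu>. jacobi_steklov_eigenfunction A X \<nu> \<mu> u"
    using assms unfolding eigen_subspace_def by blast
  define a where "a = (\<lambda>u. SOME a. u = (\<lambda>p. a \<bullet> \<nu> p))"
  define \<mu> where "\<mu> = (\<lambda>u. SOME \<mu>. jacobi_steklov_eigenfunction A X \<nu> \<mu> u)"
  have a: "u = (\<lambda>p. a u \<bullet> \<nu> p)" if "u \<in> B" for u
    unfolding a_def
    by (rule someI_ex, rule normal_component_span_eq) (use that B fun_space.span_base in blast)
  have \<mu>: "jacobi_steklov_eigenfunction A X \<nu> (\<mu> u) u" if "u \<in> B" for u
    unfolding \<mu>_def by (rule someI_ex) (rule eig[OF that])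
  have "\<exists>t r. finite t \<and> t \<subseteq> B \<and> (\<lambda>p. \<nu> p $ i) = (\<Sum>u\<in>t. fun_scale (r u) u)" for i
  proof -
    have "(\<lambda>p. \<nu> p $ i) \<in> fun_space.span B"
      unfolding B normal_component_span_def by (rule fun_space.span_base) auto
    then show ?thesis unfolding fun_space.span_explicit by blast
  qed
  then have "\<forall>i. \<exists>x. finite (fst x) \<and> fst x \<subseteq> B \<and> (\<lambda>p. \<nu> p $ i) = (\<Sum>u\<in>fst x. fun_scale (snd x u) u)"
    by simp
  from choice[OF this] obtain x where x: "\<forall>i. finite (fst (x i)) \<and> fst (x i) \<subseteq> B \<and>
      (\<lambda>p. \<nu> p $ i) = (\<Sum>u\<in>fst (x i). fun_scale (snd (x i) u) u)" by blast
  define t where "t = (\<lambda>i. fst (x i))"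
  define k where "k = (\<lambda>i. snd (x i))"
  have t: "t i \<subseteq> B" "(\<lambda>p. \<nu> p $ i) = (\<Sum>u\<in>t i. fun_scale (k i u) u)" for i
    using x by (auto simp: t_def k_def)
  have sum_ap: "(\<Sum>u\<in>T. f u) p = (\<Sum>u\<in>T. f u p)" for f :: "('m \<Rightarrow> real) \<Rightarrow> 'm \<Rightarrow> real" and T p
    by (induction T rule: infinite_finite_induct) auto
  define M :: "real^3^3" where "M = (\<chi> i. \<Sum>u\<in>t i. (k i u * \<mu> u) *\<^sub>R a u)"
  show ?thesis
  proof (rule that[of M])
    fix c p L assume c: "c \<in> A" "p \<in> fst c" "p \<in> surface_boundary A"
      and L: "\<And>a. conormal_deriv c X (\<lambda>p. a \<bullet> \<nu> p) p = a \<bullet> L"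
    show "L = M *v \<nu> p"
    proof (rule vec_eq_iff[THEN iffD2], rule allI)
      fix i
      \<comment> \<open>If the components of \<nu> are linearly dependent, \<open>b\<close> need not
        vanish; but b \<bullet> \<nu> is the zero function, so its conormal derivative
        \<open>b \<bullet> L\<close> is zero.\<close>
      define b where "b = axis i 1 - (\<Sum>u\<in>t i. k i u *\<^sub>R a u)"
      have "b \<bullet> \<nu> p = 0" for p
      proof -
        have "\<nu> p $ i = (\<Sum>u\<in>t i. k i u * u p)"
          using fun_cong[OF t(2), of p i] by (simp add: fun_scale_def sum_ap)
        also have "\<dots> = (\<Sum>u\<in>t i. k i u * (a u \<bullet> \<nu> p))"
        proof (intro sum.cong refl)
          fix u assume "u \<in> t i"
          then have "u p = a u \<bullet> \<nu> p" using fun_cong[OF a, of u p] t(1) by blast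
          then show "k i u * u p = k i u * (a u \<bullet> \<nu> p)" by simp
        qed
        finally show ?thesis by (simp add: b_def inner_diff_left inner_sum_left inner_axis')
      qed
      then have "b \<bullet> L = 0" using L[of b] L[of 0] by simp
      then have "L $ i = (\<Sum>u\<in>t i. k i u * (a u \<bullet> L))"
        by (simp add: b_def inner_diff_left inner_sum_left inner_axis')
      also have "\<dots> = (\<Sum>u\<in>t i. k i u * (\<mu> u * (a u \<bullet> \<nu> p)))"
      proof (intro sum.cong refl arg_cong[where f="\<lambda>x. _ * x"])
        fix u assume "u \<in> t i"
        then have u: "u \<in> B" using t(1) by blast
        have "conormal_deriv c X u p = \<mu> u * u p"
          using \<mu>[OF u] c unfolding jacobi_steklov_eigenfunction_def by blast
        moreover have "conormal_deriv c X u p = a u \<bullet> L" using L[of "a u"] unfolding a[OF u, symmetric] .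
        ultimately show "a u \<bullet> L = \<mu> u * (a u \<bullet> \<nu> p)" using fun_cong[OF a[OF u], of p] by simp
      qed
      also have "\<dots> = (M *v \<nu> p) $ i"
        by (simp add: M_def matrix_vector_mul_component inner_sum_left mult.assoc)
      finally show "L $ i = (M *v \<nu> p) $ i" .
    qed
  qed
qed

end

section \<open>Invariance under rotations\<close>

text \<open>The largest s in \<open>{0..t}\<close> with f s \<le> f 0 + e s exists by compactness
  and could be increased if it were less than \<open>t\<close>.\<close>

lemma dini_nonincreasing:
  fixes f :: "real \<Rightarrow> real"
  assumes cont: "continuous_on UNIV f"
    and dini: "\<And>t e. e > 0 \<Longrightarrow> \<exists>\<delta>>0. \<forall>h. 0 < h \<and> h < \<delta> \<longrightarrow> f (t + h) \<le> f t + e * h"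
    and "t \<ge> 0"
  shows "f t \<le> f 0"
proof (rule field_le_epsilon)
  fix e0 :: real assume "e0 > 0"
  define e where "e = e0 / (t + 1)"
  have e: "e > 0" using \<open>e0 > 0\<close> \<open>t \<ge> 0\<close> by (simp add: e_def)
  define S where "S = {s \<in> {0..t}. f s \<le> f 0 + e * s}"
  have "closed S"
  proof -
    have "S = {0..t} \<inter> {s. f s \<le> f 0 + e * s}" by (auto simp: S_def)
    then show ?thesis by (auto intro!: closed_Int closed_Collect_le continuous_intros cont)
  qed
  moreover have "bounded S" by (rule bounded_subset[of "{0..t}"]) (auto simp: S_def)
  ultimately have "compact S" by (simp add: compact_eq_bounded_closed)
  moreover have "0 \<in> S" using \<open>t \<ge> 0\<close> by (simp add: S_def)
  ultimately obtain s where s: "s \<in> S" "\<And>u. u \<in> S \<Longrightarrow> u \<le> s"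
    using compact_attains_sup[of S] by blast
  have "s = t"
  proof (rule ccontr)
    assume "s \<noteq> t"
    then have "s < t" using s(1) by (simp add: S_def)
    obtain \<delta> where \<delta>: "\<delta> > 0" "\<And>h. 0 < h \<Longrightarrow> h < \<delta> \<Longrightarrow> f (s + h) \<le> f s + e * h"
      using dini[OF e] by blast
    define h where "h = min \<delta> (t - s) / 2"
    have "h \<le> (t - s) / 2" by (simp add: h_def)
    then have "s + h \<le> t" using \<open>s < t\<close> by argo
    moreover have "0 < h" "h < \<delta>" using \<delta>(1) \<open>s < t\<close> by (auto simp: h_def)
    ultimately have h: "0 < h" "h < \<delta>" "s + h \<le> t" by auto
    then have "s + h \<in> S" using \<delta>(2)[OF h(1,2)] s(1) by (auto simp: S_def algebra_simps)
    then show False using s(2) h(1) by force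
  qed
  then have "f t \<le> f 0 + e * t" using s(1) by (simp add: S_def)
  also have "e * t \<le> e0" using \<open>e0 > 0\<close> \<open>t \<ge> 0\<close> by (simp add: e_def field_simps)
  finally show "f t \<le> f 0 + e0" by simp
qed

text \<open>If \<open>q\<close> is a point of \<open>S\<close> nearest to \<open>y t\<close>, moving both along the flow of the skew field
  \<open>n \<times> x\<close> keeps their squared distance constant to first order, as \<open>w \<bullet> (n \<times> w) = 0\<close>. So the
  distance from \<open>y\<close> to \<open>S\<close> does not increase.\<close>

lemma skew_flow_invariant:
  fixes S :: "(real^3) set" and y :: "real \<Rightarrow> real^3"
  assumes S: "compact S"
    and tangent: "\<And>q. q \<in> S \<Longrightarrow> \<exists>c \<delta>. c 0 = q \<and> (c has_vector_derivative (n \<times> q)) (at 0) \<and>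
       \<delta> > 0 \<and> (\<forall>s. 0 < s \<and> s < \<delta> \<longrightarrow> c s \<in> S)"
    and y: "\<And>t. (y has_vector_derivative (n \<times> y t)) (at t)" and y0: "y 0 \<in> S" and t: "t \<ge> 0"
  shows "y t \<in> S"
proof -
  have ne: "S \<noteq> {}" and closed: "closed S" using y0 S compact_imp_closed by auto
  define f where "f = (\<lambda>t. (infdist (y t) S)\<^sup>2)"
  have "continuous_on UNIV y"
    using y has_vector_derivative_continuous continuous_at_imp_continuous_on by blast
  then have "continuous_on UNIV f"
    unfolding f_def by (intro continuous_intros)
  moreover have "\<exists>\<delta>>0. \<forall>h. 0 < h \<and> h < \<delta> \<longrightarrow> f (t + h) \<le> f t + e * h" if "e > 0" for t e
  proof -
    obtain q where q: "q \<in> S" "infdist (y t) S = dist (y t) q"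
      using infdist_attains_inf[OF closed ne, of "y t"] by blast
    obtain c \<delta> where c: "c 0 = q" "(c has_vector_derivative (n \<times> q)) (at 0)"
      and \<delta>: "\<delta> > 0" "\<And>s. 0 < s \<Longrightarrow> s < \<delta> \<Longrightarrow> c s \<in> S" using tangent[OF q(1)] by blast
    define w where "w = (\<lambda>h. y (t + h) - c h)"
    define g where "g = (\<lambda>h. w h \<bullet> w h)"
    have "((\<lambda>h. t + h) has_vector_derivative 1) (at 0)" by (auto intro!: derivative_eq_intros)
    then have "((\<lambda>h. y (t + h)) has_vector_derivative (n \<times> y t)) (at 0)"
      using vector_diff_chain_at[of "\<lambda>h. t + h" 1 0 y "n \<times> y t"] y[of t]
      by (simp add: o_def)
    then have "(w has_vector_derivative (n \<times> w 0)) (at 0)"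
      unfolding w_def using has_vector_derivative_diff[OF _ c(2)] c(1) by (simp add: Cross3.right_diff_distrib)
    then have w: "(w has_derivative (\<lambda>h. h *\<^sub>R (n \<times> w 0))) (at 0)" by (simp add: has_vector_derivative_def)
    have "(g has_derivative (\<lambda>h. 0)) (at 0)"
      unfolding g_def
      by (rule has_derivative_eq_rhs[OF has_derivative_inner[OF w w]]) (simp add: fun_eq_iff dot_cross_self)
    then obtain d where d: "d > 0" "\<And>h. norm h < d \<Longrightarrow> norm (g h - g 0) \<le> e * norm h"
      using \<open>e > 0\<close> unfolding has_derivative_at_alt by (metis diff_zero)
    have "f (t + h) \<le> f t + e * h" if h: "0 < h" "h < min d \<delta>" for h
    proof -
      have "infdist (y (t + h)) S \<le> dist (y (t + h)) (c h)" using \<delta>(2)[of h] h by (intro infdist_le) auto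
      then have "f (t + h) \<le> (dist (y (t + h)) (c h))\<^sup>2"
        unfolding f_def by (intro power_mono infdist_nonneg)
      also have "\<dots> = g h" by (simp add: g_def w_def dist_norm power2_norm_eq_inner)
      also have "\<dots> \<le> g 0 + e * h" using d(2)[of h] h by auto
      also have "g 0 = f t" using q(2) c(1) by (simp add: f_def g_def w_def dist_norm power2_norm_eq_inner)
      finally show ?thesis .
    qed
    then show ?thesis using d(1) \<delta>(1) by (intro exI[of _ "min d \<delta>"]) auto
  qed
  ultimately have "f t \<le> f 0" using t by (rule dini_nonincreasing)
  moreover have "f 0 = 0" using y0 by (simp add: f_def)
  ultimately have "infdist (y t) S = 0" by (simp add: f_def)
  then show ?thesis using in_closed_iff_infdist_zero[OF closed ne] by blast
qed

text \<open>Rodrigues' formula. The parts of \<open>x\<close> and \<open>Q *v x\<close> orthogonal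
  to \<open>n\<close> have equal length, so they differ by an angle, which may depend on
  \<open>x\<close>. It is taken nonnegative because flow invariance is proved forward in
  time.\<close>

lemma rotation_about_axis_orbit:
  fixes Q :: "real^3^3" and n x :: "real^3"
  assumes Q: "orthogonal_matrix Q" "Q *v n = n" and n: "norm n = 1"
  obtains y \<theta> where "\<And>t. (y has_vector_derivative (n \<times> y t)) (at t)" "y 0 = x" "\<theta> \<ge> 0" "y \<theta> = Q *v x"
proof -
  have nn: "n \<bullet> n = 1" using n by (simp add: norm_eq_1)
  define p where "p = x - (x \<bullet> n) *\<^sub>R n"
  define s where "s = Q *v x - (x \<bullet> n) *\<^sub>R n"
  have inner: "(Q *v a) \<bullet> (Q *v b) = a \<bullet> b" for a b
    using orthogonal_transformation_matrix[of "(*v) Q"] Q(1) by (simp add: orthogonal_transformation_def)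
  have pn: "p \<bullet> n = 0" using nn by (simp add: p_def inner_diff_left)
  have sn: "s \<bullet> n = 0" using inner[of x n] nn by (simp add: s_def inner_diff_left Q(2))
  have ss: "s \<bullet> s = p \<bullet> p"
    using inner[of x x] inner[of x n] nn
    by (simp add: s_def p_def inner_diff_left inner_diff_right Q(2) inner_commute)
  have nx: "n \<times> x = - (p \<times> n)"
    using cross_skew[of n x] by (simp add: p_def Cross3.left_diff_distrib cross_mult_left)
  define y where "y = (\<lambda>t. (x \<bullet> n) *\<^sub>R n + cos t *\<^sub>R p + sin t *\<^sub>R (n \<times> x))"
  have ny: "n \<times> y t = cos t *\<^sub>R (n \<times> x) - sin t *\<^sub>R p" for t
  proof -
    have "n \<times> p = n \<times> x" by (simp add: p_def Cross3.right_diff_distrib cross_mult_right)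
    moreover have "n \<times> (n \<times> x) = - p" using cross_cross_unit(2)[OF n pn] by (simp add: nx)
    ultimately show ?thesis by (simp add: y_def cross_add_right cross_mult_right)
  qed
  have y': "(y has_vector_derivative (n \<times> y t)) (at t)" for t
    unfolding ny unfolding y_def by (auto intro!: derivative_eq_intros)
  have "\<exists>\<theta>\<ge>0. y \<theta> = Q *v x"
  proof (cases "p = 0")
    case True
    then have "s = 0" using ss by simp
    then have "y 0 = Q *v x" using True by (simp add: y_def s_def p_def)
    then show ?thesis by blast
  next
    case False
    define a where "a = (s \<bullet> p) / (p \<bullet> p)"
    define b where "b = - (s \<bullet> (p \<times> n)) / (p \<bullet> p)"
    have pp: "p \<bullet> p \<noteq> 0" using False by simp
    have "(p \<bullet> p) *\<^sub>R s = (p \<bullet> p) *\<^sub>R (a *\<^sub>R p + b *\<^sub>R (n \<times> x))"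
      unfolding orthogonal_frame_expansion[OF n pn sn] nx a_def b_def using pp by (simp add: scaleR_add_right)
    then have s_eq: "s = a *\<^sub>R p + b *\<^sub>R (n \<times> x)" using pp by simp
    have pnx: "p \<bullet> (n \<times> x) = 0" by (simp add: nx dot_cross_self)
    have "(n \<times> x) \<bullet> (n \<times> x) = p \<bullet> p"
      unfolding nx using norm_cross_dot[of p n] pn n by (simp add: power2_norm_eq_inner)
    then have "s \<bullet> s = (a\<^sup>2 + b\<^sup>2) * (p \<bullet> p)"
      unfolding s_eq using pnx by (simp add: inner_add_left inner_add_right inner_commute power2_eq_square algebra_simps)
    then have "a\<^sup>2 + b\<^sup>2 = 1" using ss pp by simp
    then obtain \<theta> where "0 \<le> \<theta>" "a = cos \<theta>" "b = sin \<theta>" using sincos_total_2pi by metis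
    moreover from this have "y \<theta> = Q *v x" using s_eq by (simp add: y_def s_def algebra_simps)
    ultimately show ?thesis by blast
  qed
  moreover have "y 0 = x" by (simp add: y_def p_def)
  ultimately show ?thesis using that y' by blast
qed

lemma rotationally_symmetric_of_tangent_rotation:
  assumes S: "compact S" and n: "norm n = 1"
    and tangent: "\<And>q. q \<in> S \<Longrightarrow> \<exists>c \<delta>. c 0 = q \<and> (c has_vector_derivative (n \<times> q)) (at 0) \<and>
       \<delta> > 0 \<and> (\<forall>s. 0 < s \<and> s < \<delta> \<longrightarrow> c s \<in> S)"
  shows "rotationally_symmetric S"
  unfolding rotationally_symmetric_def
proof (intro exI[of _ n] conjI allI impI)
  show "n \<noteq> 0" using n by auto
  have sub: "Q *v x \<in> S" if Q: "orthogonal_matrix Q" "Q *v n = n" and x: "x \<in> S" for Q x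
  proof -
    obtain y \<theta> where y: "\<And>t. (y has_vector_derivative (n \<times> y t)) (at t)" "y 0 = x" "\<theta> \<ge> 0" "y \<theta> = Q *v x"
      using rotation_about_axis_orbit[OF Q n] by metis
    then show ?thesis using skew_flow_invariant[OF S tangent y(1) _ y(3)] x by simp
  qed
  fix Q assume Q: "rotation_matrix Q \<and> Q *v n = n"
  then have orth: "orthogonal_matrix Q" by (simp add: rotation_matrix_def)
  then have QQ: "Q ** transpose Q = mat 1" "transpose Q ** Q = mat 1" by (simp_all add: orthogonal_matrix_def)
  have tn: "transpose Q *v n = n"
  proof -
    have "transpose Q *v n = transpose Q *v (Q *v n)" using Q by simp
    also have "\<dots> = (transpose Q ** Q) *v n" by (rule matrix_vector_mul_assoc)
    finally show ?thesis unfolding QQ(2) by simp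
  qed
  have ot: "orthogonal_matrix (transpose Q)" using orth by (simp add: orthogonal_matrix_transpose)
  show "(\<lambda>x. Q *v x) ` S = S"
  proof
    show "(\<lambda>x. Q *v x) ` S \<subseteq> S" using sub[OF orth] Q by auto
    show "S \<subseteq> (\<lambda>x. Q *v x) ` S"
    proof
      fix x assume "x \<in> S"
      then have "transpose Q *v x \<in> S" using sub[OF ot tn] by blast
      moreover have "Q *v (transpose Q *v x) = x" unfolding matrix_vector_mul_assoc QQ(1) by simp
      ultimately show "x \<in> (\<lambda>x. Q *v x) ` S" by (metis imageI)
    qed
  qed
qed

section \<open>Propagation over the surface\<close>

text \<open>The union of all open sets on which \<open>Z\<close> holds is also closed, because a
  \<open>V\<close> that meets it lies in it.\<close>

lemma connected_propagation:
  fixes Z :: "'m::topological_space \<Rightarrow> bool"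
  assumes conn: "connected (UNIV :: 'm set)"
    and local: "\<And>p. \<exists>V. open V \<and> p \<in> V \<and>
      (\<forall>T. open T \<longrightarrow> T \<subseteq> V \<longrightarrow> T \<noteq> {} \<longrightarrow> (\<forall>x\<in>T. Z x) \<longrightarrow> (\<forall>x\<in>V. Z x))"
    and T: "open T" "T \<noteq> {}" "\<And>x. x \<in> T \<Longrightarrow> Z x"
  shows "Z p"
proof -
  define U where "U = \<Union>{T. open T \<and> (\<forall>x\<in>T. Z x)}"
  have "open U" unfolding U_def by blast
  have UZ: "Z x" if "x \<in> U" for x using that by (auto simp: U_def)
  have "closed U"
    unfolding closed_def
  proof (subst open_subopen, intro ballI)
    fix p assume p: "p \<in> - U"
    obtain V where V: "open V" "p \<in> V"
      "\<And>T. open T \<Longrightarrow> T \<subseteq> V \<Longrightarrow> T \<noteq> {} \<Longrightarrow> (\<forall>x\<in>T. Z x) \<Longrightarrow> (\<forall>x\<in>V. Z x)" using local[of p] by blast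
    have "V \<inter> U = {}"
    proof (rule ccontr)
      assume "V \<inter> U \<noteq> {}"
      then have "\<forall>x\<in>V. Z x" using V(1) \<open>open U\<close> UZ by (intro V(3)[of "V \<inter> U"]) auto
      then have "V \<subseteq> U" using V(1) by (auto simp: U_def)
      then show False using V(2) p by blast
    qed
    then show "\<exists>T. open T \<and> p \<in> T \<and> T \<subseteq> - U" using V by (intro exI[of _ V]) auto
  qed
  then have "U = {} \<or> U = UNIV" using conn \<open>open U\<close> by (simp add: connected_clopen)
  moreover have "T \<subseteq> U" using T by (auto simp: U_def)
  ultimately show ?thesis using T(2) UZ by auto
qed

lemma chart_open_image:
  assumes "is_chart c" "open T" "T \<subseteq> fst c"
  obtains T' where "open T'" "snd c ` T = T' \<inter> {q. q $ 2 \<ge> 0}"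
proof -
  have "openin (top_of_set (fst c)) T" using assms(2,3) by (auto simp: openin_open)
  then have "openin (top_of_set (chart_image c)) (snd c ` T)"
    using assms(1) unfolding is_chart_def by (metis homeomorphism_imp_open_map)
  then have "openin (top_of_set half_plane) (snd c ` T)"
    using assms(1) openin_trans unfolding is_chart_def by blast
  then obtain T' where "open T'" "snd c ` T = half_plane \<inter> T'" unfolding openin_open by blast
  then show ?thesis using that[of T'] by (auto simp: half_plane_def)
qed

lemma chart_open_ball:
  assumes c: "is_chart c" and "p \<in> fst c" "\<rho> > 0"
  shows "open (fst c \<inter> snd c -` ball (snd c p) \<rho>)" "p \<in> fst c \<inter> snd c -` ball (snd c p) \<rho>"
proof -
  have "open (fst c)" "continuous_on (fst c) (snd c)" using c by (auto simp: is_chart_def homeomorphism_def)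
  then show "open (fst c \<inter> snd c -` ball (snd c p) \<rho>)"
    using continuous_open_preimage open_ball by blast
qed (use assms in auto)

section \<open>Global continuation and symmetry of the image\<close>

context free_boundary_surface
begin

text \<open>\<open>Z\<close> relates the vectors \<open>X p\<close> and \<open>\<nu> p\<close> and
  so does not depend on charts; continuation in patches thus spreads over the connected
  surface.\<close>

lemma surface_propagation:
  fixes Z :: "real^3 \<Rightarrow> real^3 \<Rightarrow> bool"
  assumes patch: "\<And>c p r F G F' G' F''. is_patch c p r F G F' G' F'' \<Longrightarrow>
      unique_continuation (snd c p) r (\<lambda>q. Z (F q) (G q))"
    and start: "is_patch c0 p0 r0 F0 G0 F0' G0' F0''" "\<rho>0 > 0" "\<rho>0 \<le> r0"
      "\<And>q. q \<in> ball (snd c0 p0) \<rho>0 \<Longrightarrow> q $ 2 \<ge> 0 \<Longrightarrow> Z (F0 q) (G0 q)"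
  shows "Z (X p) (\<nu> p)"
proof (rule connected_propagation[where Z="\<lambda>p. Z (X p) (\<nu> p)", OF connected_surface])
  have chart_values: "snd c x \<in> half_plane \<and> F (snd c x) = X x \<and> G (snd c x) = \<nu> x"
    if "is_patch c p r F G F' G' F''" "x \<in> fst c" "snd c x \<in> ball (snd c p) r" for c p r F G F' G' F'' x
  proof -
    have ch: "is_chart c" using that(1) charts by (simp add: is_patch_def)
    have "snd c x $ 2 \<ge> 0" using chart_inv_simps(4,5)[OF ch] that(2) by blast
    then show ?thesis using that chart_inv_simps(3)[OF ch that(2)] unfolding is_patch_def half_plane_def by auto
  qed
  fix p
  obtain c where c: "c \<in> A" "p \<in> fst c" using cover by blast
  obtain r F G F' G' F'' where P: "is_patch c p r F G F' G' F''" using patch_exists[OF c] by blast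
  have ch: "is_chart c" using charts[OF c(1)] .
  obtain \<rho> where \<rho>: "\<rho> > 0" "\<rho> \<le> r" and step: "\<And>T q0 q. open T \<Longrightarrow> T \<subseteq> ball (snd c p) \<rho> \<Longrightarrow> q0 \<in> T \<Longrightarrow> q0 $ 2 \<ge> 0 \<Longrightarrow>
        (\<forall>q\<in>T. q $ 2 \<ge> 0 \<longrightarrow> Z (F q) (G q)) \<Longrightarrow> q \<in> ball (snd c p) \<rho> \<Longrightarrow> q $ 2 \<ge> 0 \<Longrightarrow> Z (F q) (G q)"
    using patch[OF P] unfolding unique_continuation_def by meson
  define V where "V = fst c \<inter> snd c -` ball (snd c p) \<rho>"
  have val: "snd c x $ 2 \<ge> 0" "F (snd c x) = X x" "G (snd c x) = \<nu> x" if "x \<in> V" for x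
    using chart_values[OF P, of x] that \<rho>(2) by (auto simp: V_def half_plane_def)
  show "\<exists>V. open V \<and> p \<in> V \<and> (\<forall>T. open T \<longrightarrow> T \<subseteq> V \<longrightarrow> T \<noteq> {} \<longrightarrow> (\<forall>x\<in>T. Z (X x) (\<nu> x)) \<longrightarrow> (\<forall>x\<in>V. Z (X x) (\<nu> x)))"
  proof (intro exI[of _ V] conjI allI impI ballI)
    show "open V" "p \<in> V" unfolding V_def using chart_open_ball[OF ch c(2) \<rho>(1)] by auto
    fix T x assume T: "open T" "T \<subseteq> V" "T \<noteq> {}" "\<forall>x\<in>T. Z (X x) (\<nu> x)" and x: "x \<in> V"
    obtain T' where T': "open T'" "snd c ` T = T' \<inter> {q. q $ 2 \<ge> 0}"
      using chart_open_image[OF ch T(1)] T(2) by (auto simp: V_def)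
    obtain x1 where x1: "x1 \<in> T" using T(3) by blast
    have "Z (F (snd c x)) (G (snd c x))"
    proof (rule step[of "T' \<inter> ball (snd c p) \<rho>" "snd c x1"])
      show "snd c x1 \<in> T' \<inter> ball (snd c p) \<rho>" "snd c x1 $ 2 \<ge> 0" "snd c x $ 2 \<ge> 0" "snd c x \<in> ball (snd c p) \<rho>"
        using x1 T(2) T'(2) x val(1) by (auto simp: V_def)
      show "\<forall>q\<in>T' \<inter> ball (snd c p) \<rho>. q $ 2 \<ge> 0 \<longrightarrow> Z (F q) (G q)"
      proof (intro ballI impI)
        fix q assume "q \<in> T' \<inter> ball (snd c p) \<rho>" "q $ 2 \<ge> 0"
        then have "q \<in> snd c ` T" using T'(2) by blast
        then obtain x2 where "x2 \<in> T" "q = snd c x2" by blast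
        then show "Z (F q) (G q)" using T(2,4) val by auto
      qed
    qed (use T' in auto)
    then show "Z (X x) (\<nu> x)" using val[OF x] by simp
  qed
next
  have c0: "c0 \<in> A" "p0 \<in> fst c0" using start(1) by (auto simp: is_patch_def)
  have ch: "is_chart c0" using charts[OF c0(1)] .
  show "open (fst c0 \<inter> snd c0 -` ball (snd c0 p0) \<rho>0)" "fst c0 \<inter> snd c0 -` ball (snd c0 p0) \<rho>0 \<noteq> {}"
    using chart_open_ball[OF ch c0(2) start(2)] by auto
  fix x assume x: "x \<in> fst c0 \<inter> snd c0 -` ball (snd c0 p0) \<rho>0"
  have half: "snd c0 x $ 2 \<ge> 0" using chart_inv_simps(4,5)[OF ch] x by blast
  then have "F0 (snd c0 x) = X x" "G0 (snd c0 x) = \<nu> x"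
    using start(1,3) x chart_inv_simps(3)[OF ch, of x] unfolding is_patch_def by auto
  then show "Z (X x) (\<nu> x)" using start(4)[of "snd c0 x"] half x by auto
qed

lemma height_propagation:
  assumes "is_patch c0 p0 r0 F0 G0 F0' G0' F0''" "\<rho>0 > 0" "\<rho>0 \<le> r0"
      "\<And>q. q \<in> ball (snd c0 p0) \<rho>0 \<Longrightarrow> q $ 2 \<ge> 0 \<Longrightarrow> a \<bullet> F0 q = k"
  shows "a \<bullet> X p = k"
proof -
  have "a \<bullet> X p - k = 0"
  proof (rule surface_propagation[where Z="\<lambda>x n. a \<bullet> x - k = 0", OF _ assms(1-3)])
    fix c p r F G F' G' F'' assume "is_patch c p r F G F' G' F''"
    then interpret minimal_patch "snd c p" r F G F' G' F'' by (simp add: is_patch_def)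
    show "unique_continuation (snd c p) r (\<lambda>q. a \<bullet> F q - k = 0)" by (rule height_unique_continuation)
  qed (use assms(4) in auto)
  then show ?thesis by simp
qed

lemma rotation_propagation:
  assumes "is_patch c0 p0 r0 F0 G0 F0' G0' F0''" "\<rho>0 > 0" "\<rho>0 \<le> r0"
      "\<And>q. q \<in> ball (snd c0 p0) \<rho>0 \<Longrightarrow> q $ 2 \<ge> 0 \<Longrightarrow> (n \<times> F0 q) \<bullet> G0 q = 0"
  shows "(n \<times> X p) \<bullet> \<nu> p = 0"
proof (rule surface_propagation[where Z="\<lambda>x m. (n \<times> x) \<bullet> m = 0", OF _ assms])
  fix c p r F G F' G' F'' assume "is_patch c p r F G F' G' F''"
  then interpret minimal_patch "snd c p" r F G F' G' F'' by (simp add: is_patch_def)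
  show "unique_continuation (snd c p) r (\<lambda>q. (n \<times> F q) \<bullet> G q = 0)" by (rule rotation_field_unique_continuation)
qed

lemma patch_at:
  assumes P: "is_patch c p r F G F' G' F''"
  shows "snd c p \<in> ball (snd c p) r" "snd c p $ 2 \<ge> 0" "F (snd c p) = X p" "G (snd c p) = \<nu> p"
proof -
  interpret minimal_patch "snd c p" r F G F' G' F'' using P by (simp add: is_patch_def)
  have ch: "is_chart c" and p: "p \<in> fst c" using P charts by (auto simp: is_patch_def)
  show 1: "snd c p \<in> ball (snd c p) r" "snd c p $ 2 \<ge> 0" using r x0 by auto
  then show "F (snd c p) = X p" "G (snd c p) = \<nu> p"
    using P chart_inv_simps(3)[OF ch p] unfolding is_patch_def by auto
qed

text \<open>Without boundary, each a \<bullet> X attains its maximum over the compact image at an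
  interior point, so it is constant near that point and then everywhere. If all coordinates are
  constant, X is not an immersion.\<close>

lemma boundary_nonempty: "surface_boundary A \<noteq> {}"
proof
  assume empty: "surface_boundary A = {}"
  have const: "\<exists>k. \<forall>p. a \<bullet> X p = k" for a
  proof -
    have "continuous_on (range X) (\<lambda>x. a \<bullet> x)" by (intro continuous_intros)
    then obtain p where max: "\<And>p'. a \<bullet> X p' \<le> a \<bullet> X p"
      using continuous_attains_sup[OF compact_range, of "\<lambda>x. a \<bullet> x"] by auto
    obtain c where c: "c \<in> A" "p \<in> fst c" using cover by blast
    obtain r F G F' G' F'' where P: "is_patch c p r F G F' G' F''" using patch_exists[OF c] by blast
    interpret minimal_patch "snd c p" r F G F' G' F'' using P by (simp add: is_patch_def)
    have ch: "is_chart c" using charts[OF c(1)] .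
    have pos: "q $ 2 > 0" if "q \<in> half" for q
    proof -
      have "q \<in> chart_image c" using P that unfolding is_patch_def by auto
      then have "chart_inv c q \<in> surface_boundary A" if "q $ 2 = 0"
        using c(1) chart_inv_simps(1,2)[OF ch, of q] that unfolding surface_boundary_def by auto
      then have "q $ 2 \<noteq> 0" using empty by blast
      then show ?thesis using that by auto
    qed
    have le: "a \<bullet> F q \<le> a \<bullet> F (snd c p)" if "q \<in> half" for q
      using P that max patch_at(3)[OF P] unfolding is_patch_def by auto
    obtain \<rho> where \<rho>: "\<rho> > 0" "\<rho> \<le> r"
      "\<And>a q. (\<And>q. q \<in> half \<Longrightarrow> a \<bullet> F q \<le> a \<bullet> F (snd c p)) \<Longrightarrow> q \<in> ball (snd c p) \<rho> \<Longrightarrow> q $ 2 > 0 \<Longrightarrow> a \<bullet> F q = a \<bullet> F (snd c p)"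
      using interior_maximum pos[of "snd c p"] patch_at(1,2)[OF P] by blast
    have "a \<bullet> F q = a \<bullet> F (snd c p)" if "q \<in> ball (snd c p) \<rho>" "q $ 2 \<ge> 0" for q
      using \<rho>(3)[OF le that(1)] pos[of q] that \<rho>(2) by auto
    then have "a \<bullet> X p' = a \<bullet> F (snd c p)" for p' using height_propagation[OF P \<rho>(1,2)] by blast
    then show ?thesis by blast
  qed
  fix p :: 'm
  obtain c where c: "c \<in> A" "p \<in> fst c" using cover by blast
  obtain r F G F' G' F'' where P: "is_patch c p r F G F' G' F''" using patch_exists[OF c] by blast
  interpret minimal_patch "snd c p" r F G F' G' F'' using P by (simp add: is_patch_def)
  have x0h: "snd c p \<in> half" using patch_at[OF P] by auto
  have "F q = F (snd c p)" if "q \<in> half" for q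
  proof (rule vec_eq_iff[THEN iffD2], rule allI)
    fix i
    obtain k where k: "\<And>p. axis i 1 \<bullet> X p = k" using const by blast
    have "F q = X (chart_inv c q)" using P that unfolding is_patch_def by auto
    then show "F q $ i = F (snd c p) $ i" using k patch_at(3)[OF P] by (simp add: inner_axis')
  qed
  from derivative_zero_on_half[where f=F, OF this x0h X'[OF patch_at(1)[OF P]]]
  have "F' (snd c p) (axis 1 1) = 0" .
  then show False using X'_nonzero[OF x0h, of "axis 1 1"] by (simp add: axis_eq_0_iff)
qed

text \<open>The curves required for invariance are images of segments q + s v in a patch. At
  interior points tangency provides v; at boundary points \<open>bd\<close> gives v along the
  boundary line, so the segment stays in the half-plane.\<close>

lemma rotationally_symmetric_range:
  assumes n: "norm n = 1" and tan: "\<And>p. (n \<times> X p) \<bullet> \<nu> p = 0"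
    and bd: "\<And>c p r F G F' G' F''. is_patch c p r F G F' G' F'' \<Longrightarrow> snd c p $ 2 = 0 \<Longrightarrow>
      \<exists>s. n \<times> X p = s *\<^sub>R F' (snd c p) (axis 1 1)"
  shows "rotationally_symmetric (range X)"
proof (rule rotationally_symmetric_of_tangent_rotation[OF compact_range n])
  fix x assume "x \<in> range X"
  then obtain p where p: "x = X p" by blast
  obtain c where c: "c \<in> A" "p \<in> fst c" using cover by blast
  obtain r F G F' G' F'' where P: "is_patch c p r F G F' G' F''" using patch_exists[OF c] by blast
  interpret minimal_patch "snd c p" r F G F' G' F'' using P by (simp add: is_patch_def)
  note at = patch_at[OF P]
  have lin: "linear (F' (snd c p))" using linX' at by blast
  obtain v where v: "F' (snd c p) v = n \<times> X p" "snd c p $ 2 = 0 \<Longrightarrow> v $ 2 = 0"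
  proof (cases "snd c p $ 2 = 0")
    case True
    obtain s where "n \<times> X p = s *\<^sub>R F' (snd c p) (axis 1 1)" using bd[OF P True] by blast
    then show ?thesis using that[of "s *\<^sub>R axis 1 1"] linear_scale[OF lin] by (simp add: axis_def)
  next
    case False
    have "(n \<times> X p) \<bullet> G (snd c p) = 0" using tan at by simp
    then obtain v where "F' (snd c p) v = n \<times> X p" using tangent_surj at by (metis Int_iff mem_Collect_eq)
    then show ?thesis using that False by blast
  qed
  define k where "k = (\<lambda>s. F (snd c p + s *\<^sub>R v))"
  have "k 0 = x" using at p by (simp add: k_def)
  moreover have "(k has_vector_derivative (n \<times> x)) (at 0)"
  proof -
    have "(k has_derivative (\<lambda>s. F' (snd c p) (s *\<^sub>R v))) (at 0)"
      unfolding k_def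
      by (rule has_derivative_compose[where f="\<lambda>s. snd c p + s *\<^sub>R v" and g=F])
         (use X'[OF at(1)] in \<open>auto intro!: derivative_eq_intros\<close>)
    then show ?thesis unfolding has_vector_derivative_def using linear_scale[OF lin] v(1) p by simp
  qed
  moreover have "\<exists>\<delta>>0. \<forall>s. 0 < s \<and> s < \<delta> \<longrightarrow> k s \<in> range X"
  proof -
    define W where "W = ball (snd c p) r \<inter> (if snd c p $ 2 = 0 then UNIV else {q. q $ 2 > 0})"
    note open_upper_half_plane
    then have "open W" by (auto simp: W_def)
    then have "open ((\<lambda>s::real. snd c p + s *\<^sub>R v) -` W)" by (intro open_vimage continuous_intros)
    moreover have "0 \<in> (\<lambda>s::real. snd c p + s *\<^sub>R v) -` W" using at by (auto simp: W_def)
    ultimately obtain \<delta> where \<delta>: "\<delta> > 0" "ball 0 \<delta> \<subseteq> (\<lambda>s::real. snd c p + s *\<^sub>R v) -` W"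
      using open_contains_ball by blast
    have "k s \<in> range X" if "0 < s" "s < \<delta>" for s
    proof -
      have W: "snd c p + s *\<^sub>R v \<in> W" using \<delta>(2) that by (auto simp: subset_iff)
      then have "snd c p + s *\<^sub>R v \<in> half"
        using v(2) by (auto simp: W_def split: if_splits)
      then show ?thesis using P unfolding is_patch_def k_def by auto
    qed
    then show ?thesis using \<delta>(1) by blast
  qed
  ultimately show "\<exists>c \<delta>. c 0 = x \<and> (c has_vector_derivative (n \<times> x)) (at 0) \<and> \<delta> > 0 \<and> (\<forall>s. 0 < s \<and> s < \<delta> \<longrightarrow> c s \<in> range X)"
    by blast
qed

lemma boundary_chart:
  assumes "p \<in> surface_boundary A"
  obtains c r F G F' G' F'' where "is_patch c p r F G F' G' F''" "snd c p $ 2 = 0"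
  using assms patch_exists unfolding surface_boundary_def by blast

lemma eigen_subspace_imp_symmetric:
  assumes eig: "eigen_subspace A X \<nu> (normal_component_span \<nu>)"
  shows "rotationally_symmetric (range X)"
proof -
  obtain M where M: "\<And>c p L. c \<in> A \<Longrightarrow> p \<in> fst c \<Longrightarrow> p \<in> surface_boundary A \<Longrightarrow>
     (\<And>a. conormal_deriv c X (\<lambda>p. a \<bullet> \<nu> p) p = a \<bullet> L) \<Longrightarrow> L = M *v \<nu> p"
    using steklov_matrix_exists[OF eig] by metis
  have bp: "boundary_patch (snd c p) r F G F' G' F'' M"
    if P: "is_patch c p r F G F' G' F''" and b: "snd c p $ 2 = 0" for c p r F G F' G' F''
  proof -
    interpret free_boundary_patch "snd c p" r F G F' G' F'' by (rule patch_free_boundary[OF P b])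
    have c: "c \<in> A" and ch: "is_chart c" using P charts by (auto simp: is_patch_def)
    show ?thesis
    proof
      fix q w assume q: "q \<in> ball (snd c p) r" "q $ 2 = 0" and w: "w $ 2 < 0" "F' q w = F q"
      have eq: "G q = \<nu> (chart_inv c q)" "q \<in> chart_image c" using P q unfolding is_patch_def by auto
      have p': "chart_inv c q \<in> fst c" "snd c (chart_inv c q) = q" using chart_inv_simps(1,2)[OF ch eq(2)] by auto
      then have "chart_inv c q \<in> surface_boundary A" using c q(2) unfolding surface_boundary_def by auto
      from M[OF c p'(1) this conormal_deriv_eq[OF P b q w]]
      show "G' q w = M *v G q" unfolding eq(1) .
    qed
  qed
  define K where "K = (\<lambda>p. X p \<bullet> (M *v \<nu> p))"
  show ?thesis
  proof (cases "\<exists>p\<in>surface_boundary A. K p \<noteq> 0")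
    case True
    then obtain p0 where p0: "p0 \<in> surface_boundary A" "K p0 \<noteq> 0" by blast
    obtain c r F G F' G' F'' where P: "is_patch c p0 r F G F' G' F''" "snd c p0 $ 2 = 0"
      using boundary_chart[OF p0(1)] .
    interpret boundary_patch "snd c p0" r F G F' G' F'' M by (rule bp[OF P])
    define n where "n = \<nu> p0 + K p0 *\<^sub>R X p0"
    have k: "\<kappa> (snd c p0) = K p0" unfolding \<kappa>_def K_def using patch_at[OF P(1)] by simp
    then have k0: "\<kappa> (snd c p0) \<noteq> 0" using p0(2) by simp
    have n: "n = G (snd c p0) + \<kappa> (snd c p0) *\<^sub>R F (snd c p0)" using k patch_at[OF P(1)] by (simp add: n_def)
    have "n \<bullet> G (snd c p0) = 1"
      using frame[OF x0_in] by (simp add: n inner_add_left)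
    then have "n \<noteq> 0" by auto
    define m where "m = (1 / norm n) *\<^sub>R n"
    have m: "norm m = 1" using \<open>n \<noteq> 0\<close> by (simp add: m_def)
    have Mv: "M *v v = (v \<bullet> n) *\<^sub>R n - v" for v using steklov_matrix[OF k0 n] .
    obtain \<rho> where \<rho>: "\<rho> > 0" "\<rho> \<le> r" "\<And>q. q \<in> ball (snd c p0) \<rho> \<Longrightarrow> q $ 2 \<ge> 0 \<Longrightarrow> (n \<times> F q) \<bullet> G q = 0"
      using curved_boundary_rotation[OF k0 n] by blast
    have tan: "(n \<times> X p) \<bullet> \<nu> p = 0" for p by (rule rotation_propagation[OF P(1) \<rho>])
    have bd: "\<exists>s. n \<times> X p = s *\<^sub>R F' (snd c p) (axis 1 1)"
      if P: "is_patch c p r F G F' G' F''" "snd c p $ 2 = 0" for c p r F G F' G' F''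
      using boundary_patch.tangent_of_axis[OF bp[OF P] Mv] patch_at(3)[OF P(1)] by simp
    show ?thesis
    proof (rule rotationally_symmetric_range[OF m])
      show "(m \<times> X p) \<bullet> \<nu> p = 0" for p using tan[of p] by (simp add: m_def cross_mult_left)
      fix c p r F G F' G' F'' assume "is_patch c p r F G F' G' F''" "snd c p $ 2 = 0"
      from bd[OF this] obtain s where "n \<times> X p = s *\<^sub>R F' (snd c p) (axis 1 1)" by blast
      then have "m \<times> X p = ((1 / norm n) * s) *\<^sub>R F' (snd c p) (axis 1 1)" by (simp add: m_def cross_mult_left)
      then show "\<exists>s. m \<times> X p = s *\<^sub>R F' (snd c p) (axis 1 1)" by blast
    qed
  next
    case False
    obtain p0 where p0: "p0 \<in> surface_boundary A" using boundary_nonempty by blast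
    obtain c r F G F' G' F'' where P: "is_patch c p0 r F G F' G' F''" "snd c p0 $ 2 = 0"
      using boundary_chart[OF p0(1)] .
    interpret boundary_patch "snd c p0" r F G F' G' F'' M by (rule bp[OF P])
    have cA: "c \<in> A" and ch: "is_chart c" using P charts by (auto simp: is_patch_def)
    have "\<kappa> q = 0" if q: "q \<in> bd" for q
    proof -
      have eq: "q \<in> chart_image c" "F q = X (chart_inv c q)" "G q = \<nu> (chart_inv c q)"
        using P q unfolding is_patch_def by auto
      have "chart_inv c q \<in> surface_boundary A"
        using chart_inv_simps(1,2)[OF ch eq(1)] cA q unfolding surface_boundary_def by auto
      then show ?thesis using False eq by (auto simp: \<kappa>_def K_def)
    qed
    from flat_boundary_height[OF this]
    obtain \<rho> where \<rho>: "\<rho> > 0" "\<rho> \<le> r" "\<And>q. q \<in> ball (snd c p0) \<rho> \<Longrightarrow> q $ 2 \<ge> 0 \<Longrightarrow> G (snd c p0) \<bullet> F q = 0"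
      by blast
    define n where "n = \<nu> p0"
    have n: "norm n = 1" using unit_\<nu> by (simp add: n_def)
    have "G (snd c p0) = n" using patch_at[OF P(1)] by (simp add: n_def)
    then have nX: "n \<bullet> X p = 0" for p using height_propagation[OF P(1) \<rho>(1,2), of n 0] \<rho>(3) by simp
    \<comment> \<open>The image lies in the plane orthogonal to n, so n is normal to the surface
      everywhere. Then n \<times> X is a multiple of \<nu> \<times> X, which is tangent and equals
      \<tau> along the boundary.\<close>
    have normal_n: "n = (n \<bullet> \<nu> p) *\<^sub>R \<nu> p" for p
    proof -
      obtain c where c: "c \<in> A" "p \<in> fst c" using cover by blast
      obtain r F G F' G' F'' where P: "is_patch c p r F G F' G' F''" using patch_exists[OF c] by blast
      interpret I: minimal_patch "snd c p" r F G F' G' F'' using P by (simp add: is_patch_def)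
      note at = patch_at[OF P]
      have x0h: "snd c p \<in> I.half" using at by auto
      have dn: "((\<lambda>q. n \<bullet> F q) has_derivative (\<lambda>v. n \<bullet> F' (snd c p) v)) (at (snd c p))"
        using I.X'[OF at(1)] by (rule has_derivative_inner_right)
      have zn: "n \<bullet> F q = 0" if "q \<in> I.half" for q using P that nX unfolding is_patch_def by auto
      have nF: "n \<bullet> F' (snd c p) v = 0" for v
        by (rule I.derivative_zero_on_half[where f="\<lambda>q. n \<bullet> F q" and c=0, OF zn x0h dn])
      define s where "s = n - (n \<bullet> \<nu> p) *\<^sub>R \<nu> p"
      have "\<nu> p \<bullet> \<nu> p = 1" using unit_\<nu> by (simp add: norm_eq_1)
      then have s: "s \<bullet> G (snd c p) = 0" using at by (simp add: s_def inner_diff_left)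
      then obtain v where v: "F' (snd c p) v = s" using I.tangent_surj[OF x0h] by blast
      have "s \<bullet> s = n \<bullet> s - (n \<bullet> \<nu> p) * (\<nu> p \<bullet> s)" by (simp add: s_def inner_diff_left)
      also have "\<dots> = 0" using nF[of v] v s at by (simp add: inner_commute)
      finally show ?thesis by (simp add: s_def)
    qed
    have nxX: "n \<times> X p = (n \<bullet> \<nu> p) *\<^sub>R (\<nu> p \<times> X p)" for p
      using arg_cong[OF normal_n[of p], of "\<lambda>y. y \<times> X p"] by (simp add: cross_mult_left)
    show ?thesis
    proof (rule rotationally_symmetric_range[OF n])
      show "(n \<times> X p) \<bullet> \<nu> p = 0" for p unfolding nxX by (simp add: dot_cross_self)
      fix c p r F G F' G' F'' assume P: "is_patch c p r F G F' G' F''" "snd c p $ 2 = 0"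
      interpret I: boundary_patch "snd c p" r F G F' G' F'' M by (rule bp[OF P])
      have "\<nu> p \<times> X p = I.\<tau> (snd c p)" using patch_at[OF P(1)] by (simp add: I.\<tau>_def)
      also have "\<dots> = (1 / I.\<l> (snd c p)) *\<^sub>R F' (snd c p) (axis 1 1)" using I.T_eq[OF I.x0_in] by simp
      finally have "n \<times> X p = ((n \<bullet> \<nu> p) * (1 / I.\<l> (snd c p))) *\<^sub>R F' (snd c p) (axis 1 1)"
        unfolding nxX by simp
      then show "\<exists>s. n \<times> X p = s *\<^sub>R F' (snd c p) (axis 1 1)" by blast
    qed
  qed
qed

end

theorem theorem1p1:
  fixes A :: "'m::{t2_space, second_countable_topology} chart set"
    and X \<nu> :: "'m \<Rightarrow> real^3"
  assumes "free_boundary_minimal_surface A X \<nu>"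
    and "eigen_subspace A X \<nu> (normal_component_span \<nu>)"
  shows "rotationally_symmetric (range X)"
proof -
  interpret free_boundary_surface A X \<nu> by (rule free_boundary_surface.intro[OF assms(1)])
  show ?thesis by (rule eigen_subspace_imp_symmetric[OF assms(2)])
qed

end
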